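(* Let $n,m$ be positive integers with $m\le\lfloor n/2\rfloor$. Let $\boldsymbol{x}=\{x_1,\dots,x_n\}$ be distinct points on the real line, and let $\boldsymbol{\xi}=\{\xi_1,\dots,\xi_m\}\subset\mathbb{C}\setminus\boldsymbol{x}$ be distinct points, closed under complex conjugation, solving the stationary relations $$-\sum_{j=1}^{n}\frac{1}{\xi_k-x_j}+\sum_{l\neq k}\frac{2}{\xi_k-\xi_l}=0,\qquad k=1,\dots,m .$$ Then there exists $R\in\mathcal{CR}_{m,n}(\boldsymbol{x})$ with $\boldsymbol{\xi}$ as finite poles and $\boldsymbol{x}$ as finite critical points. Moreover, the hulls $K_t$ generated by the multiple chordal Loewner flow with parametrization $\boldsymbol{\nu}(t)$ started from $(\boldsymbol{x},\boldsymbol{\xi})$ are subsets of the real locus $\Gamma(R)$, for any time $t$ before the collision of any poles or critical points (i.e. as long as the points $x_1(t),\dots,x_n(t),\xi_1(t),\dots,\xi_m(t)$ have stayed pairwise distinct on $[0,t]$). Up to any such time, $$R\circ g_t^{-1}\in\mathcal{CR}_{m,n}(\boldsymbol{x}(t)),$$ meaning that $R\circ g_t^{-1}$ on $\mathbb{H}$ is the restriction of an element of $\mathcal{CR}_{m,n}(\boldsymbol{x}(t))$, where $\boldsymbol{x}(t)$ is the location of the critical points at time $t$ under the flow.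
   Context: $\mathcal{CR}_{m,n}(\boldsymbol{x})$: for distinct real points $\boldsymbol{x}=\{x_1,\dots,x_n\}$, the class of rational functions $R(z)$ such that (a) $\overline{R(\bar z)}=R(z)$; (b) the finite critical points of $R$ are exactly $x_1,\dots,x_n$ and are simple; (c) the finite poles of $R$ are $m$ distinct simple poles; (d) $R$ has a pole of order $n-2m+1$ at $\infty$. Real locus: $\Gamma(R)=\{z\in\widehat{\mathbb{C}}: R(z)\in\mathbb{R}\cup\{\infty\}\}$. Multiple chordal Loewner flow (upper half-plane $\mathbb{H}$, marked point $\infty$) with parametrization $\boldsymbol{\nu}=(\nu_1,\dots,\nu_n)$, where each $\nu_i:[0,\infty)\to[0,\infty)$ is measurable: the maps $g_t$ solve $$\partial_t g_t(z)=\sum_{j=1}^n\frac{2\nu_j(t)}{g_t(z)-x_j(t)},\qquad g_0(z)=z,$$ the driving functions $x_j(t)$, with $x_j(0)=x_j$, solve $$\dot x_j=\nu_j(t)\Big(\sum_{k\neq j}\frac{2}{x_j-x_k}-\sum_{l=1}^m\frac{4}{x_j-\xi_l}\Big)+\sum_{k\neq j}\frac{2\nu_k(t)}{x_j-x_k},$$ and $\xi_l(t)=g_t(\xi_l)$ (with $g_t$ extended to the lower half-plane by reflection), so that $\dot\xi_l=\sum_j \frac{2\nu_j(t)}{\xi_l-x_j}$. For $z\in\overline{\mathbb{H}}$, $\tau_z$ is the first time at which $g_t(z)=x_j(t)$ for some $j$, and the hull is $K_t=\{z\in\overline{\mathbb{H}}:\tau_z\le t\}$. *)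

theory Defs
  imports "HOL-Complex_Analysis.Complex_Analysis"
begin

text \<open>A rational function is a quotient of coprime polynomials, seen as a function on the complex
  plane. Since division by zero gives zero, its value at a pole is 0; poles are therefore
  always detected with \<^const>\<open>is_pole\<close>, never by evaluation.\<close>

definition rational_function :: "(complex \<Rightarrow> complex) \<Rightarrow> bool" where
  "rational_function R \<longleftrightarrow>
     (\<exists>P Q :: complex poly. Q \<noteq> 0 \<and> coprime P Q \<and> R = (\<lambda>z. poly P z / poly Q z))"

definition finite_poles :: "(complex \<Rightarrow> complex) \<Rightarrow> complex set" where
  "finite_poles R = {z. is_pole R z}"

definition finite_critical_points :: "(complex \<Rightarrow> complex) \<Rightarrow> complex set" where
  "finite_critical_points R = {z. \<not> is_pole R z \<and> deriv R z = 0}"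

text \<open>The order of a pole is the negative of \<^const>\<open>zorder\<close>; the behaviour of \<open>R\<close> at infinity is the
  behaviour of \<open>R (1/w)\<close> at \<open>w = 0\<close>.\<close>

definition CR :: "nat \<Rightarrow> nat \<Rightarrow> (nat \<Rightarrow> real) \<Rightarrow> (complex \<Rightarrow> complex) set" where
  "CR m n x = {R. rational_function R \<and>
     (\<forall>z. cnj (R (cnj z)) = R z) \<and>
     finite_critical_points R = (\<lambda>j. complex_of_real (x j)) ` {1..n} \<and>
     (\<forall>z \<in> finite_critical_points R. zorder (deriv R) z = 1) \<and>
     finite (finite_poles R) \<and> card (finite_poles R) = m \<and>
     (\<forall>z \<in> finite_poles R. zorder R z = -1) \<and>
     is_pole (\<lambda>w. R (inverse w)) 0 \<and>
     zorder (\<lambda>w. R (inverse w)) 0 = - (int n - 2 * int m + 1)}"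

text \<open>The Riemann sphere is the type \<^typ>\<open>complex option\<close>, with \<^const>\<open>None\<close> as the point at infinity.\<close>

definition sphere_map :: "(complex \<Rightarrow> complex) \<Rightarrow> complex option \<Rightarrow> complex option" where
  "sphere_map R p = (case p of
       Some z \<Rightarrow> (if is_pole R z then None else Some (R z))
     | None \<Rightarrow> (if is_pole (\<lambda>w. R (inverse w)) 0 then None else Some (Lim at_infinity R)))"

definition real_locus :: "(complex \<Rightarrow> complex) \<Rightarrow> complex option set" where
  "real_locus R = {p. sphere_map R p \<in> insert None (Some ` \<real>)}"

definition upper_half_plane :: "complex set" where
  "upper_half_plane = {z. Im z > 0}"

definition stationary_relations ::
    "nat \<Rightarrow> nat \<Rightarrow> (nat \<Rightarrow> real) \<Rightarrow> (nat \<Rightarrow> complex) \<Rightarrow> bool" where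
  "stationary_relations n m x \<xi> \<longleftrightarrow> (\<forall>k\<in>{1..m}.
     - (\<Sum>j\<in>{1..n}. 1 / (\<xi> k - of_real (x j))) + (\<Sum>l\<in>{1..m} - {k}. 2 / (\<xi> k - \<xi> l)) = 0)"

definition parametrization :: "nat \<Rightarrow> (nat \<Rightarrow> real \<Rightarrow> real) \<Rightarrow> bool" where
  "parametrization n \<nu> \<longleftrightarrow>
     (\<forall>j\<in>{1..n}. \<nu> j \<in> borel_measurable (lebesgue_on {0..}) \<and> (\<forall>t\<ge>0. \<nu> j t \<ge> 0))"

text \<open>As the \<open>\<nu> j\<close> are merely measurable, differential equations in time are understood in the
  sense of Caratheodory: \<open>solves_upto T y f\<close> says that on \<open>[0, T]\<close> the path \<open>y\<close> is absolutely
  continuous with derivative \<open>f\<close> almost everywhere, where \<open>f\<close> is the right-hand side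
  evaluated along \<open>y\<close>.\<close>

definition solves_upto :: "real \<Rightarrow> (real \<Rightarrow> complex) \<Rightarrow> (real \<Rightarrow> complex) \<Rightarrow> bool" where
  "solves_upto T y f \<longleftrightarrow>
     (\<forall>t\<in>{0..T}. f absolutely_integrable_on {0..t} \<and> y t = y 0 + integral {0..t} f)"

definition hits ::
    "nat \<Rightarrow> (nat \<Rightarrow> real \<Rightarrow> real) \<Rightarrow> (real \<Rightarrow> complex \<Rightarrow> complex) \<Rightarrow> complex \<Rightarrow> real \<Rightarrow> bool" where
  "hits n x g z t \<longleftrightarrow> (\<exists>j\<in>{1..n}. g t z = of_real (x j t))"

text \<open>The time \<open>\<tau>\<^sub>z\<close>, infinite if \<open>z\<close> is never swallowed. That the infimum is attained is part of
  the definition of the flow below.\<close>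

definition swallowing_time ::
    "nat \<Rightarrow> (nat \<Rightarrow> real \<Rightarrow> real) \<Rightarrow> (real \<Rightarrow> complex \<Rightarrow> complex) \<Rightarrow> complex \<Rightarrow> ereal" where
  "swallowing_time n x g z = Inf (ereal ` {t. 0 \<le> t \<and> hits n x g z t})"

definition loewner_hull ::
    "nat \<Rightarrow> (nat \<Rightarrow> real \<Rightarrow> real) \<Rightarrow> (real \<Rightarrow> complex \<Rightarrow> complex) \<Rightarrow> real \<Rightarrow> complex set" where
  "loewner_hull n x g t = {z. Im z \<ge> 0 \<and> swallowing_time n x g z \<le> ereal t}"

text \<open>The driving functions \<open>x j t\<close> and maps \<open>g t z\<close> of the flow on the time interval \<open>[0, T]\<close>,
  started from \<open>(x0, \<xi>0)\<close>. The path \<open>\<lambda>t. g t z\<close> of a point of the closed upper half-plane solves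
  the Loewner equation strictly before \<open>\<tau>\<^sub>z\<close> and reaches one of the driving functions
  continuously at \<open>\<tau>\<^sub>z\<close>; its values after \<open>\<tau>\<^sub>z\<close> are meaningless. The poles move as
  \<open>\<xi>\<^sub>l(t) = g t (\<xi>0 l)\<close>.\<close>

definition multiple_loewner_flow ::
    "nat \<Rightarrow> nat \<Rightarrow> (nat \<Rightarrow> real \<Rightarrow> real) \<Rightarrow> (nat \<Rightarrow> real) \<Rightarrow> (nat \<Rightarrow> complex) \<Rightarrow> real \<Rightarrow>
     (nat \<Rightarrow> real \<Rightarrow> real) \<Rightarrow> (real \<Rightarrow> complex \<Rightarrow> complex) \<Rightarrow> bool" where
  "multiple_loewner_flow n m \<nu> x0 \<xi>0 T x g \<longleftrightarrow>
     (\<forall>z. Im z \<ge> 0 \<longrightarrow>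
        g 0 z = z \<and>
        continuous_on {t\<in>{0..T}. ereal t \<le> swallowing_time n x g z} (\<lambda>t. g t z) \<and>
        (\<forall>t\<in>{0..T}. ereal t < swallowing_time n x g z \<longrightarrow>
           solves_upto t (\<lambda>s. g s z)
             (\<lambda>s. \<Sum>j\<in>{1..n}. 2 * of_real (\<nu> j s) / (g s z - of_real (x j s)))) \<and>
        (swallowing_time n x g z \<le> ereal T \<longrightarrow>
           (\<exists>t\<in>{0..T}. swallowing_time n x g z = ereal t \<and> hits n x g z t))) \<and>
     (\<forall>t\<in>{0..T}. \<forall>z. Im z < 0 \<longrightarrow> g t z = cnj (g t (cnj z))) \<and>
     (\<forall>j\<in>{1..n}.
        x j 0 = x0 j \<and>
        solves_upto T (\<lambda>s. of_real (x j s))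
          (\<lambda>s. of_real (\<nu> j s) *
                 ((\<Sum>k\<in>{1..n} - {j}. 2 / (of_real (x j s) - of_real (x k s)))
                  - (\<Sum>l\<in>{1..m}. 4 / (of_real (x j s) - g s (\<xi>0 l))))
               + (\<Sum>k\<in>{1..n} - {j}. 2 * of_real (\<nu> k s) / (of_real (x j s) - of_real (x k s)))))"

definition pairwise_distinct ::
    "nat \<Rightarrow> nat \<Rightarrow> (nat \<Rightarrow> real) \<Rightarrow> (nat \<Rightarrow> complex) \<Rightarrow> bool" where
  "pairwise_distinct n m x \<xi> \<longleftrightarrow>
     inj_on x {1..n} \<and> inj_on \<xi> {1..m} \<and>
     (\<forall>j\<in>{1..n}. \<forall>l\<in>{1..m}. \<xi> l \<noteq> of_real (x j))"

end

theory Submission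
  imports Defs "HOL-Computational_Algebra.Fundamental_Theorem_Algebra"
begin

text \<open>Write \<open>F\<^sub>t(w) = \<Prod>\<^sub>j (w - x\<^sub>j(t)) / \<Prod>\<^sub>l (w - \<xi>\<^sub>l(t))\<^sup>2\<close>. The stationary relations say exactly that the
  residues of \<open>F\<^sub>0\<close> vanish, so \<open>F\<^sub>0\<close> has a rational primitive \<open>R\<close>. Along the flow each factor
  \<open>g\<^sub>t(z) - x\<^sub>j\<close>, \<open>g\<^sub>t(z) - \<xi>\<^sub>l\<close> and each difference \<open>g\<^sub>t(z) - g\<^sub>t(z')\<close> solves a linear equation, hence
  is an exponential. This makes \<open>g\<^sub>t\<close> holomorphic and injective, and shows that \<open>F\<^sub>t(g\<^sub>t(z)) g\<^sub>t'(z)\<close> is an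
  integral of motion. The defect in a stationary relation solves a linear equation too, so \<open>F\<^sub>t\<close> has
  a primitive \<open>R\<^sub>t\<close>, and \<open>R\<^sub>t - R \<circ> g\<^sub>t\<^sup>-\<^sup>1\<close> is constant on the half-plane; the constant is real because
  both functions are real at far real points, which are never swallowed. When \<open>z\<close> is swallowed at time
  \<open>\<tau>\<close>, \<open>Im R(z) = Im R\<^sub>t(g\<^sub>t(z))\<close> tends to \<open>0\<close> as \<open>t \<rightarrow> \<tau>\<close>, because \<open>g\<^sub>t(z)\<close> tends to a real point away
  from the poles and \<open>R\<^sub>t\<close> is real on the line with bounded derivative.

  The weights \<open>\<nu>\<^sub>j\<close> are only assumed measurable; that they are integrable as long as no
  points collide follows from the fact that nonnegative weights which move neither the \<open>x\<^sub>j\<close> nor the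
  \<open>\<xi>\<^sub>l\<close> must vanish, by compactness.\<close>

section \<open>Absolutely continuous paths\<close>

text \<open>With merely measurable weights the velocities are only integrable in time, so classical
  ODE theory does not apply; most dynamical claims are cast as scalar linear equations and solved by
  an integrating factor. This needs integrable coefficients, so integrability of the weights has to
  precede the analysis of \<open>g\<close>, and the facts it rests on (reality and conjugation of
  the poles) have to be proved without it. For \<open>R = P / Q\<close> the derivative is
  \<open>(P' Q - P Q') / Q\<^sup>2\<close>, so finding \<open>R\<close> means solving a Wronskian
  equation for the polynomial \<open>P\<close>. The equation determines \<open>P\<close> only up to
  multiples of \<open>Q\<close>, that is \<open>R\<^sub>t\<close> up to a constant. As
  \<open>g\<^sub>t\<close> is never expanded at infinity, the constant is read off at real points
  far to the right. Conservation holds at unswallowed points and says nothing at the swallowing time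
  itself. One has to work at earlier times \<open>s\<close>, where the primitive
  \<open>R\<^sub>s\<close> varies with \<open>s\<close>; what is controlled uniformly in
  \<open>s\<close> is only its derivative \<open>F\<^sub>s\<close>, and that suffices.\<close>

lemma absolutely_integrable_continuous_mult:
  fixes f \<phi> :: "real \<Rightarrow> complex"
  assumes "continuous_on {a..b} \<phi>" "f absolutely_integrable_on {a..b}"
  shows "(\<lambda>s. \<phi> s * f s) absolutely_integrable_on {a..b}"
proof (rule absolutely_integrable_bounded_measurable_product[where h = "(*)"])
  show "bilinear ((*) :: complex \<Rightarrow> _)"
    using bilinear_conv_bounded_bilinear bounded_bilinear_mult by blast
  show "bounded (\<phi> ` {a..b})"
    using assms(1) compact_continuous_image compact_imp_bounded by blast
qed (use assms in \<open>auto intro: continuous_imp_measurable_on_sets_lebesgue\<close>)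

text \<open>The running integral of \<open>norm f\<close> is the variation function that replaces
  elapsed time when the velocity \<open>f\<close> may be unbounded.\<close>

lemma integral_diff_norm_le:
  fixes h :: "real \<Rightarrow> complex"
  assumes h: "h absolutely_integrable_on {0..T}" and f: "f absolutely_integrable_on {0..T}"
    and "0 \<le> a" "a \<le> b" "b \<le> T" and le: "\<And>r. r \<in> {a..b} \<Longrightarrow> norm (h r) \<le> c * norm (f r :: complex)"
  shows "norm (integral {0..b} h - integral {0..a} h) 
    \<le> c * (integral {0..b} (\<lambda>r. norm (f r)) - integral {0..a} (\<lambda>r. norm (f r)))"
proof -
  have sub: "k integrable_on {a'..b'}" 
    if "k integrable_on {0..T}" "0 \<le> a'" "b' \<le> T" for k :: "real \<Rightarrow> 'a::banach" and a' b'
    using that integrable_on_subinterval by (metis atLeastatMost_subset_iff)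
  have hi: "h integrable_on {0..T}" and ni: "(\<lambda>r. norm (f r)) integrable_on {0..T}"
    using h f by (auto simp: absolutely_integrable_on_def)
  have "integral {0..b} h - integral {0..a} h = integral {a..b} h"
    using Henstock_Kurzweil_Integration.integral_combine[of 0 a b h] integrable_on_subinterval[OF hi, of 0 b] assms(3-5) by (auto simp: algebra_simps)
  moreover have "integral {0..b} (\<lambda>r. norm (f r)) - integral {0..a} (\<lambda>r. norm (f r)) = integral {a..b} (\<lambda>r. norm (f r))"
    using Henstock_Kurzweil_Integration.integral_combine[of 0 a b "\<lambda>r. norm (f r)"] integrable_on_subinterval[OF ni, of 0 b] assms(3-5) by (auto simp: algebra_simps)
  moreover have "norm (integral {a..b} h) \<le> integral {a..b} (\<lambda>r. c * norm (f r))"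
    using assms(3-5) integrable_on_subinterval[OF hi, of a b] integrable_on_subinterval[OF ni, of a b]
    by (intro Henstock_Kurzweil_Integration.integral_norm_bound_integral le integrable_on_mult_right) auto
  ultimately show ?thesis by simp
qed

lemma solves_uptoI:
  assumes "f absolutely_integrable_on {0..T}" "\<And>t. t \<in> {0..T} \<Longrightarrow> y t = y 0 + integral {0..t} f"
  shows "solves_upto T y f"
  unfolding solves_upto_def
proof (intro ballI conjI assms(2))
  fix t assume "t \<in> {0..T}"
  then show "f absolutely_integrable_on {0..t}"
    by (intro absolutely_integrable_on_subinterval[OF assms(1)]) auto
qed

lemma solves_uptoD:
  assumes "solves_upto T y f"
  shows "f absolutely_integrable_on {0..T}" "t \<in> {0..T} \<Longrightarrow> y t = y 0 + integral {0..t} f"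
proof -
  show "f absolutely_integrable_on {0..T}"
  proof (cases "0 \<le> T")
    case True
    then show ?thesis using assms unfolding solves_upto_def by (metis atLeastAtMost_iff order_refl)
  qed simp
  show "t \<in> {0..T} \<Longrightarrow> y t = y 0 + integral {0..t} f"
    using assms unfolding solves_upto_def by blast
qed

lemma solves_upto_mono: "solves_upto T y f \<Longrightarrow> T' \<le> T \<Longrightarrow> solves_upto T' y f"
  unfolding solves_upto_def by (meson atLeastAtMost_iff order_trans)

lemma solves_upto_cong:
  assumes "solves_upto T y f" "\<And>s. s \<in> {0..T} \<Longrightarrow> f s = f' s" "\<And>s. s \<in> {0..T} \<Longrightarrow> y s = y' s"
  shows "solves_upto T y' f'"
proof (rule solves_uptoI)
  show "f' absolutely_integrable_on {0..T}"
    using solves_uptoD(1)[OF assms(1)] assms(2) set_integrable_cong[of lebesgue lebesgue "{0..T}" "{0..T}" f f'] by auto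
  fix t assume t: "t \<in> {0..T}"
  have "integral {0..t} f' = integral {0..t} f"
    using t assms(2) by (intro integral_cong) auto
  then show "y' t = y' 0 + integral {0..t} f'"
    using solves_uptoD(2)[OF assms(1) t] assms(3)[of t] assms(3)[of 0] t by auto
qed

lemma solves_upto_continuous:
  assumes "solves_upto T y f" shows "continuous_on {0..T} y"
proof -
  have "f integrable_on {0..T}" using solves_uptoD(1)[OF assms] by (simp add: absolutely_integrable_on_def)
  then have "continuous_on {0..T} (\<lambda>t. y 0 + integral {0..t} f)"
    by (intro continuous_intros indefinite_integral_continuous_1)
  then show ?thesis
    by (rule continuous_on_eq) (rule solves_uptoD(2)[OF assms, symmetric])
qed

lemma solves_upto_const: "solves_upto T (\<lambda>_. c) (\<lambda>_. 0)"
  by (rule solves_uptoI) auto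

text \<open>Only real linearity is asked of \<open>L\<close>, so complex conjugation and the
  imaginary part qualify.\<close>

lemma solves_upto_linear_image:
  assumes "solves_upto T y f" "bounded_linear L"
  shows "solves_upto T (\<lambda>t. L (y t)) (\<lambda>t. L (f t))"
proof (rule solves_uptoI)
  show "(\<lambda>t. L (f t)) absolutely_integrable_on {0..T}"
    using absolutely_integrable_linear[OF solves_uptoD(1)[OF assms(1)] assms(2)] by (simp add: o_def)
  fix t assume t: "t \<in> {0..T}"
  have "f integrable_on {0..t}"
    using t assms(1) by (auto simp: solves_upto_def absolutely_integrable_on_def)
  then show "L (y t) = L (y 0) + integral {0..t} (\<lambda>t. L (f t))"
    using integral_linear[OF _ assms(2), of f "{0..t}"] linear_add[OF bounded_linear.linear[OF assms(2)]]
     solves_uptoD(2)[OF assms(1) t]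
    by (simp add: o_def)
qed

lemma solves_upto_add:
  assumes "solves_upto T y f" "solves_upto T z g"
  shows "solves_upto T (\<lambda>t. y t + z t) (\<lambda>t. f t + g t)"
proof (rule solves_uptoI)
  show "(\<lambda>t. f t + g t) absolutely_integrable_on {0..T}"
    by (intro set_integral_add solves_uptoD[OF assms(1)] solves_uptoD[OF assms(2)])
  fix t assume t: "t \<in> {0..T}"
  have "f integrable_on {0..t}" "g integrable_on {0..t}"
    using t assms by (auto simp: solves_upto_def absolutely_integrable_on_def)
  then have "integral {0..t} (\<lambda>t. f t + g t) = integral {0..t} f + integral {0..t} g"
    by (rule Henstock_Kurzweil_Integration.integral_add)
  then show "y t + z t = y 0 + z 0 + integral {0..t} (\<lambda>t. f t + g t)"
    using solves_uptoD(2)[OF assms(1) t] solves_uptoD(2)[OF assms(2) t] by simp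
qed

lemma solves_upto_cmult: "solves_upto T y f \<Longrightarrow> solves_upto T (\<lambda>t. c * y t) (\<lambda>t. c * f t)"
  by (rule solves_upto_linear_image[OF _ bounded_linear_mult_right])

lemma solves_upto_diff:
  assumes "solves_upto T y f" "solves_upto T z g"
  shows "solves_upto T (\<lambda>t. y t - z t) (\<lambda>t. f t - g t)"
  using solves_upto_add[OF assms(1) solves_upto_cmult[OF assms(2), of "-1"]] by simp

lemma solves_upto_sum:
  assumes "\<And>i. i \<in> I \<Longrightarrow> solves_upto T (y i) (f i)"
  shows "solves_upto T (\<lambda>t. \<Sum>i\<in>I. y i t) (\<lambda>t. \<Sum>i\<in>I. f i t)"
  using assms
proof (induction I rule: infinite_finite_induct)
  case (insert i I)
  then show ?case using solves_upto_add[of T "y i" "f i"] by simp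
qed (simp_all add: solves_upto_const)

text \<open>Differentiation almost everywhere is avoided. The defect \<open>\<Phi>\<close> between
  \<open>G (y t)\<close> and the candidate integral has, near every point, increments at most
  \<open>e\<close> times those of the variation \<open>M\<close>; gluing such intervals bounds the
  total defect by \<open>e * M t\<close> for every \<open>e > 0\<close>.\<close>

lemma solves_upto_chain:
  assumes y: "solves_upto T y f"
    and G: "\<And>t. t \<in> {0..T} \<Longrightarrow> (G has_field_derivative G' (y t)) (at (y t))"
    and G': "continuous_on {0..T} (\<lambda>t. G' (y t))"
  shows "solves_upto T (\<lambda>t. G (y t)) (\<lambda>t. G' (y t) * f t)"
proof (rule solves_uptoI)
  note f = solves_uptoD(1)[OF y]
  show J: "(\<lambda>t. G' (y t) * f t) absolutely_integrable_on {0..T}"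
    by (rule absolutely_integrable_continuous_mult[OF G' f])
  define \<Phi> where "\<Phi> = (\<lambda>t. G (y t) - integral {0..t} (\<lambda>t. G' (y t) * f t))"
  define M where "M = (\<lambda>t. integral {0..t} (\<lambda>r. norm (f r)))"
  have M0: "M 0 = 0" by (simp add: M_def)
  have yc: "continuous_on {0..T} y" using solves_upto_continuous[OF y] .
  have local: "\<exists>d>0. \<forall>u\<in>{0..T}. \<bar>u - x\<bar> < d \<longrightarrow> norm (\<Phi> u - \<Phi> x) \<le> e * \<bar>M u - M x\<bar>"
    if x: "x \<in> {0..T}" and e: "e > 0" for x e
  proof -
    have "(G has_derivative (\<lambda>h. G' (y x) * h)) (at (y x))"
      using G[OF x] by (simp add: has_field_derivative_def)
    then obtain d1 where d1: "d1 > 0" "\<And>v. norm (v - y x) < d1 \<Longrightarrow> 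
        norm (G v - G (y x) - G' (y x) * (v - y x)) \<le> e/2 * norm (v - y x)"
      using e unfolding has_derivative_at_alt by (metis half_gt_zero)
    obtain d2 where d2: "d2 > 0" "\<And>u. u \<in> {0..T} \<Longrightarrow> \<bar>u - x\<bar> < d2 \<Longrightarrow> norm (y u - y x) < d1"
      using yc x d1(1) unfolding continuous_on_iff dist_norm real_norm_def by metis
    obtain d3 where d3: "d3 > 0" "\<And>u. u \<in> {0..T} \<Longrightarrow> \<bar>u - x\<bar> < d3 \<Longrightarrow> norm (G' (y u) - G' (y x)) < e/2"
      using G' x e half_gt_zero[OF e] unfolding continuous_on_iff dist_norm real_norm_def by metis
    have "norm (\<Phi> u - \<Phi> x) \<le> e * \<bar>M u - M x\<bar>" if u: "u \<in> {0..T}" and ux: "\<bar>u - x\<bar> < min d2 d3" for u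
    proof -
      let ?h = "\<lambda>r. (G' (y r) - G' (y x)) * f r"
      have hi: "?h absolutely_integrable_on {0..T}"
        by (intro absolutely_integrable_continuous_mult f continuous_intros G')
      have key1: "norm (integral {0..b} ?h - integral {0..a} ?h) \<le> e/2 * (M b - M a) 
         \<and> norm (integral {0..b} f - integral {0..a} f) \<le> 1 * (M b - M a)"
        if ab: "a \<le> b" "0 \<le> a" "b \<le> T" "\<And>r. r \<in> {a..b} \<Longrightarrow> \<bar>r - x\<bar> < d3" for a b
        unfolding M_def
      proof (intro conjI integral_diff_norm_le[OF hi f] integral_diff_norm_le[OF f f] ab)
        fix r assume "r \<in> {a..b}"
        then have "norm (G' (y r) - G' (y x)) \<le> e/2" using d3(2)[of r] ab by fastforce
        then show "norm (?h r) \<le> e/2 * norm (f r)"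
          unfolding norm_mult by (rule mult_right_mono) simp
      qed auto
      have key: "norm (integral {0..u} ?h - integral {0..x} ?h) \<le> e/2 * \<bar>M u - M x\<bar>
         \<and> norm (integral {0..u} f - integral {0..x} f) \<le> \<bar>M u - M x\<bar>"
      proof (cases "x \<le> u")
        case True
        show ?thesis using key1[OF True] x u ux e
          by (smt (verit, ccfv_SIG) atLeastAtMost_iff norm_ge_zero mult_left_mono)
      next
        case False
        then show ?thesis using key1[of u x] x u ux e
          by (smt (verit, ccfv_SIG) atLeastAtMost_iff norm_ge_zero mult_left_mono norm_minus_commute)
      qed
      have split: "integral {0..v} ?h = integral {0..v} (\<lambda>t. G' (y t) * f t) - G' (y x) * integral {0..v} f" 
        if "v \<in> {0..T}" for v
      proof -
        have 1: "f integrable_on {0..v}" "(\<lambda>t. G' (y t) * f t) integrable_on {0..v}"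
          using J f that unfolding absolutely_integrable_on_def
          by (auto intro: integrable_on_subinterval)
        have "integral {0..v} ?h = integral {0..v} (\<lambda>r. G' (y r) * f r - G' (y x) * f r)"
          by (simp add: left_diff_distrib)
        also have "\<dots> = integral {0..v} (\<lambda>t. G' (y t) * f t) - integral {0..v} (\<lambda>r. G' (y x) * f r)"
          using 1 by (intro Henstock_Kurzweil_Integration.integral_diff integrable_on_mult_right) auto
        finally show ?thesis by simp
      qed
      have yd: "y u - y x = integral {0..u} f - integral {0..x} f"
        using solves_uptoD(2)[OF y u] solves_uptoD(2)[OF y x] by simp
      \<comment> \<open>The first bracket is the remainder of \<open>G\<close> at
        \<open>y x\<close>, the second collects the oscillation of \<open>G'\<close> along
        \<open>y\<close>; each receives half of \<open>e\<close>.\<close>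
      have "\<Phi> u - \<Phi> x = (G (y u) - G (y x) - G' (y x) * (y u - y x)) 
          - (integral {0..u} ?h - integral {0..x} ?h)"
        unfolding \<Phi>_def split[OF u] split[OF x] yd by (simp add: algebra_simps)
      also have "norm \<dots> \<le> e/2 * norm (y u - y x) + e/2 * \<bar>M u - M x\<bar>"
        by (rule order_trans[OF norm_triangle_ineq4]) (use d1(2)[OF d2(2)[OF u]] ux key in auto)
      also have "\<dots> \<le> e/2 * \<bar>M u - M x\<bar> + e/2 * \<bar>M u - M x\<bar>"
        using key e unfolding yd by (intro add_mono mult_left_mono) auto
      finally show ?thesis by simp
    qed
    then show ?thesis using d2(1) d3(1) by (intro exI[of _ "min d2 d3"]) auto
  qed
  have mono: "M a \<le> M b" if "0 \<le> a" "a \<le> b" "b \<le> T" for a b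
    using integral_diff_norm_le[OF f f that, of 1] unfolding M_def by (smt (verit) norm_ge_zero mult_1)
  fix t assume t: "t \<in> {0..T}"
  have "norm (\<Phi> t - \<Phi> 0) \<le> e * (M t - M 0)" if e: "e > 0" for e
  proof -
    have "0 \<le> t" using t by auto
    \<comment> \<open>Interval induction: an estimate that is additive over adjacent intervals and
      holds on all short intervals around each point holds on \<open>{0..t}\<close>. The trivial
      \<open>0 \<le> 0\<close> gives the goal the shape of \<open>P\<close> at the
      endpoints.\<close>
    then have "0 \<le> (0::real) \<and> t \<le> T \<longrightarrow> norm (\<Phi> t - \<Phi> 0) \<le> e * (M t - M 0)"
    proof (induction rule: Bolzano[where P = "\<lambda>a b. 0 \<le> a \<and> b \<le> T \<longrightarrow> norm (\<Phi> b - \<Phi> a) \<le> e * (M b - M a)"])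
      case (trans a b c)
      show ?case
      proof
        assume "0 \<le> a \<and> c \<le> T"
        then have "norm (\<Phi> b - \<Phi> a) \<le> e * (M b - M a)" "norm (\<Phi> c - \<Phi> b) \<le> e * (M c - M b)"
          using trans by auto
        moreover have "norm (\<Phi> c - \<Phi> a) \<le> norm (\<Phi> b - \<Phi> a) + norm (\<Phi> c - \<Phi> b)"
          by (metis add.commute diff_add_cancel add_diff_eq norm_triangle_ineq)
        ultimately show "norm (\<Phi> c - \<Phi> a) \<le> e * (M c - M a)"
          by (simp add: algebra_simps)
      qed
    next
      case (local x)
      then have x: "x \<in> {0..T}" using t by auto
      obtain d where d: "d > 0" "\<And>u. u \<in> {0..T} \<Longrightarrow> \<bar>u - x\<bar> < d \<Longrightarrow> norm (\<Phi> u - \<Phi> x) \<le> e * \<bar>M u - M x\<bar>"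
        using \<open>\<And>x e. x \<in> {0..T} \<Longrightarrow> e > 0 \<Longrightarrow> _\<close>[OF x e] by blast
      show ?case
      proof (intro exI[of _ d] conjI allI impI d(1))
        fix a b assume ab: "a \<le> x \<and> x \<le> b \<and> b - a < d" and 0: "0 \<le> a \<and> b \<le> T"
        have "norm (\<Phi> b - \<Phi> x) \<le> e * (M b - M x)" using d(2)[of b] ab 0 mono[of x b] x by auto
        moreover have "norm (\<Phi> a - \<Phi> x) \<le> e * (M x - M a)" using d(2)[of a] ab 0 mono[of a x] x by auto
        moreover have "norm (\<Phi> b - \<Phi> a) \<le> norm (\<Phi> b - \<Phi> x) + norm (\<Phi> a - \<Phi> x)"
          by (metis norm_triangle_ineq4 add_diff_cancel_left' diff_add_cancel diff_diff_eq2)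
        ultimately show "norm (\<Phi> b - \<Phi> a) \<le> e * (M b - M a)"
          by (simp add: algebra_simps)
      qed
    qed
    then show ?thesis using t by auto
  qed
  note small = this
  have "norm (\<Phi> t - \<Phi> 0) = 0"
  proof (rule ccontr)
    assume n0: "norm (\<Phi> t - \<Phi> 0) \<noteq> 0"
    \<comment> \<open>Makes \<open>e * (M t + 1)\<close> half of the supposedly positive norm; the
      added 1 covers \<open>M t = 0\<close>.\<close>
    define e where "e = norm (\<Phi> t - \<Phi> 0) / (2 * (M t + 1))"
    have "M t \<ge> 0" using mono[of 0 t] t M0 by auto
    then have e: "e > 0" using n0 unfolding e_def by auto
    have "norm (\<Phi> t - \<Phi> 0) \<le> e * (M t + 1)"
      using small[OF e] M0 e by (simp add: algebra_simps)
    also have "\<dots> = norm (\<Phi> t - \<Phi> 0) / 2" using \<open>M t \<ge> 0\<close> unfolding e_def by (simp add: field_simps)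
    finally show False using n0 by auto
  qed
  then show "G (y t) = G (y 0) + integral {0..t} (\<lambda>t. G' (y t) * f t)"
    by (simp add: \<Phi>_def diff_eq_eq)
qed

text \<open>Polarization: \<open>4 y z = (y + z)\<^sup>2 - (y - z)\<^sup>2\<close> reduces the
  product rule to the one-variable chain rule for squares.\<close>

lemma solves_upto_mult:
  assumes "solves_upto T y f" "solves_upto T z g"
  shows "solves_upto T (\<lambda>t. y t * z t) (\<lambda>t. f t * z t + y t * g t)"
proof -
  have sq: "solves_upto T (\<lambda>t. (u t)\<^sup>2) (\<lambda>t. 2 * u t * h t)" if "solves_upto T u h" for u h
    by (rule solves_upto_chain[OF that, where G = "\<lambda>w. w\<^sup>2" and G' = "\<lambda>w. 2 * w"])
       (auto intro!: derivative_eq_intros continuous_intros solves_upto_continuous[OF that])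
  show ?thesis
    by (rule solves_upto_cong[OF solves_upto_cmult[OF solves_upto_diff[OF 
       sq[OF solves_upto_add[OF assms]] sq[OF solves_upto_diff[OF assms]]], where c = "1/4"]])
       (auto simp: algebra_simps power2_eq_square)
qed

lemma solves_upto_inverse:
  assumes "solves_upto T y f" "\<And>t. t \<in> {0..T} \<Longrightarrow> y t \<noteq> 0"
  shows "solves_upto T (\<lambda>t. 1 / y t) (\<lambda>t. - f t / (y t)\<^sup>2)"
proof -
  have "solves_upto T (\<lambda>t. 1 / y t) (\<lambda>t. - (1 / (y t)\<^sup>2) * f t)"
    by (rule solves_upto_chain[OF assms(1), where G = "\<lambda>w. 1 / w" and G' = "\<lambda>w. - (1 / w\<^sup>2)"])
       (auto intro!: derivative_eq_intros continuous_intros solves_upto_continuous[OF assms(1)] assms(2)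
        simp: power2_eq_square assms(2))
  then show ?thesis by (rule solves_upto_cong) auto
qed

text \<open>Integrating factor: the product of \<open>y\<close> with
  \<open>exp (- integral {0..t} a)\<close> has zero velocity. The formula yields uniqueness and
  nonvanishing at once.\<close>

lemma solves_upto_linear_ode:
  assumes y: "solves_upto T y (\<lambda>s. a s * y s)" and a: "a absolutely_integrable_on {0..T}"
    and t: "t \<in> {0..T}"
  shows "y t = y 0 * exp (integral {0..t} a)"
proof -
  have A: "solves_upto T (\<lambda>t. - integral {0..t} a) (\<lambda>t. - a t)"
    using solves_upto_cmult[OF solves_uptoI[OF a, of "\<lambda>t. integral {0..t} a"], of "-1"] by simp
  have E: "solves_upto T (\<lambda>t. exp (- integral {0..t} a)) (\<lambda>t. exp (- integral {0..t} a) * (- a t))"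
    by (rule solves_upto_chain[OF A, where G = exp and G' = exp])
       (auto intro!: derivative_eq_intros continuous_intros solves_upto_continuous[OF A])
  have "solves_upto T (\<lambda>t. y t * exp (- integral {0..t} a)) (\<lambda>_. 0)"
    by (rule solves_upto_cong[OF solves_upto_mult[OF y E]]) auto
  from solves_uptoD(2)[OF this t] have "y t * exp (- integral {0..t} a) = y 0" by simp
  then show ?thesis by (simp add: exp_minus field_simps)
qed

section \<open>Rational functions with prescribed critical points and poles\<close>

text \<open>Indexing the roots by a family, not a set, keeps track of each root as it moves in time.
  For infinite \<open>I\<close> the product defaults to \<open>1\<close>.\<close>

definition root_poly :: "('i \<Rightarrow> 'a) \<Rightarrow> 'i set \<Rightarrow> 'a::idom poly" where
  "root_poly r I = (\<Prod>i\<in>I. [:- r i, 1:])"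

lemma poly_root_poly [simp]: "poly (root_poly r I) a = (\<Prod>i\<in>I. a - r i)"
  by (simp add: root_poly_def poly_prod)

lemma root_poly_nonzero [simp]: "root_poly r I \<noteq> 0"
  by (cases "finite I") (auto simp: root_poly_def)

lemma degree_root_poly: "finite I \<Longrightarrow> degree (root_poly r I) = card I"
  by (induction I rule: finite_induct) (auto simp: root_poly_def degree_mult_eq simp del: mult_pCons_left mult_pCons_right)

lemma root_poly_remove:
  "finite I \<Longrightarrow> i \<in> I \<Longrightarrow> root_poly r I = [:- r i, 1:] * root_poly r (I - {i})"
  by (simp add: root_poly_def prod.remove[of I i])

lemma pderiv_root_poly_remove:
  fixes r :: "'i \<Rightarrow> 'a::{idom,semiring_char_0}"
  assumes "finite I" "i \<in> I"
  shows "pderiv (root_poly r I) = root_poly r (I - {i}) + [:- r i, 1:] * pderiv (root_poly r (I - {i}))"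
  unfolding root_poly_remove[OF assms] by (simp add: pderiv_mult pderiv_pCons del: mult_pCons_left mult_pCons_right)

text \<open>The logarithmic derivative cleared of denominators. It translates between derivatives of
  polynomials and the sums of reciprocals in the stationary relations.\<close>

lemma poly_pderiv_root_poly:
  fixes r :: "'i \<Rightarrow> 'a::field_char_0"
  assumes "finite I" "a \<notin> r ` I"
  shows "poly (pderiv (root_poly r I)) a = (\<Prod>i\<in>I. a - r i) * (\<Sum>i\<in>I. 1 / (a - r i))"
  using assms
proof (induction I rule: finite_induct)
  case (insert i I)
  have "poly (pderiv (root_poly r (insert i I))) a
      = (\<Prod>i\<in>I. a - r i) + (a - r i) * poly (pderiv (root_poly r I)) a"
    using pderiv_root_poly_remove[of "insert i I" i r] insert.hyps by (simp add: left_diff_distrib)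
  with insert show ?case by (simp add: distrib_left)
qed (simp add: root_poly_def)

lemma poly_antiderivative_exists:
  fixes E :: "'a::field_char_0 poly"
  shows "\<exists>F. pderiv F = E"
proof
  have "pderiv (\<Sum>i\<le>degree E. monom (coeff E i / of_nat (Suc i)) (Suc i)) = (\<Sum>i\<le>degree E. monom (coeff E i) i)"
    by (simp add: higher_pderiv_sum[of 1, simplified] pderiv_monom del: of_nat_Suc)
  then show "pderiv (\<Sum>i\<le>degree E. monom (coeff E i / of_nat (Suc i)) (Suc i)) = E"
    by (simp add: poly_as_sum_of_monoms)
qed

lemma square_dvd_of_double_root:
  fixes N :: "'a::{idom,semiring_char_0} poly"
  assumes "poly N a = 0" "poly (pderiv N) a = 0"
  shows "[:- a, 1:]\<^sup>2 dvd N"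
proof -
  obtain M where M: "N = [:- a, 1:] * M" using assms(1) by (auto simp: poly_eq_0_iff_dvd elim: dvdE)
  then have "poly M a = 0" using assms(2) by (simp add: pderiv_mult pderiv_pCons del: mult_pCons_left mult_pCons_right)
  then have "[:- a, 1:] dvd M" by (simp add: poly_eq_0_iff_dvd)
  then show ?thesis unfolding M power2_eq_square by (rule mult_dvd_mono[OF dvd_refl])
qed

text \<open>At a new root \<open>r i\<close> the factor already split off does not vanish, so the
  full order of \<open>N\<close> there passes to the cofactor \<open>M\<close>.\<close>

lemma root_poly_square_dvd:
  fixes N :: "'a::idom poly"
  assumes "finite I" "inj_on r I" "\<And>i. i \<in> I \<Longrightarrow> [:- r i, 1:]\<^sup>2 dvd N"
  shows "(root_poly r I)\<^sup>2 dvd N"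
  using assms
proof (induction I rule: finite_induct)
  case (insert i I)
  then obtain M where M: "N = (root_poly r I)\<^sup>2 * M" by (auto elim: dvdE)
  have ne: "poly ((root_poly r I)\<^sup>2) (r i) \<noteq> 0" using insert.hyps insert.prems(1) by (auto simp: inj_on_def)
  have "[:- r i, 1:]\<^sup>2 dvd M"
  proof (cases "M = 0")
    case False
    then have "N \<noteq> 0" by (simp add: M)
    then have "2 \<le> order (r i) N" using insert.prems(2)[of i] by (simp add: order_divides)
    also have "order (r i) N = order (r i) ((root_poly r I)\<^sup>2) + order (r i) M"
      using \<open>N \<noteq> 0\<close> M order_mult by blast
    also have "\<dots> = order (r i) M" using ne by (simp add: order_0I)
    finally show ?thesis by (simp add: order_divides)
  qed simp
  then have "(root_poly r I)\<^sup>2 * [:- r i, 1:]\<^sup>2 dvd N" unfolding M by (rule mult_dvd_mono[OF dvd_refl])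
  moreover have "(root_poly r (insert i I))\<^sup>2 = (root_poly r I)\<^sup>2 * [:- r i, 1:]\<^sup>2"
    using insert.hyps by (simp add: root_poly_def power_mult_distrib mult.commute del: mult_pCons_left mult_pCons_right)
  ultimately show ?case by simp
qed (simp add: root_poly_def)

lemma pairwise_distinctD:
  assumes "pairwise_distinct n m x \<xi>"
  shows "inj_on x {1..n}" "inj_on \<xi> {1..m}" "inj_on (\<lambda>j. complex_of_real (x j)) {1..n}"
    "\<And>j l. j \<in> {1..n} \<Longrightarrow> l \<in> {1..m} \<Longrightarrow> \<xi> l \<noteq> complex_of_real (x j)"
proof -
  show "inj_on x {1..n}" "inj_on \<xi> {1..m}"
    "\<And>j l. j \<in> {1..n} \<Longrightarrow> l \<in> {1..m} \<Longrightarrow> \<xi> l \<noteq> complex_of_real (x j)"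
    using assms unfolding pairwise_distinct_def by blast+
  then show "inj_on (\<lambda>j. complex_of_real (x j)) {1..n}"
    by (meson inj_onD inj_onI of_real_eq_iff)
qed

lemma map_poly_cnj_mult: "map_poly cnj (p * q) = map_poly cnj p * map_poly cnj q"
  by (rule poly_ext) simp

lemma map_poly_cnj_diff: "map_poly cnj (p - q) = map_poly cnj p - map_poly cnj q"
  by (rule poly_ext) simp

lemma map_poly_cnj_pderiv: "map_poly cnj (pderiv p) = pderiv (map_poly cnj p)"
  by (rule poly_eqI) (simp add: coeff_map_poly coeff_pderiv)

lemma map_poly_cnj_root_poly:
  assumes "finite I" "inj_on r I" "cnj ` (r ` I) = r ` I"
  shows "map_poly cnj (root_poly r I) = root_poly r I"
proof (rule poly_ext)
  fix z
  have "poly (map_poly cnj (root_poly r I)) z = (\<Prod>i\<in>I. z - cnj (r i))" by simp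
  also have "\<dots> = (\<Prod>w\<in>cnj ` (r ` I). z - w)"
    using assms(2) by (simp add: prod.reindex inj_on_def image_image comp_def)
  also have "\<dots> = (\<Prod>i\<in>I. z - r i)"
    unfolding assms(3) using assms(2) by (simp add: prod.reindex)
  finally show "poly (map_poly cnj (root_poly r I)) z = poly (root_poly r I) z" by simp
qed

abbreviation crit_poly :: "nat \<Rightarrow> (nat \<Rightarrow> real) \<Rightarrow> complex poly" where
  "crit_poly n x \<equiv> root_poly (\<lambda>j. complex_of_real (x j)) {1..n}"

text \<open>Subtracting the double poles of \<open>\<Pi> / Q\<^sup>2\<close> leaves a polynomial, because
  the stationary relations say that its residues vanish.\<close>

lemma stationary_wronskian_exists:
  assumes d: "pairwise_distinct n m x \<xi>" and s: "stationary_relations n m x \<xi>"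
  shows "\<exists>P. pderiv P * root_poly \<xi> {1..m} - P * pderiv (root_poly \<xi> {1..m}) = crit_poly n x"
proof -
  define I where "I = {1..m}"
  define Q where "Q = root_poly \<xi> I"
  define q where "q = (\<lambda>l. root_poly \<xi> (I - {l}))"
  \<comment> \<open>\<open>A l\<close> is the coefficient of
    \<open>1 / (w - \<xi> l)\<^sup>2\<close> in the partial fractions of
    \<open>crit_poly n x / Q\<^sup>2\<close>; \<open>N\<close> is the numerator left after all these
    double poles are removed.\<close>
  define A where "A = (\<lambda>l. poly (crit_poly n x) (\<xi> l) / (poly (q l) (\<xi> l))\<^sup>2)"
  define N where "N = crit_poly n x - (\<Sum>l\<in>I. smult (A l) ((q l)\<^sup>2))"
  have inj: "inj_on \<xi> I" and fin: "finite I" using pairwise_distinctD(2)[OF d] by (simp_all add: I_def)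
  have q0: "poly (q l) (\<xi> k) = 0" if "l \<in> I" "k \<in> I" "l \<noteq> k" for l k
    using that fin by (auto simp: q_def)
  have qn: "poly (q l) (\<xi> l) \<noteq> 0" if "l \<in> I" for l
    using that fin inj by (auto simp: q_def inj_on_def)
  have "[:- \<xi> k, 1:]\<^sup>2 dvd N" if k: "k \<in> I" for k
  proof (rule square_dvd_of_double_root)
    have "(\<Sum>l\<in>I. A l * (poly (q l) (\<xi> k))\<^sup>2) = A k * (poly (q k) (\<xi> k))\<^sup>2"
      using q0 k fin by (subst sum.remove[of I k]) auto
    then show "poly N (\<xi> k) = 0"
      using qn[OF k] by (simp add: N_def poly_sum A_def del: poly_root_poly)
    have xk: "\<xi> k \<notin> (\<lambda>j. complex_of_real (x j)) ` {1..n}"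
      using d k unfolding pairwise_distinct_def I_def by force
    have xk': "\<xi> k \<notin> \<xi> ` (I - {k})" using inj k by (auto simp: inj_on_def)
    have 1: "poly (pderiv (crit_poly n x)) (\<xi> k) = poly (crit_poly n x) (\<xi> k) * (\<Sum>j=1..n. 1 / (\<xi> k - x j))"
      using poly_pderiv_root_poly[OF _ xk] by simp
    have 2: "poly (pderiv (q k)) (\<xi> k) = poly (q k) (\<xi> k) * (\<Sum>l\<in>I-{k}. 1 / (\<xi> k - \<xi> l))"
      unfolding q_def using poly_pderiv_root_poly[OF _ xk'] fin by simp
    \<comment> \<open>The stationary relation: at \<open>\<xi> k\<close> the logarithmic derivatives
      of \<open>crit_poly n x\<close> and of \<open>(q k)\<^sup>2\<close> agree, which cancels the
      simple pole.\<close>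
    have 3: "(\<Sum>j=1..n. 1 / (\<xi> k - x j)) = 2 * (\<Sum>l\<in>I-{k}. 1 / (\<xi> k - \<xi> l))"
      using s k unfolding stationary_relations_def I_def by (simp add: sum_distrib_left)
    have "poly (pderiv (\<Sum>l\<in>I. smult (A l) ((q l)\<^sup>2))) (\<xi> k) 
        = (\<Sum>l\<in>I. A l * (2 * poly (q l) (\<xi> k) * poly (pderiv (q l)) (\<xi> k)))"
      by (simp add: higher_pderiv_sum[of 1, simplified] poly_sum pderiv_smult power2_eq_square pderiv_mult algebra_simps)
    also have "\<dots> = A k * (2 * poly (q k) (\<xi> k) * poly (pderiv (q k)) (\<xi> k))"
      using q0 k fin by (subst sum.remove[of I k]) auto
    also have "\<dots> = poly (crit_poly n x) (\<xi> k) * (\<Sum>j=1..n. 1 / (\<xi> k - x j))"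
      unfolding 2 3 A_def using qn[OF k] by (simp add: power2_eq_square del: poly_root_poly)
    finally show "poly (pderiv N) (\<xi> k) = 0"
      unfolding N_def pderiv_diff poly_diff 1 by simp
  qed
  then have "Q\<^sup>2 dvd N" unfolding Q_def by (rule root_poly_square_dvd[OF fin inj])
  then obtain E where E: "N = Q\<^sup>2 * E" by (elim dvdE)
  obtain F where F: "pderiv F = E" using poly_antiderivative_exists by blast
  \<comment> \<open>\<open>q l / Q\<close> is \<open>1 / (w - \<xi> l)\<close>, whose derivative is
    \<open>- (q l)\<^sup>2 / Q\<^sup>2\<close>.\<close>
  have W: "pderiv (q l) * Q - q l * pderiv Q = - (q l)\<^sup>2" if "l \<in> I" for l
  proof -
    have "Q = [:- \<xi> l, 1:] * q l" unfolding Q_def q_def by (rule root_poly_remove[OF fin that])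
    moreover have "pderiv Q = q l + [:- \<xi> l, 1:] * pderiv (q l)"
      unfolding Q_def q_def by (rule pderiv_root_poly_remove[OF fin that])
    ultimately show ?thesis
      by (simp add: power2_eq_square algebra_simps del: mult_pCons_left mult_pCons_right)
  qed
  let ?S = "\<Sum>l\<in>I. smult (A l) (q l)"
  have "pderiv ?S * Q - ?S * pderiv Q = (\<Sum>l\<in>I. smult (A l) (pderiv (q l) * Q - q l * pderiv Q))"
    by (simp add: higher_pderiv_sum[of 1, simplified] pderiv_smult sum_distrib_right sum_subtractf smult_diff_right)
  also have "\<dots> = - (\<Sum>l\<in>I. smult (A l) ((q l)\<^sup>2))" using W by (simp add: sum_negf)
  finally have S: "pderiv ?S * Q - ?S * pderiv Q = - (\<Sum>l\<in>I. smult (A l) ((q l)\<^sup>2))" .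
  \<comment> \<open>The solution is \<open>F * Q - ?S\<close>: its quotient by \<open>Q\<close> is a
    polynomial minus the simple fractions \<open>A l / (w - \<xi> l)\<close>.\<close>
  have "pderiv (F * Q - ?S) * Q - (F * Q - ?S) * pderiv Q 
      = Q\<^sup>2 * E - (pderiv ?S * Q - ?S * pderiv Q)"
    by (simp add: pderiv_diff pderiv_mult F power2_eq_square algebra_simps)
  also have "\<dots> = crit_poly n x" unfolding S E[symmetric] N_def by simp
  finally show ?thesis unfolding Q_def I_def by blast
qed

text \<open>The Wronskian is linear in \<open>P\<close>, and \<open>Q\<close> and the right-hand
  side are fixed by conjugation. So the conjugate of a solution is a solution, and so is the mean of
  the two.\<close>

lemma real_stationary_wronskian_exists:
  assumes d: "pairwise_distinct n m x \<xi>" and s: "stationary_relations n m x \<xi>"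
    and c: "cnj ` (\<xi> ` {1..m}) = \<xi> ` {1..m}"
  shows "\<exists>P. map_poly cnj P = P \<and>
    pderiv P * root_poly \<xi> {1..m} - P * pderiv (root_poly \<xi> {1..m}) = crit_poly n x"
proof -
  let ?Q = "root_poly \<xi> {1..m}"
  obtain P where P: "pderiv P * ?Q - P * pderiv ?Q = crit_poly n x"
    using stationary_wronskian_exists[OF d s] by (rule exE)
  have inj: "inj_on \<xi> {1..m}" "inj_on (\<lambda>j. complex_of_real (x j)) {1..n}"
    using pairwise_distinctD[OF d] by blast+
  have Q: "map_poly cnj ?Q = ?Q" by (intro map_poly_cnj_root_poly inj c) auto
  have Pi: "map_poly cnj (crit_poly n x) = crit_poly n x"
    by (intro map_poly_cnj_root_poly inj) (auto simp: image_image)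
  define P' where "P' = map_poly cnj P"
  have P': "pderiv P' * ?Q - P' * pderiv ?Q = crit_poly n x"
    using arg_cong[OF P, of "map_poly cnj"] 
    unfolding map_poly_cnj_mult map_poly_cnj_diff map_poly_cnj_pderiv Q Pi P'_def .
  define R where "R = smult (1/2) (P + P')"
  have "pderiv R * ?Q - R * pderiv ?Q = smult (1/2) ((pderiv P * ?Q - P * pderiv ?Q) + (pderiv P' * ?Q - P' * pderiv ?Q))"
    by (simp add: R_def pderiv_smult pderiv_add algebra_simps smult_add_right smult_diff_right)
  also have "\<dots> = crit_poly n x" unfolding P P'
    by (rule poly_ext) simp
  finally have "pderiv R * ?Q - R * pderiv ?Q = crit_poly n x" .
  moreover have "map_poly cnj R = R"
    by (rule poly_ext) (simp add: R_def P'_def)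
  ultimately show ?thesis by blast
qed

section \<open>From a solution of the Wronskian equation to the class \<open>CR\<close>\<close>

lemma has_pole_of_factor:
  fixes f :: "complex \<Rightarrow> complex"
  assumes S: "open S" "z \<in> S" and g: "g holomorphic_on S" "g z \<noteq> 0" and k: "k > 0"
    and eq: "\<And>w. w \<in> S \<Longrightarrow> w \<noteq> z \<Longrightarrow> f w = g w / (w - z) ^ k"
  shows "is_pole f z" "zorder f z = - int k"
proof -
  have "is_pole (\<lambda>w. g w / (w - z) ^ k) z"
  proof (rule is_pole_divide)
    show "isCont g z" using S g(1) by (metis continuous_on_eq_continuous_at holomorphic_on_imp_continuous_on)
    show "filterlim (\<lambda>w. (w - z) ^ k) (at 0) (at z)"
      using k by (auto simp: filterlim_at eventually_at intro!: exI[of _ 1] tendsto_eq_intros)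
  qed fact
  then show "is_pole f z"
    by (rule is_pole_transform) (use eq S in \<open>auto simp: eventually_at_topological intro!: exI[of _ S]\<close>)
  show "zorder f z = - int k"
    by (rule zorder_eqI[OF S g]) (use eq in \<open>simp add: power_int_minus field_simps\<close>)
qed

lemma poly_divide_holomorphic_on:
  assumes "\<And>w. w \<in> S \<Longrightarrow> poly q w \<noteq> 0"
  shows "(\<lambda>w. poly p w / poly q w) holomorphic_on S"
proof -
  have "poly r holomorphic_on S" for r :: "complex poly"
    unfolding holomorphic_on_def field_differentiable_def
    using has_field_derivative_at_within[OF poly_DERIV] by blast
  then show ?thesis using assms by (intro holomorphic_on_divide) auto
qed

text \<open>A crude degree count gives \<open>n + 1 \<le> degree P + m\<close>, hence
  \<open>degree P > m\<close> because \<open>2 * m \<le> n\<close>. Then the two leading terms of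
  the Wronskian, with factors \<open>degree P\<close> and \<open>m\<close>, cannot cancel, which
  makes the count exact.\<close>

lemma wronskian_degree:
  fixes P Q W :: "complex poly"
  assumes W: "pderiv P * Q - P * pderiv Q = W" and deg: "degree Q = m" "degree W = n" "0 < m" "2 * m \<le> n"
  shows "degree P + m = n + 1" "P \<noteq> 0"
proof -
  have W0: "W \<noteq> 0" using deg by auto
  then show P0: "P \<noteq> 0" using W by auto
  have Q0: "Q \<noteq> 0" "pderiv Q \<noteq> 0" using deg by (auto simp: pderiv_eq_0_iff)
  have dP: "degree (pderiv P * Q) \<le> degree P - 1 + m" "degree (P * pderiv Q) \<le> degree P + (m - 1)"
    using degree_mult_le[of "pderiv P" Q] degree_mult_le[of P "pderiv Q"] deg by (auto simp: degree_pderiv)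
  have "n \<le> max (degree (pderiv P * Q)) (degree (P * pderiv Q))"
    using degree_diff_le_max[of "pderiv P * Q" "P * pderiv Q"] W deg by simp
  then have le: "n + 1 \<le> degree P + m" using dP deg by (cases "degree P = 0") auto
  then have pm: "degree P > m" using deg by linarith
  have "coeff W (degree P + m - 1) = (of_nat (degree P) - of_nat m) * (lead_coeff P * lead_coeff Q)"
  proof -
    have "coeff (pderiv P * Q) (degree P + m - 1) = lead_coeff (pderiv P) * lead_coeff Q"
      using coeff_mult_degree_sum[of "pderiv P" Q] pm deg by (simp add: degree_pderiv)
    moreover have "coeff (P * pderiv Q) (degree P + m - 1) = lead_coeff P * lead_coeff (pderiv Q)"
      using coeff_mult_degree_sum[of P "pderiv Q"] pm deg by (simp add: degree_pderiv)
    moreover have "lead_coeff (pderiv P) = of_nat (degree P) * lead_coeff P"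
      "lead_coeff (pderiv Q) = of_nat m * lead_coeff Q"
      using pm deg by (simp_all add: degree_pderiv coeff_pderiv)
    ultimately show ?thesis unfolding W[symmetric] by (simp add: algebra_simps)
  qed
  moreover have "\<dots> \<noteq> 0" using pm P0 Q0 by auto
  ultimately have "degree P + m - 1 \<le> n" using le_degree deg(2) by metis
  then show "degree P + m = n + 1" using le by linarith
qed

lemma CR_of_wronskian:
  assumes d: "pairwise_distinct n m x \<xi>" and mn: "0 < m" "m \<le> n div 2"
    and c: "cnj ` (\<xi> ` {1..m}) = \<xi> ` {1..m}"
    and real: "map_poly cnj P = P"
    and W: "pderiv P * root_poly \<xi> {1..m} - P * pderiv (root_poly \<xi> {1..m}) = crit_poly n x"
  defines "R \<equiv> \<lambda>z. poly P z / poly (root_poly \<xi> {1..m}) z"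
  shows "R \<in> CR m n x"
    and "finite_poles R = \<xi> ` {1..m}"
    and "\<And>w. w \<notin> \<xi> ` {1..m} \<Longrightarrow> (R has_field_derivative
           poly (crit_poly n x) w / (poly (root_poly \<xi> {1..m}) w)\<^sup>2) (at w)"
proof -
  define I where "I = {1..m}"
  define Q where "Q = root_poly \<xi> I"
  define Pi where "Pi = crit_poly n x"
  note R = R_def[folded I_def, folded Q_def]
  note W = W[folded I_def, folded Q_def Pi_def]
  have inj: "inj_on \<xi> I" "inj_on (\<lambda>j. complex_of_real (x j)) {1..n}" and fin: "finite I"
    using pairwise_distinctD[OF d] unfolding I_def by blast+
  have xx: "complex_of_real (x j) \<notin> \<xi> ` I" if "j \<in> {1..n}" for j
    using d that unfolding pairwise_distinct_def I_def by force
  have xx': "w \<notin> \<xi> ` I" if "w \<in> (\<lambda>j. complex_of_real (x j)) ` {1..n}" for w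
    using that by (rule imageE) (simp only:, rule xx)
  have Qz: "poly Q w = 0 \<longleftrightarrow> w \<in> \<xi> ` I" for w
    using fin by (auto simp: Q_def)
  have Piz: "poly Pi w = 0 \<longleftrightarrow> w \<in> (\<lambda>j. complex_of_real (x j)) ` {1..n}" for w
    by (auto simp: Pi_def)
  \<comment> \<open>A common zero of \<open>P\<close> and \<open>Q\<close> would be a zero of the
    Wronskian, hence some \<open>x j\<close>, and these are kept apart from the poles.\<close>
  have PQ: "poly P w \<noteq> 0" if "w \<in> \<xi> ` I" for w
  proof
    assume "poly P w = 0"
    moreover have "poly Q w = 0" using that Qz by simp
    ultimately have "poly Pi w = 0" unfolding W[symmetric] by simp
    then obtain j where "j \<in> {1..n}" "w = complex_of_real (x j)" using Piz by blast
    then show False using xx that by blast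
  qed
  show der: "(R has_field_derivative poly (crit_poly n x) w / (poly (root_poly \<xi> {1..m}) w)\<^sup>2) (at w)"
    if "w \<notin> \<xi> ` {1..m}" for w
  proof -
    have "poly Q w \<noteq> 0" using that Qz by (simp add: I_def)
    then have "(R has_field_derivative (poly (pderiv P) w * poly Q w - poly P w * poly (pderiv Q) w) / (poly Q w * poly Q w)) (at w)"
      unfolding R by (intro DERIV_divide poly_DERIV)
    moreover have "poly (pderiv P) w * poly Q w - poly P w * poly (pderiv Q) w = poly Pi w"
      unfolding W[symmetric] by simp
    ultimately show ?thesis by (simp add: Pi_def Q_def I_def power2_eq_square)
  qed
  note der = der[folded I_def, folded Q_def Pi_def]
  have op: "open (- (\<xi> ` J))" if "J \<subseteq> I" for J
    using that fin by (intro open_Compl finite_imp_closed finite_imageI) (rule finite_subset)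
  have hol: "R holomorphic_on - (\<xi> ` I)"
    unfolding holomorphic_on_def field_differentiable_def
    using has_field_derivative_at_within[OF der] by blast
  have pole: "is_pole R (\<xi> l)" "zorder R (\<xi> l) = - 1" if l: "l \<in> I" for l
  proof -
    let ?q = "root_poly \<xi> (I - {l})"
    have ql: "\<xi> l \<notin> \<xi> ` (I - {l})" using l inj(1) by (auto simp: inj_on_def)
    have qz: "poly ?q w \<noteq> 0" if "w \<in> - (\<xi> ` (I - {l}))" for w
      using that fin by auto
    have "R w = poly P w / poly ?q w / (w - \<xi> l) ^ 1" for w
      unfolding R Q_def root_poly_remove[OF fin l] by (simp add: poly_mult del: mult_pCons_left)
    moreover have "(\<lambda>w. poly P w / poly ?q w) holomorphic_on - (\<xi> ` (I - {l}))"
      by (rule poly_divide_holomorphic_on) (rule qz)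
    ultimately have "is_pole R (\<xi> l) \<and> zorder R (\<xi> l) = - int 1"
      using has_pole_of_factor[of "- (\<xi> ` (I - {l}))" "\<xi> l" "\<lambda>w. poly P w / poly ?q w" 1 R]
        op[of "I - {l}"] ql qz PQ[of "\<xi> l"] l
      by (auto simp del: poly_root_poly)
    then show "is_pole R (\<xi> l)" "zorder R (\<xi> l) = - 1" by auto
  qed
  have "\<not> is_pole R w" if "w \<notin> \<xi> ` I" for w
    using not_is_pole_holomorphic[OF op[OF subset_refl] _ hol, of w] that by simp
  then have poles: "is_pole R w \<longleftrightarrow> w \<in> \<xi> ` I" for w using pole by auto
  show fp: "finite_poles R = \<xi> ` {1..m}"
    by (auto simp: finite_poles_def poles I_def)
  have dR: "deriv R w = poly Pi w / (poly Q w)\<^sup>2" if "w \<notin> \<xi> ` I" for w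
    using der[OF that] by (rule DERIV_imp_deriv)
  have crit: "finite_critical_points R = (\<lambda>j. complex_of_real (x j)) ` {1..n}"
  proof -
    have "w \<notin> \<xi> ` I \<and> deriv R w = 0 \<longleftrightarrow> w \<notin> \<xi> ` I \<and> poly Pi w = 0" for w
      using dR[of w] Qz[of w] by auto
    then have "finite_critical_points R = {w. w \<notin> \<xi> ` I \<and> poly Pi w = 0}"
      unfolding finite_critical_points_def poles by simp
    also have "\<dots> = (\<lambda>j. complex_of_real (x j)) ` {1..n}" unfolding Piz using xx' by fast
    finally show ?thesis .
  qed
  have zx: "zorder (deriv R) (complex_of_real (x j)) = 1" if j: "j \<in> {1..n}" for j
  proof (rule zorder_eqI[where S = "- (\<xi> ` I)" and g = "\<lambda>w. poly (root_poly (\<lambda>j. complex_of_real (x j)) ({1..n} - {j})) w / (poly Q w)\<^sup>2"])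
    fix w assume "w \<in> - \<xi> ` I"
    then show "deriv R w = poly (root_poly (\<lambda>j. complex_of_real (x j)) ({1..n} - {j})) w / (poly Q w)\<^sup>2 *
         (w - complex_of_real (x j)) powi 1"
      using j dR[of w] unfolding Pi_def root_poly_remove[OF finite_atLeastAtMost j]
      by (simp add: poly_mult del: mult_pCons_left)
  next
    show "poly (root_poly (\<lambda>j. complex_of_real (x j)) ({1..n} - {j})) (complex_of_real (x j)) /
         (poly Q (complex_of_real (x j)))\<^sup>2 \<noteq> 0"
    proof -
      have "complex_of_real (x j) - complex_of_real (x k) \<noteq> 0" if "k \<in> {1..n} - {j}" for k
        using inj_onD[OF inj(2), of j k] j that by auto
      moreover have "poly Q (complex_of_real (x j)) \<noteq> 0" using xx[OF j] Qz by blast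
      ultimately show ?thesis by (simp add: prod_zero_iff)
    qed
  next
    show "(\<lambda>w. poly (root_poly (\<lambda>j. complex_of_real (x j)) ({1..n} - {j})) w / (poly Q w)\<^sup>2) holomorphic_on - \<xi> ` I"
      using poly_divide_holomorphic_on[of "- \<xi> ` I" "Q\<^sup>2" "root_poly (\<lambda>j. complex_of_real (x j)) ({1..n} - {j})"] Qz
      by simp
  qed (use op[OF subset_refl] xx[OF j] in auto)
  have coprime: "coprime P Q"
  proof (rule coprimeI)
    fix D assume D: "D dvd P" "D dvd Q"
    show "is_unit D"
    proof (rule ccontr)
      assume "\<not> is_unit D"
      moreover have "D \<noteq> 0" using D(2) by (auto simp: Q_def)
      ultimately have "degree D \<noteq> 0" by (metis is_unit_iff_degree)
      then obtain z where "poly D z = 0" 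
        using alg_closed_imp_poly_has_root[of D] by auto
      then have "poly P z = 0" "poly Q z = 0" using D by (auto elim!: dvdE)
      then show False using PQ Qz by blast
    qed
  qed
  \<comment> \<open>This includes the poles, where both sides are the default value
    \<open>0\<close>.\<close>
  have sym: "cnj (R (cnj z)) = R z" for z
    using poly_cnj[of P "cnj z"] poly_cnj[of Q "cnj z"] real
      map_poly_cnj_root_poly[OF fin inj(1) c[folded I_def], folded Q_def]
    by (simp add: R)
  have dQ: "degree Q = m" "degree Pi = n" by (simp_all add: Q_def Pi_def I_def degree_root_poly)
  have dP: "degree P + m = n + 1" "P \<noteq> 0"
    using wronskian_degree[OF W dQ] mn by auto
  have inf: "is_pole (\<lambda>w. R (inverse w)) 0" "zorder (\<lambda>w. R (inverse w)) 0 = - int (degree P - m)"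
  proof -
    \<comment> \<open>The reflected polynomials describe \<open>R\<close> near infinity. At
      \<open>0\<close> they take the leading coefficients as values, so neither vanishes there and
      the pole order is the degree difference \<open>degree P - m\<close>, which is
      \<open>n - 2 * m + 1\<close>.\<close>
    define T where "T = {w. poly (reflect_poly Q) w \<noteq> 0}"
    have "open T" unfolding T_def by (intro open_Collect_neq continuous_intros)
    moreover have "0 \<in> T" by (simp add: T_def Q_def)
    moreover have "R (inverse w) = poly (reflect_poly P) w / poly (reflect_poly Q) w / (w - 0) ^ (degree P - m)"
      if "w \<noteq> 0" for w
    proof -
      have e1: "poly P (inverse w) = poly (reflect_poly P) w / w ^ degree P"
        "poly Q (inverse w) = poly (reflect_poly Q) w / w ^ m"
        using that dQ(1) by (simp_all add: poly_reflect_poly_nz)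
      have e2: "w ^ degree P = w ^ (degree P - m) * w ^ m"
        using dP(1) mn unfolding power_add[symmetric] by (intro arg_cong[where f = "power w"]) linarith
      show ?thesis unfolding R e1 e2 using that by simp
    qed
    moreover have "(\<lambda>w. poly (reflect_poly P) w / poly (reflect_poly Q) w) holomorphic_on T"
      by (rule poly_divide_holomorphic_on) (simp add: T_def)
    ultimately show "is_pole (\<lambda>w. R (inverse w)) 0" "zorder (\<lambda>w. R (inverse w)) 0 = - int (degree P - m)"
      using has_pole_of_factor[of T 0 "\<lambda>w. poly (reflect_poly P) w / poly (reflect_poly Q) w" "degree P - m" "\<lambda>w. R (inverse w)"]
        dP mn by (auto simp: Q_def)
  qed
  have "int (degree P - m) = int n - 2 * int m + 1" using dP mn by linarith
  moreover have "card (finite_poles R) = m" using fp inj(1) by (simp add: I_def card_image)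
  moreover have "rational_function R" unfolding rational_function_def R
    using coprime Q_def by (intro exI[of _ P] exI[of _ Q]) auto
  ultimately show "R \<in> CR m n x"
    unfolding CR_def using sym crit zx fp pole inf by (auto simp: I_def)
qed

section \<open>Identities for the velocities\<close>

text \<open>Weights and positions are complex so that the identities below are purely algebraic;
  reality enters only when \<open>of_real\<close> is substituted.\<close>

definition flow_field :: "'i set \<Rightarrow> ('i \<Rightarrow> complex) \<Rightarrow> ('i \<Rightarrow> complex) \<Rightarrow> complex \<Rightarrow> complex" where
  "flow_field J \<nu> x w = (\<Sum>j\<in>J. 2 * \<nu> j / (w - x j))"

definition driving_velocity ::
    "'i set \<Rightarrow> 'l set \<Rightarrow> ('i \<Rightarrow> complex) \<Rightarrow> ('i \<Rightarrow> complex) \<Rightarrow> ('l \<Rightarrow> complex) \<Rightarrow> 'i \<Rightarrow> complex" where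
  "driving_velocity J L \<nu> x \<xi> k =
     \<nu> k * ((\<Sum>i\<in>J - {k}. 2 / (x k - x i)) - (\<Sum>l\<in>L. 4 / (x k - \<xi> l))) + (\<Sum>i\<in>J - {k}. 2 * \<nu> i / (x k - x i))"

lemma sum_off_diagonal_swap:
  assumes "finite J"
  shows "(\<Sum>k\<in>J. \<Sum>i\<in>J - {k}. f k i) = (\<Sum>i\<in>J. \<Sum>k\<in>J - {i}. f k i)"
proof -
  have "J - {k} = {i \<in> J. i \<noteq> k}" "J - {k} = {i \<in> J. k \<noteq> i}" for k by auto
  then show ?thesis using sum.swap_restrict[OF assms assms, of f "\<lambda>k i. i \<noteq> k"] by simp
qed

text \<open>Apart from index \<open>k\<close>, which keeps its singularity, the terms combine in
  pairs: \<open>1 / (w - x i) - 1 / (x k - x i)\<close> contains the factor \<open>w - x k\<close>,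
  and this cancels the denominator.\<close>

lemma velocity_difference_driving:
  assumes J: "finite J" "inj_on x J" and k: "k \<in> J" and w: "w \<notin> x ` J"
  shows "(flow_field J \<nu> x w - driving_velocity J L \<nu> x \<xi> k) / (w - x k) =
    2 * \<nu> k / (w - x k)\<^sup>2
    - \<nu> k * ((\<Sum>i\<in>J - {k}. 2 / (x k - x i)) - (\<Sum>l\<in>L. 4 / (x k - \<xi> l))) / (w - x k)
    - (\<Sum>i\<in>J - {k}. 2 * \<nu> i / ((w - x i) * (x k - x i)))"
proof -
  have wk: "w - x i \<noteq> 0" if "i \<in> J" for i using w that by auto
  have xk: "x k - x i \<noteq> 0" if "i \<in> J - {k}" for i using inj_onD[OF J(2), of k i] k that by auto
  let ?a = "(\<Sum>i\<in>J - {k}. 2 / (x k - x i)) - (\<Sum>l\<in>L. 4 / (x k - \<xi> l))"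
  have "flow_field J \<nu> x w - driving_velocity J L \<nu> x \<xi> k
      = 2 * \<nu> k / (w - x k) - \<nu> k * ?a + (\<Sum>i\<in>J - {k}. 2 * \<nu> i / (w - x i) - 2 * \<nu> i / (x k - x i))"
    unfolding flow_field_def driving_velocity_def sum.remove[OF J(1) k] sum_subtractf by simp
  also have "(\<Sum>i\<in>J - {k}. 2 * \<nu> i / (w - x i) - 2 * \<nu> i / (x k - x i))
      = (\<Sum>i\<in>J - {k}. - (w - x k) * (2 * \<nu> i / ((w - x i) * (x k - x i))))"
  proof (rule sum.cong[OF refl])
    fix i assume i: "i \<in> J - {k}"
    then show "2 * \<nu> i / (w - x i) - 2 * \<nu> i / (x k - x i) = - (w - x k) * (2 * \<nu> i / ((w - x i) * (x k - x i)))"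
      using wk[of i] xk[OF i] by (simp add: divide_simps) (simp add: algebra_simps)
  qed
  also have "\<dots> = - (w - x k) * (\<Sum>i\<in>J - {k}. 2 * \<nu> i / ((w - x i) * (x k - x i)))"
    by (rule sum_distrib_left[symmetric])
  finally have eq: "flow_field J \<nu> x w - driving_velocity J L \<nu> x \<xi> k = \<dots> + (2 * \<nu> k / (w - x k) - \<nu> k * ?a)"
    by simp
  have aux: "(- d * s + (2 * c / d - y)) / d = 2 * c / d\<^sup>2 - y / d - s" if "d \<noteq> 0" for c d s y :: complex
    using that by (simp add: field_simps power2_eq_square)
  show ?thesis unfolding eq by (rule aux[OF wk[OF k]])
qed

lemma velocity_difference_pole:
  assumes "w \<notin> x ` J" "v \<notin> x ` J" "w \<noteq> v"
  shows "(flow_field J \<nu> x w - flow_field J \<nu> x v) / (w - v) = - (\<Sum>j\<in>J. 2 * \<nu> j / ((w - x j) * (v - x j)))"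
proof -
  have "flow_field J \<nu> x w - flow_field J \<nu> x v = (\<Sum>j\<in>J. - (w - v) * (2 * \<nu> j / ((w - x j) * (v - x j))))"
    unfolding flow_field_def sum_subtractf[symmetric]
  proof (rule sum.cong[OF refl])
    fix j assume "j \<in> J"
    then have "w - x j \<noteq> 0" "v - x j \<noteq> 0" using assms by auto
    then show "2 * \<nu> j / (w - x j) - 2 * \<nu> j / (v - x j) = - (w - v) * (2 * \<nu> j / ((w - x j) * (v - x j)))"
      by (simp add: divide_simps) (simp add: algebra_simps)
  qed
  also have "\<dots> = - (w - v) * (\<Sum>j\<in>J. 2 * \<nu> j / ((w - x j) * (v - x j)))"
    by (rule sum_distrib_left[symmetric])
  finally show ?thesis using assms(3) by (simp del: minus_diff_eq)
qed

text \<open>The logarithmic derivative of \<open>\<Prod>\<^sub>k (w - x\<^sub>k) / \<Prod>\<^sub>l (w - \<xi>\<^sub>l)\<^sup>2\<close> along the flow is minus that of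
  \<open>g\<^sub>t'\<close>, so that the product of the two is an integral of motion.\<close>

lemma integral_of_motion_identity:
  assumes J: "finite J" "inj_on x J" and w: "w \<notin> x ` J" "w \<notin> \<xi> ` L" and d: "\<And>l. l \<in> L \<Longrightarrow> \<xi> l \<notin> x ` J"
  shows "(\<Sum>k\<in>J. (flow_field J \<nu> x w - driving_velocity J L \<nu> x \<xi> k) / (w - x k))
     - 2 * (\<Sum>l\<in>L. (flow_field J \<nu> x w - flow_field J \<nu> x (\<xi> l)) / (w - \<xi> l))
     = (\<Sum>j\<in>J. 2 * \<nu> j / (w - x j)\<^sup>2)"
proof -
  let ?S = "\<lambda>k. \<Sum>i\<in>J - {k}. 2 / (x k - x i)" and ?Z = "\<lambda>k. \<Sum>l\<in>L. 4 / (x k - \<xi> l)"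
  \<comment> \<open>Exchanging the roles of \<open>i\<close> and \<open>k\<close> produces the
    interaction sums \<open>?S i\<close> with weight \<open>\<nu> i\<close>; they cancel those in
    the drift of \<open>x i\<close>.\<close>
  have "(\<Sum>k\<in>J. \<Sum>i\<in>J - {k}. 2 * \<nu> i / ((w - x i) * (x k - x i))) 
      = (\<Sum>i\<in>J. \<Sum>k\<in>J - {i}. 2 * \<nu> i / ((w - x i) * (x k - x i)))"
    by (rule sum_off_diagonal_swap[OF J(1)])
  also have "\<dots> = (\<Sum>i\<in>J. - (\<nu> i * ?S i / (w - x i)))"
  proof (rule sum.cong[OF refl])
    fix i assume "i \<in> J"
    have "?S i = - (\<Sum>k\<in>J - {i}. 2 / (x k - x i))"
      unfolding sum_negf[symmetric] by (intro sum.cong refl) (metis minus_diff_eq minus_divide_right)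
    then show "(\<Sum>k\<in>J - {i}. 2 * \<nu> i / ((w - x i) * (x k - x i))) = - (\<nu> i * ?S i / (w - x i))"
      by (simp add: sum_distrib_left sum_divide_distrib mult.commute)
  qed
  finally have 1: "(\<Sum>k\<in>J. \<Sum>i\<in>J - {k}. 2 * \<nu> i / ((w - x i) * (x k - x i))) = \<dots>" .
  have "(\<Sum>k\<in>J. (flow_field J \<nu> x w - driving_velocity J L \<nu> x \<xi> k) / (w - x k))
     = (\<Sum>k\<in>J. 2 * \<nu> k / (w - x k)\<^sup>2 - \<nu> k * (?S k - ?Z k) / (w - x k)
        - (\<Sum>i\<in>J - {k}. 2 * \<nu> i / ((w - x i) * (x k - x i))))"
    using velocity_difference_driving[OF J _ w(1)] by (intro sum.cong) auto
  also have "\<dots> = (\<Sum>k\<in>J. 2 * \<nu> k / (w - x k)\<^sup>2) + (\<Sum>k\<in>J. \<nu> k * ?Z k / (w - x k))"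
    unfolding sum_subtractf 1
    by (simp add: right_diff_distrib diff_divide_distrib sum_subtractf sum_negf)
  finally have 2: "(\<Sum>k\<in>J. (flow_field J \<nu> x w - driving_velocity J L \<nu> x \<xi> k) / (w - x k)) = \<dots>" .
  have "(\<Sum>l\<in>L. (flow_field J \<nu> x w - flow_field J \<nu> x (\<xi> l)) / (w - \<xi> l))
     = (\<Sum>l\<in>L. - (\<Sum>j\<in>J. 2 * \<nu> j / ((w - x j) * (\<xi> l - x j))))"
    using w d by (intro sum.cong refl velocity_difference_pole) auto
  also have "\<dots> = - (\<Sum>j\<in>J. \<Sum>l\<in>L. 2 * \<nu> j / ((w - x j) * (\<xi> l - x j)))"
    unfolding sum_negf by (subst sum.swap) simp
  finally have 3: "2 * (\<Sum>l\<in>L. (flow_field J \<nu> x w - flow_field J \<nu> x (\<xi> l)) / (w - \<xi> l))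
     = - (\<Sum>j\<in>J. 2 * (\<Sum>l\<in>L. 2 * \<nu> j / ((w - x j) * (\<xi> l - x j))))"
    by (simp add: sum_distrib_left)
  \<comment> \<open>The coefficient \<open>4\<close> in the drift is matched to the double poles: it
    is the exponent \<open>2\<close> times the coefficient \<open>2\<close> of the field.\<close>
  have "\<nu> j * ?Z j / (w - x j) = - 2 * (\<Sum>l\<in>L. 2 * \<nu> j / ((w - x j) * (\<xi> l - x j)))" if j: "j \<in> J" for j
  proof -
    have "\<nu> j * ?Z j / (w - x j) = (\<Sum>l\<in>L. \<nu> j / (w - x j) * (4 / (x j - \<xi> l)))"
      by (simp add: sum_distrib_left sum_divide_distrib ac_simps)
    also have "\<dots> = (\<Sum>l\<in>L. (- 2) * (2 * \<nu> j / ((w - x j) * (\<xi> l - x j))))"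
    proof (rule sum.cong[OF refl])
      fix l assume l: "l \<in> L"
      have "\<xi> l \<noteq> x j" "w \<noteq> x j" using d[OF l] w(1) imageI[OF j, of x] by metis+
      then have "\<xi> l - x j \<noteq> 0" "x j - \<xi> l \<noteq> 0" "w - x j \<noteq> 0" by auto
      then show "\<nu> j / (w - x j) * (4 / (x j - \<xi> l)) = (- 2) * (2 * \<nu> j / ((w - x j) * (\<xi> l - x j)))"
        by (simp add: divide_simps) (simp add: algebra_simps)
    qed
    finally show ?thesis by (simp add: sum_distrib_left)
  qed
  then have "(\<Sum>k\<in>J. \<nu> k * ?Z k / (w - x k)) = - (\<Sum>j\<in>J. 2 * (\<Sum>l\<in>L. 2 * \<nu> j / ((w - x j) * (\<xi> l - x j))))"
    by (simp add: sum_negf[symmetric])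
  then show ?thesis unfolding 2 3 by simp
qed

text \<open>The left-hand side is the velocity of \<open>\<Sum>\<^sub>k 1 / (\<xi>\<^sub>p - x\<^sub>k) - \<Sum>\<^sub>l 2 / (\<xi>\<^sub>p - \<xi>\<^sub>l)\<close>, which therefore
  satisfies a linear equation and stays zero.\<close>

lemma stationary_relation_velocity:
  assumes J: "finite J" "inj_on x J" and L: "finite L" "inj_on \<xi> L" and d: "\<And>l. l \<in> L \<Longrightarrow> \<xi> l \<notin> x ` J"
    and p: "p \<in> L"
  shows "- (\<Sum>k\<in>J. (flow_field J \<nu> x (\<xi> p) - driving_velocity J L \<nu> x \<xi> k) / (\<xi> p - x k)\<^sup>2)
     + 2 * (\<Sum>l\<in>L - {p}. (flow_field J \<nu> x (\<xi> p) - flow_field J \<nu> x (\<xi> l)) / (\<xi> p - \<xi> l)\<^sup>2)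
     = (\<Sum>j\<in>J. 2 * \<nu> j / (\<xi> p - x j)\<^sup>2) * ((\<Sum>k\<in>J. 1 / (\<xi> p - x k)) - (\<Sum>l\<in>L - {p}. 2 / (\<xi> p - \<xi> l)))"
proof -
  define a where "a = \<xi> p"
  have ax: "a \<notin> x ` J" using d p by (simp add: a_def)
  have ax0: "a - x j \<noteq> 0" if "j \<in> J" for j using ax that by auto
  have xx0: "x k - x i \<noteq> 0" if "k \<in> J" "i \<in> J" "k \<noteq> i" for k i
    using inj_onD[OF J(2), of k i] that by auto
  have al: "a - \<xi> l \<noteq> 0" if "l \<in> L - {p}" for l
    using inj_onD[OF L(2), of p l] p that by (auto simp: a_def)
  have xl: "\<xi> l - x j \<noteq> 0" if "l \<in> L" "j \<in> J" for l j using d[OF that(1)] that(2) by auto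
  let ?S = "\<lambda>k. \<Sum>i\<in>J - {k}. 2 / (x k - x i)" and ?Z = "\<lambda>k. \<Sum>l\<in>L. 4 / (x k - \<xi> l)"
  let ?U = "\<lambda>k. \<Sum>i\<in>J - {k}. 2 / (a - x i)"
  \<comment> \<open>After the exchange of indices a second partial fraction, in \<open>x k\<close>,
    splits each term into a part \<open>?S i\<close>, which cancels the interaction in the drift,
    and a part \<open>?U i\<close> involving \<open>a\<close>.\<close>
  have "(\<Sum>k\<in>J. \<Sum>i\<in>J - {k}. 2 * \<nu> i / ((a - x i) * (x k - x i)) / (a - x k)) 
      = (\<Sum>i\<in>J. \<Sum>k\<in>J - {i}. 2 * \<nu> i / ((a - x i) * (x k - x i)) / (a - x k))"
    by (rule sum_off_diagonal_swap[OF J(1)])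
  also have "\<dots> = (\<Sum>i\<in>J. \<nu> i / (a - x i)\<^sup>2 * (?U i - ?S i))"
  proof (rule sum.cong[OF refl])
    fix i assume i: "i \<in> J"
    have "2 * \<nu> i / ((a - x i) * (x k - x i)) / (a - x k) = \<nu> i / (a - x i)\<^sup>2 * (2 / (a - x k) - 2 / (x i - x k))"
      if k: "k \<in> J - {i}" for k
    proof -
      have 0: "x k - x i \<noteq> 0" "x i - x k \<noteq> 0" "a - x i \<noteq> 0" "a - x k \<noteq> 0" using ax0 xx0 i k by auto
      have "2 / (a - x k) - 2 / (x i - x k) = 2 * (a - x i) / ((x k - x i) * (a - x k))"
        using 0 by (simp add: divide_simps) (simp add: algebra_simps)
      moreover have "2 * c / (d * d1) / d2 = c / d\<^sup>2 * (2 * d / (d1 * d2))" if "d \<noteq> 0" for c d d1 d2 :: complex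
        using that by (simp add: power2_eq_square ac_simps)
      ultimately show ?thesis using 0 by (simp only: not_False_eq_True)
    qed
    then show "(\<Sum>k\<in>J - {i}. 2 * \<nu> i / ((a - x i) * (x k - x i)) / (a - x k)) = \<nu> i / (a - x i)\<^sup>2 * (?U i - ?S i)"
      by (simp add: sum_subtractf[symmetric] sum_distrib_left)
  qed
  finally have 1: "(\<Sum>k\<in>J. (\<Sum>i\<in>J - {k}. 2 * \<nu> i / ((a - x i) * (x k - x i))) / (a - x k)) = \<dots>"
    by (simp add: sum_divide_distrib)
  have "(\<Sum>k\<in>J. (flow_field J \<nu> x a - driving_velocity J L \<nu> x \<xi> k) / (a - x k)\<^sup>2)
     = (\<Sum>k\<in>J. (flow_field J \<nu> x a - driving_velocity J L \<nu> x \<xi> k) / (a - x k) / (a - x k))"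
    by (simp add: power2_eq_square)
  also have "\<dots> = (\<Sum>k\<in>J. (2 * \<nu> k / (a - x k)\<^sup>2 - \<nu> k * (?S k - ?Z k) / (a - x k)
        - (\<Sum>i\<in>J - {k}. 2 * \<nu> i / ((a - x i) * (x k - x i)))) / (a - x k))"
    by (rule sum.cong[OF refl]) (simp only: velocity_difference_driving[OF J _ ax])
  also have "\<dots> = (\<Sum>k\<in>J. 2 * \<nu> k / (a - x k)\<^sup>2 / (a - x k)) - (\<Sum>k\<in>J. \<nu> k * (?S k - ?Z k) / (a - x k) / (a - x k))
        - (\<Sum>i\<in>J. \<nu> i / (a - x i)\<^sup>2 * (?U i - ?S i))"
    unfolding diff_divide_distrib sum_subtractf 1[symmetric] ..
  also have "\<dots> = (\<Sum>k\<in>J. 2 * \<nu> k / (a - x k)\<^sup>2 / (a - x k) - \<nu> k * (?S k - ?Z k) / (a - x k) / (a - x k)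
        - \<nu> k / (a - x k)\<^sup>2 * (?U k - ?S k))"
    by (simp only: sum_subtractf)
  also have "\<dots> = (\<Sum>k\<in>J. \<nu> k / (a - x k)\<^sup>2 * (2 / (a - x k) + ?Z k - ?U k))"
  proof (rule sum.cong[OF refl])
    have "2 * c / d\<^sup>2 / d - c * (s - z) / d / d - c / d\<^sup>2 * (u - s) = c / d\<^sup>2 * (2 / d + z - u)"
      for c d s u z :: complex
      by (cases "d = 0") (simp_all add: field_simps power2_eq_square)
    then show "2 * \<nu> k / (a - x k)\<^sup>2 / (a - x k) - \<nu> k * (?S k - ?Z k) / (a - x k) / (a - x k)
        - \<nu> k / (a - x k)\<^sup>2 * (?U k - ?S k) = \<nu> k / (a - x k)\<^sup>2 * (2 / (a - x k) + ?Z k - ?U k)" for k .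
  qed
  finally have 2: "(\<Sum>k\<in>J. (flow_field J \<nu> x a - driving_velocity J L \<nu> x \<xi> k) / (a - x k)\<^sup>2) = \<dots>" .
  let ?Y = "\<lambda>j. \<Sum>l\<in>L - {p}. 4 / (\<xi> l - x j) + 4 / (a - \<xi> l)"
  have "2 * ((flow_field J \<nu> x a - flow_field J \<nu> x (\<xi> l)) / (a - \<xi> l)\<^sup>2)
      = - (\<Sum>j\<in>J. \<nu> j / (a - x j)\<^sup>2 * (4 / (\<xi> l - x j) + 4 / (a - \<xi> l)))" if l: "l \<in> L - {p}" for l
  proof -
    have "2 * ((flow_field J \<nu> x a - flow_field J \<nu> x (\<xi> l)) / (a - \<xi> l)\<^sup>2)
        = 2 * ((flow_field J \<nu> x a - flow_field J \<nu> x (\<xi> l)) / (a - \<xi> l) / (a - \<xi> l))"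
      by (simp add: power2_eq_square)
    also have "\<dots> = 2 * (- (\<Sum>j\<in>J. 2 * \<nu> j / ((a - x j) * (\<xi> l - x j))) / (a - \<xi> l))"
      using ax d[of l] al[OF l] l by (subst velocity_difference_pole) auto
    also have "\<dots> = - (\<Sum>j\<in>J. 4 * \<nu> j / ((a - x j) * (\<xi> l - x j)) / (a - \<xi> l))"
      by (simp add: sum_distrib_left sum_divide_distrib)
    also have "(\<Sum>j\<in>J. 4 * \<nu> j / ((a - x j) * (\<xi> l - x j)) / (a - \<xi> l))
       = (\<Sum>j\<in>J. \<nu> j / (a - x j)\<^sup>2 * (4 / (\<xi> l - x j) + 4 / (a - \<xi> l)))"
    proof (rule sum.cong[OF refl])
      fix j assume j: "j \<in> J"
      have 0: "\<xi> l - x j \<noteq> 0" "a - \<xi> l \<noteq> 0" "a - x j \<noteq> 0" using xl al ax0 l j by auto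
      have "4 / (\<xi> l - x j) + 4 / (a - \<xi> l) = 4 * (a - x j) / ((\<xi> l - x j) * (a - \<xi> l))"
        using 0 by (simp add: divide_simps)
      moreover have "4 * c / (d * d1) / d2 = c / d\<^sup>2 * (4 * d / (d1 * d2))" if "d \<noteq> 0" for c d d1 d2 :: complex
        using that by (simp add: power2_eq_square ac_simps)
      ultimately show "4 * \<nu> j / ((a - x j) * (\<xi> l - x j)) / (a - \<xi> l) = \<nu> j / (a - x j)\<^sup>2 * (4 / (\<xi> l - x j) + 4 / (a - \<xi> l))"
        using 0 by (simp only: not_False_eq_True)
    qed
    finally show ?thesis .
  qed
  then have 3: "2 * (\<Sum>l\<in>L - {p}. (flow_field J \<nu> x a - flow_field J \<nu> x (\<xi> l)) / (a - \<xi> l)\<^sup>2)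
      = - (\<Sum>j\<in>J. \<nu> j / (a - x j)\<^sup>2 * ?Y j)"
    unfolding sum_distrib_left by (simp add: sum_negf sum_distrib_left sum.swap[of _ J])
  have "- (\<Sum>k\<in>J. \<nu> k / (a - x k)\<^sup>2 * (2 / (a - x k) + ?Z k - ?U k)) - (\<Sum>j\<in>J. \<nu> j / (a - x j)\<^sup>2 * ?Y j)
      = (\<Sum>j\<in>J. \<nu> j / (a - x j)\<^sup>2 * (- (2 / (a - x j) + ?Z j - ?U j) - ?Y j))"
    by (simp add: sum_subtractf[symmetric] sum_negf[symmetric] algebra_simps)
  also have "\<dots> = (\<Sum>j\<in>J. 2 * \<nu> j / (a - x j)\<^sup>2 * ((\<Sum>k\<in>J. 1 / (a - x k)) - (\<Sum>l\<in>L - {p}. 2 / (a - \<xi> l))))"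
  proof (rule sum.cong[OF refl])
    fix j assume j: "j \<in> J"
    \<comment> \<open>As \<open>a\<close> is itself the pole \<open>\<xi> p\<close>, its own term in
      the drift contributes \<open>4 / (a - x j)\<close>. Less the \<open>2 / (a - x j)\<close> from
      the field, this completes \<open>?U j\<close> to the sum over all of \<open>J\<close>.\<close>
    have "?Z j = 4 / (x j - a) + (\<Sum>l\<in>L - {p}. 4 / (x j - \<xi> l))"
      unfolding a_def by (rule sum.remove[OF L(1) p])
    also have "4 / (x j - a) = - (4 / (a - x j))" by (metis minus_diff_eq minus_divide_right)
    also have "(\<Sum>l\<in>L - {p}. 4 / (x j - \<xi> l)) = - (\<Sum>l\<in>L - {p}. 4 / (\<xi> l - x j))"
      unfolding sum_negf[symmetric] by (intro sum.cong refl) (metis minus_diff_eq minus_divide_right)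
    finally have Z: "?Z j = - (4 / (a - x j)) + - (\<Sum>l\<in>L - {p}. 4 / (\<xi> l - x j))" .
    have U: "(\<Sum>k\<in>J. 1 / (a - x k)) = 1 / (a - x j) + (\<Sum>i\<in>J - {j}. 1 / (a - x i))"
      by (rule sum.remove[OF J(1) j])
    have U2: "?U j = 2 * (\<Sum>i\<in>J - {j}. 1 / (a - x i))" by (simp add: sum_distrib_left)
    have Y: "?Y j = (\<Sum>l\<in>L - {p}. 4 / (\<xi> l - x j)) + 2 * (\<Sum>l\<in>L - {p}. 2 / (a - \<xi> l))"
      by (simp add: sum.distrib sum_distrib_left)
    have "- (2 / (a - x j) + ?Z j - ?U j) - ?Y j = 2 * ((\<Sum>k\<in>J. 1 / (a - x k)) - (\<Sum>l\<in>L - {p}. 2 / (a - \<xi> l)))"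
      unfolding Z U U2 Y by (simp add: algebra_simps)
    then show "\<nu> j / (a - x j)\<^sup>2 * (- (2 / (a - x j) + ?Z j - ?U j) - ?Y j) 
        = 2 * \<nu> j / (a - x j)\<^sup>2 * ((\<Sum>k\<in>J. 1 / (a - x k)) - (\<Sum>l\<in>L - {p}. 2 / (a - \<xi> l)))"
      by simp
  qed
  also have "\<dots> = (\<Sum>j\<in>J. 2 * \<nu> j / (a - x j)\<^sup>2) * ((\<Sum>k\<in>J. 1 / (a - x k)) - (\<Sum>l\<in>L - {p}. 2 / (a - \<xi> l)))"
    by (rule sum_distrib_right[symmetric])
  finally show ?thesis unfolding a_def[symmetric] 2 3 by simp
qed

section \<open>Weights are controlled by velocities\<close>

lemma continuous_on_flow_field:
  assumes "\<And>j. j \<in> J \<Longrightarrow> continuous_on S (\<lambda>s. \<nu> s j)" "\<And>j. j \<in> J \<Longrightarrow> continuous_on S (\<lambda>s. x s j)"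
    "continuous_on S w" "\<And>s j. s \<in> S \<Longrightarrow> j \<in> J \<Longrightarrow> w s \<noteq> x s j"
  shows "continuous_on S (\<lambda>s. flow_field J (\<nu> s) (x s) (w s))"
  unfolding flow_field_def using assms by (intro continuous_intros) auto

lemma continuous_on_driving_velocity:
  assumes "\<And>j. j \<in> J \<Longrightarrow> continuous_on S (\<lambda>s. \<nu> s j)" "\<And>j. j \<in> J \<Longrightarrow> continuous_on S (\<lambda>s. x s j)"
    "\<And>l. l \<in> L \<Longrightarrow> continuous_on S (\<lambda>s. \<xi> s l)"
    "\<And>s j. s \<in> S \<Longrightarrow> inj_on (x s) J" "\<And>s j l. s \<in> S \<Longrightarrow> j \<in> J \<Longrightarrow> l \<in> L \<Longrightarrow> \<xi> s l \<noteq> x s j" and k: "k \<in> J"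
  shows "continuous_on S (\<lambda>s. driving_velocity J L (\<nu> s) (x s) (\<xi> s) k)"
proof -
  have "x s k \<noteq> x s i" if "s \<in> S" "i \<in> J - {k}" for s i
    using assms(4)[OF that(1)] that(2) k by (metis DiffE inj_onD singletonI)
  then show ?thesis unfolding driving_velocity_def using assms(1-3,5) k
    by (intro continuous_intros) (metis DiffE right_minus_eq)+
qed

text \<open>At the largest node every factor is positive; at the second largest exactly one factor,
  the difference to the largest, is negative.\<close>

lemma exists_alternating_node_products:
  fixes X :: "nat \<Rightarrow> real"
  assumes "finite J" "inj_on X J" "2 \<le> card J"
  shows "\<exists>i\<in>J. \<exists>k\<in>J. (\<Prod>j\<in>J - {i}. X i - X j) > 0 \<and> (\<Prod>j\<in>J - {k}. X k - X j) < 0"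
proof -
  have "J \<noteq> {}" using assms(3) by auto
  then obtain i where i: "i \<in> J" "X i = Max (X ` J)"
    using Max_in[of "X ` J"] assms(1) by (metis (no_types, lifting) finite_imageI image_iff image_is_empty)
  have "J - {i} \<noteq> {}"
  proof
    assume "J - {i} = {}"
    then have "J \<subseteq> {i}" by blast
    then have "card J \<le> 1" using card_mono[of "{i}" J] by simp
    then show False using assms(3) by simp
  qed
  then obtain k where k: "k \<in> J - {i}" "X k = Max (X ` (J - {i}))"
    using Max_in[of "X ` (J - {i})"] assms(1) by (metis (no_types, lifting) finite_Diff finite_imageI image_iff image_is_empty)
  have lt: "X j < X l" if "j \<in> J" "l \<in> J" "X j \<le> X l" "j \<noteq> l" for j l
    using that inj_onD[OF assms(2), of j l] by (metis order_less_le)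
  have "X j \<le> X i" if "j \<in> J" for j using i that assms(1) by simp
  then have i_max: "X j < X i" if "j \<in> J - {i}" for j using lt[of j i] i that by auto
  have "X j \<le> X k" if "j \<in> J - {i}" for j using k that assms(1) by simp
  then have k_max: "X j < X k" if "j \<in> J - {i} - {k}" for j using lt[of j k] k that by auto
  have "(\<Prod>j\<in>J - {i}. X i - X j) > 0" using i_max by (intro prod_pos) auto
  moreover have "(\<Prod>j\<in>J - {k}. X k - X j) = (X k - X i) * (\<Prod>j\<in>J - {k} - {i}. X k - X j)"
    using i k assms(1) by (intro prod.remove) auto
  moreover have "(\<Prod>j\<in>J - {k} - {i}. X k - X j) > 0" using k_max by (intro prod_pos) auto
  moreover have "X k - X i < 0" using i_max[of k] k by simp
  ultimately show ?thesis using i(1) k(1) by (metis DiffD1 mult_neg_pos)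
qed

text \<open>If nothing moves, the integral of motion says that \<open>V \<cdot> \<Prod>\<^sub>k (w - x\<^sub>k) / \<Prod>\<^sub>l (w - \<xi>\<^sub>l)\<^sup>2\<close> is constant,
  where \<open>V\<close> is the flow field. Evaluating at the \<open>x\<^sub>k\<close> shows that the weights alternate in sign.\<close>

lemma zero_velocity_imp_zero_weights:
  fixes X \<nu> :: "nat \<Rightarrow> real"
  assumes d: "pairwise_distinct n m X \<xi>" and c: "cnj ` (\<xi> ` {1..m}) = \<xi> ` {1..m}" and n: "2 \<le> n"
    and pos: "\<And>j. j \<in> {1..n} \<Longrightarrow> 0 \<le> \<nu> j"
    and dv: "\<And>k. k \<in> {1..n} \<Longrightarrow> driving_velocity {1..n} {1..m} (\<lambda>j. of_real (\<nu> j)) (\<lambda>j. of_real (X j)) \<xi> k = 0"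
    and ff: "\<And>l. l \<in> {1..m} \<Longrightarrow> flow_field {1..n} (\<lambda>j. of_real (\<nu> j)) (\<lambda>j. of_real (X j)) (\<xi> l) = 0"
    and k: "k \<in> {1..n}"
  shows "\<nu> k = 0"
proof -
  define J where "J = {1..n}"
  define L where "L = {1..m}"
  define x where "x = (\<lambda>j. complex_of_real (X j))"
  define u where "u = (\<lambda>j. complex_of_real (\<nu> j))"
  define Q where "Q = root_poly \<xi> L"
  define Pi where "Pi = root_poly x J"
  define q where "q = (\<lambda>j. root_poly x (J - {j}))"
  \<comment> \<open>The product \<open>V * Pi / Q\<^sup>2\<close> with its removable singularities
    at the \<open>x j\<close> filled in, so that it can be evaluated there.\<close>
  define G where "G = (\<lambda>w. (\<Sum>j\<in>J. 2 * u j * poly (q j) w) / (poly Q w)\<^sup>2)"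
  note dv = dv[folded J_def L_def x_def u_def] and ff = ff[folded J_def L_def x_def u_def]
  have fin: "finite J" "finite L" by (simp_all add: J_def L_def)
  have inj: "inj_on x J" "inj_on \<xi> L" "inj_on X J" and xl: "\<And>j l. j \<in> J \<Longrightarrow> l \<in> L \<Longrightarrow> \<xi> l \<noteq> x j"
    using pairwise_distinctD[OF d] unfolding x_def J_def L_def by blast+
  have xl': "\<xi> l \<notin> x ` J" if "l \<in> L" for l using xl that by blast
  have lx': "x j \<notin> \<xi> ` L" if "j \<in> J" for j using xl that by force
  have Q0: "poly Q w \<noteq> 0" if "w \<notin> \<xi> ` L" for w using that fin by (auto simp: Q_def)
  have Gc: "continuous_on (- (\<xi> ` L)) G"
    unfolding G_def using Q0 by (intro continuous_intros) auto
  have Gd: "DERIV G w :> 0" if w: "w \<in> - (\<xi> ` L) - x ` J" for w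
  proof -
    define V where "V = flow_field J u x"
    have w1: "w \<notin> x ` J" "w \<notin> \<xi> ` L" using w by auto
    have wx: "w - x j \<noteq> 0" if "j \<in> J" for j using w1 that by auto
    let ?SJ = "\<Sum>j\<in>J. 1 / (w - x j)" and ?SL = "\<Sum>l\<in>L. 1 / (w - \<xi> l)"
    have dPi: "poly (pderiv Pi) w = poly Pi w * ?SJ"
      unfolding Pi_def using poly_pderiv_root_poly[OF fin(1) w1(1)] by simp
    have dQ: "poly (pderiv Q) w = poly Q w * ?SL"
      unfolding Q_def using poly_pderiv_root_poly[OF fin(2) w1(2)] by simp
    have dV: "(V has_field_derivative - (\<Sum>j\<in>J. 2 * u j / (w - x j)\<^sup>2)) (at w)"
      unfolding V_def flow_field_def sum_negf[symmetric] using wx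
      by (auto intro!: derivative_eq_intros simp: power2_eq_square)
    have id: "V w * (?SJ - 2 * ?SL) = (\<Sum>j\<in>J. 2 * u j / (w - x j)\<^sup>2)"
      using integral_of_motion_identity[OF fin(1) inj(1) w1 xl', of u] dv ff
      by (simp add: V_def sum_distrib_left algebra_simps)
    have "((\<lambda>w. V w * poly Pi w / (poly Q w)\<^sup>2) has_field_derivative 
       ((- (\<Sum>j\<in>J. 2 * u j / (w - x j)\<^sup>2) * poly Pi w + V w * poly (pderiv Pi) w) * (poly Q w)\<^sup>2 
         - V w * poly Pi w * (2 * poly Q w * poly (pderiv Q) w)) / ((poly Q w)\<^sup>2 * (poly Q w)\<^sup>2)) (at w)"
      using Q0[OF w1(2)] by (auto intro!: derivative_eq_intros dV simp: algebra_simps)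
    moreover have "(- (\<Sum>j\<in>J. 2 * u j / (w - x j)\<^sup>2) * poly Pi w + V w * poly (pderiv Pi) w) * (poly Q w)\<^sup>2 
         - V w * poly Pi w * (2 * poly Q w * poly (pderiv Q) w) = 0"
      unfolding dPi dQ id[symmetric] by (simp add: power2_eq_square algebra_simps)
    ultimately have "((\<lambda>w. V w * poly Pi w / (poly Q w)\<^sup>2) has_field_derivative 0) (at w)" by simp
    then show ?thesis
    proof (rule has_field_derivative_transform_within_open)
      show "open (- (x ` J))" using fin by (intro open_Compl finite_imp_closed) auto
      show "w \<in> - (x ` J)" using w by auto
      fix v assume v: "v \<in> - (x ` J)"
      have "V v * poly Pi v = (\<Sum>j\<in>J. 2 * u j / (v - x j) * poly Pi v)"
        unfolding V_def flow_field_def by (rule sum_distrib_right)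
      also have "\<dots> = (\<Sum>j\<in>J. 2 * u j * poly (q j) v)"
      proof (rule sum.cong[OF refl])
        fix j assume j: "j \<in> J"
        have "poly Pi v = (v - x j) * poly (q j) v"
          unfolding Pi_def q_def root_poly_remove[OF fin(1) j] by (simp del: mult_pCons_left)
        moreover have "v - x j \<noteq> 0" using v j by auto
        ultimately show "2 * u j / (v - x j) * poly Pi v = 2 * u j * poly (q j) v" by simp
      qed
      finally show "V v * poly Pi v / (poly Q v)\<^sup>2 = G v" by (simp add: G_def)
    qed
  qed
  have "connected (- (\<xi> ` L))"
    using fin by (intro path_connected_imp_connected path_connected_complement_countable) (auto simp: countable_finite)
  moreover have "open (- (\<xi> ` L))" using fin by (intro open_Compl finite_imp_closed) auto
  \<comment> \<open>The derivative of \<open>G\<close> is known only off the \<open>x j\<close>;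
    continuity bridges these finitely many points of the connected domain.\<close>
  ultimately obtain C where C: "\<And>w. w \<in> - (\<xi> ` L) \<Longrightarrow> G w = C"
    using DERIV_zero_connected_constant[OF _ _ _ Gc, of "x ` J"] Gd fin by blast
  define p where "p = (\<lambda>j. \<Prod>i\<in>J - {j}. X j - X i)"
  have Qr: "\<exists>r. r \<noteq> 0 \<and> poly Q (x j) = of_real r" if j: "j \<in> J" for j
  proof -
    have "map_poly cnj Q = Q" unfolding Q_def using c inj(2) by (intro map_poly_cnj_root_poly) (auto simp: L_def)
    then have "cnj (poly Q (x j)) = poly Q (x j)" using poly_cnj[of Q "x j"] by (simp add: x_def)
    then have "poly Q (x j) = of_real (Re (poly Q (x j)))" by (simp add: complex_eq_iff)
    moreover have "poly Q (x j) \<noteq> 0" using Q0 lx'[OF j] by blast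
    ultimately show ?thesis by (metis of_real_0)
  qed
  \<comment> \<open>Only the term with index \<open>j\<close> survives at \<open>x j\<close>, and
    \<open>Q\<close> is real and nonzero there, so \<open>C\<close> is a positive multiple of
    \<open>\<nu> j * p j\<close>.\<close>
  have Gx: "\<exists>r>0. C = of_real (\<nu> j * p j * r)" if j: "j \<in> J" for j
  proof -
    obtain r where r: "r \<noteq> 0" "poly Q (x j) = of_real r" using Qr[OF j] by blast
    have "poly (q i) (x j) = 0" if "i \<in> J - {j}" for i
      using j that fin by (auto simp: q_def)
    then have "(\<Sum>i\<in>J. 2 * u i * poly (q i) (x j)) = 2 * u j * poly (q j) (x j)"
      by (subst sum.remove[OF fin(1) j]) simp
    moreover have "poly (q j) (x j) = of_real (p j)" by (simp add: q_def x_def p_def)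
    ultimately have "G (x j) = of_real (\<nu> j * p j * (2 / r\<^sup>2))" by (simp add: G_def r u_def)
    then have "C = of_real (\<nu> j * p j * (2 / r\<^sup>2))" using C[of "x j"] lx'[OF j] by (metis ComplI)
    moreover have "2 / r\<^sup>2 > 0" using r by simp
    ultimately show ?thesis by blast
  qed
  obtain a b where ab: "a \<in> J" "b \<in> J" "p a > 0" "p b < 0"
    using exists_alternating_node_products[OF fin(1) inj(3)] n unfolding p_def J_def by auto
  obtain r1 where r1: "r1 > 0" "C = of_real (\<nu> a * p a * r1)" using Gx ab by blast
  obtain r2 where r2: "r2 > 0" "C = of_real (\<nu> b * p b * r2)" using Gx ab by blast
  have "\<nu> a * p a * r1 \<ge> 0" "\<nu> b * p b * r2 \<le> 0"
    using pos[of a] pos[of b] ab r1 r2 by (auto simp: J_def mult_nonneg_nonpos mult_nonpos_nonneg)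
  then have "C = 0" using r1 r2 by (metis of_real_0 of_real_eq_iff order_antisym)
  obtain r3 where r3: "r3 > 0" "C = of_real (\<nu> k * p k * r3)" using Gx k unfolding J_def by blast
  have "p k \<noteq> 0" unfolding p_def using fin inj_onD[OF inj(3), of k] k by (auto simp: J_def)
  then show ?thesis using r3 \<open>C = 0\<close> by simp
qed

text \<open>Weights are functions on all of \<open>nat\<close>, so this is Tychonoff's theorem for
  an infinite cube; coordinates outside \<open>{1..n}\<close> range freely over the unit
  interval.\<close>

lemma compact_unit_simplex:
  "compact {\<nu> :: nat \<Rightarrow> real. (\<forall>j. 0 \<le> \<nu> j \<and> \<nu> j \<le> 1) \<and> (\<Sum>j\<in>{1..n}. \<nu> j) = 1}"
proof -
  have "compactin (product_topology (\<lambda>i. euclidean) UNIV) (PiE UNIV (\<lambda>_::nat. {0..1::real}))"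
    unfolding compactin_PiE by simp
  then have "compact (PiE UNIV (\<lambda>_::nat. {0..1::real}))"
    unfolding euclidean_product_topology by simp
  moreover have "closed {\<nu> :: nat \<Rightarrow> real. (\<Sum>j\<in>{1..n}. \<nu> j) = 1}"
    by (intro closed_Collect_eq continuous_on_const continuous_on_sum continuous_on_product_coordinates)
  ultimately have "compact (PiE UNIV (\<lambda>_::nat. {0..1::real}) \<inter> {\<nu>. (\<Sum>j\<in>{1..n}. \<nu> j) = 1})"
    by (rule compact_Int_closed)
  moreover have "PiE UNIV (\<lambda>_::nat. {0..1::real}) \<inter> {\<nu>. (\<Sum>j\<in>{1..n}. \<nu> j) = 1} = 
    {\<nu>. (\<forall>j. 0 \<le> \<nu> j \<and> \<nu> j \<le> 1) \<and> (\<Sum>j\<in>{1..n}. \<nu> j) = 1}"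
    by (auto simp: PiE_iff)
  ultimately show ?thesis by simp
qed

text \<open>Velocities are homogeneous of degree one in the weights. So it is enough to bound the
  total speed below by some \<open>e > 0\<close> on the compact product of the time interval with
  the simplex, where it is continuous and has no zero; then \<open>C = 1 / e\<close>.\<close>

lemma weights_le_velocities:
  fixes X :: "real \<Rightarrow> nat \<Rightarrow> real" and p :: "real \<Rightarrow> nat \<Rightarrow> complex"
  assumes d: "\<And>s. s \<in> {0..t} \<Longrightarrow> pairwise_distinct n m (X s) (p s)"
    and c: "\<And>s. s \<in> {0..t} \<Longrightarrow> cnj ` (p s ` {1..m}) = p s ` {1..m}" and n: "2 \<le> n"
    and X: "\<And>j. j \<in> {1..n} \<Longrightarrow> continuous_on {0..t} (\<lambda>s. X s j)"
    and p: "\<And>l. l \<in> {1..m} \<Longrightarrow> continuous_on {0..t} (\<lambda>s. p s l)"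
  shows "\<exists>C\<ge>0. \<forall>s\<in>{0..t}. \<forall>\<nu>. (\<forall>j\<in>{1..n}. 0 \<le> \<nu> j) \<longrightarrow> (\<Sum>j\<in>{1..n}. \<nu> j) \<le>
      C * ((\<Sum>k\<in>{1..n}. norm (driving_velocity {1..n} {1..m} (\<lambda>j. of_real (\<nu> j)) (\<lambda>j. of_real (X s j)) (p s) k))
         + (\<Sum>l\<in>{1..m}. norm (flow_field {1..n} (\<lambda>j. of_real (\<nu> j)) (\<lambda>j. of_real (X s j)) (p s l))))"
proof (cases "0 \<le> t")
  case False
  then show ?thesis by (intro exI[of _ 0]) auto
next
  case True
  define \<Psi> where "\<Psi> = (\<lambda>s \<nu>. (\<Sum>k\<in>{1..n}. norm (driving_velocity {1..n} {1..m} (\<lambda>j. of_real (\<nu> j)) (\<lambda>j. of_real (X s j)) (p s) k))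
         + (\<Sum>l\<in>{1..m}. norm (flow_field {1..n} (\<lambda>j. of_real (\<nu> j)) (\<lambda>j. of_real (X s j)) (p s l))))"
  define K where "K = {\<nu> :: nat \<Rightarrow> real. (\<forall>j. 0 \<le> \<nu> j \<and> \<nu> j \<le> 1) \<and> (\<Sum>j\<in>{1..n}. \<nu> j) = 1}"
  have "compact ({0..t} \<times> K)" unfolding K_def by (intro compact_Times compact_unit_simplex) simp
  moreover have "(\<lambda>j. if j = 1 then 1 else 0) \<in> K" using n by (auto simp: K_def)
  then have "{0..t} \<times> K \<noteq> {}" using True by auto
  moreover have "continuous_on ({0..t} \<times> K) (\<lambda>z. \<Psi> (fst z) (snd z))"
  proof -
    have cx: "continuous_on ({0..t} \<times> K) (\<lambda>z. complex_of_real (X (fst z) j))" if "j \<in> {1..n}" for j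
      by (intro continuous_intros continuous_on_compose2[OF X[OF that]]) auto
    have cp: "continuous_on ({0..t} \<times> K) (\<lambda>z. p (fst z) l)" if "l \<in> {1..m}" for l
      by (intro continuous_on_compose2[OF p[OF that]] continuous_intros) auto
    have cn: "continuous_on ({0..t} \<times> K) (\<lambda>z. complex_of_real (snd z j))" for j
      by (intro continuous_intros continuous_on_compose2[OF continuous_on_product_coordinates]) auto
    note dd = pairwise_distinctD[OF d]
    have inj: "inj_on (\<lambda>j. complex_of_real (X (fst z) j)) {1..n}"
      and ne: "\<And>j l. j \<in> {1..n} \<Longrightarrow> l \<in> {1..m} \<Longrightarrow> p (fst z) l \<noteq> complex_of_real (X (fst z) j)"
      if "z \<in> {0..t} \<times> K" for z
      using dd(3,4)[of "fst z"] that by (simp_all add: mem_Times_iff)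
    show ?thesis unfolding \<Psi>_def
      by (intro continuous_on_add continuous_on_sum continuous_on_norm continuous_on_flow_field
          continuous_on_driving_velocity cx cp cn inj ne)
  qed
  ultimately obtain z where z: "z \<in> {0..t} \<times> K" "\<And>z'. z' \<in> {0..t} \<times> K \<Longrightarrow> \<Psi> (fst z) (snd z) \<le> \<Psi> (fst z') (snd z')"
    using continuous_attains_inf[of "{0..t} \<times> K" "\<lambda>z. \<Psi> (fst z) (snd z)"] by blast
  define e where "e = \<Psi> (fst z) (snd z)"
  have \<Psi>0: "\<Psi> s \<nu> \<ge> 0" for s \<nu> unfolding \<Psi>_def by (intro add_nonneg_nonneg sum_nonneg) auto
  have "e \<noteq> 0"
  proof
    assume "e = 0"
    then have e0: "(\<Sum>k\<in>{1..n}. norm (driving_velocity {1..n} {1..m} (\<lambda>j. of_real (snd z j)) (\<lambda>j. of_real (X (fst z) j)) (p (fst z)) k)) = 0"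
       "(\<Sum>l\<in>{1..m}. norm (flow_field {1..n} (\<lambda>j. of_real (snd z j)) (\<lambda>j. of_real (X (fst z) j)) (p (fst z) l))) = 0"
      unfolding e_def \<Psi>_def by (smt (verit) norm_ge_zero sum_nonneg)+
    have s: "fst z \<in> {0..t}" and zK: "snd z \<in> K" using z(1) by auto
    have "snd z k = 0" if "k \<in> {1..n}" for k
    proof (rule zero_velocity_imp_zero_weights[OF d[OF s] c[OF s] n _ _ _ that])
      show "0 \<le> snd z j" for j using zK by (auto simp: K_def)
      show "driving_velocity {1..n} {1..m} (\<lambda>j. complex_of_real (snd z j)) (\<lambda>j. complex_of_real (X (fst z) j)) (p (fst z)) k = 0"
        if "k \<in> {1..n}" for k using e0(1) that by (subst (asm) sum_nonneg_eq_0_iff) auto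
      show "flow_field {1..n} (\<lambda>j. complex_of_real (snd z j)) (\<lambda>j. complex_of_real (X (fst z) j)) (p (fst z) l) = 0"
        if "l \<in> {1..m}" for l using e0(2) that by (subst (asm) sum_nonneg_eq_0_iff) auto
    qed
    then show False using zK by (auto simp: K_def)
  qed
  then have e: "e > 0" using \<Psi>0[of "fst z" "snd z"] by (simp add: e_def)
  have scale: "\<Psi> s (\<lambda>j. r * \<nu> j) = r * \<Psi> s \<nu>" if "r \<ge> 0" for r s \<nu>
  proof -
    have "driving_velocity {1..n} {1..m} (\<lambda>j. complex_of_real (r * \<nu> j)) (\<lambda>j. of_real (X s j)) (p s) k
      = of_real r * driving_velocity {1..n} {1..m} (\<lambda>j. complex_of_real (\<nu> j)) (\<lambda>j. of_real (X s j)) (p s) k" for k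
      unfolding driving_velocity_def by (simp add: sum_distrib_left algebra_simps)
    moreover have "flow_field {1..n} (\<lambda>j. complex_of_real (r * \<nu> j)) (\<lambda>j. of_real (X s j)) w
      = of_real r * flow_field {1..n} (\<lambda>j. complex_of_real (\<nu> j)) (\<lambda>j. of_real (X s j)) w" for w
      unfolding flow_field_def by (simp add: sum_distrib_left algebra_simps)
    ultimately show ?thesis unfolding \<Psi>_def using that
      by (simp add: norm_mult sum_distrib_left distrib_left)
  qed
  have "(\<Sum>j\<in>{1..n}. \<nu> j) \<le> 1 / e * \<Psi> s \<nu>" if s: "s \<in> {0..t}" and pos: "\<forall>j\<in>{1..n}. 0 \<le> \<nu> j" for s \<nu>
  proof (cases "(\<Sum>j\<in>{1..n}. \<nu> j) = 0")
    case True
    then show ?thesis using \<Psi>0 e by simp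
  next
    case False
    define N where "N = (\<Sum>j\<in>{1..n}. \<nu> j)"
    have "N \<ge> 0" unfolding N_def using pos by (intro sum_nonneg) auto
    then have N: "N > 0" using False N_def by simp
    \<comment> \<open>Cut off to \<open>0\<close> outside \<open>{1..n}\<close>, where
      \<open>\<nu>\<close> is arbitrary while \<open>K\<close> demands values between
      \<open>0\<close> and \<open>1\<close>.\<close>
    define \<nu>' where "\<nu>' = (\<lambda>j. if j \<in> {1..n} then 1 / N * \<nu> j else 0)"
    have "\<nu> j \<le> N" if "j \<in> {1..n}" for j
      unfolding N_def using pos that by (intro member_le_sum) auto
    moreover have "(\<Sum>j\<in>{1..n}. \<nu>' j) = 1"
      using N unfolding \<nu>'_def by (simp add: sum_divide_distrib[symmetric] N_def)
    ultimately have "\<nu>' \<in> K" using N pos by (auto simp: K_def \<nu>'_def)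
    then have "e \<le> \<Psi> s \<nu>'" using z(2)[of "(s, \<nu>')"] s by (auto simp: e_def)
    also have "\<Psi> s \<nu>' = \<Psi> s (\<lambda>j. 1 / N * \<nu> j)"
      unfolding \<Psi>_def driving_velocity_def flow_field_def \<nu>'_def
      by (intro arg_cong2[where f = "(+)"] sum.cong refl arg_cong[where f = norm] arg_cong2[where f = "(*)"] arg_cong2[where f = "(/)"]) auto
    also have "\<dots> = 1 / N * \<Psi> s \<nu>" using N by (intro scale) auto
    finally show ?thesis using N e unfolding N_def[symmetric] by (simp add: field_simps)
  qed
  then show ?thesis unfolding \<Psi>_def using e by (intro exI[of _ "1 / e"]) auto
qed

section \<open>Poles and critical points under the flow\<close>

lemma Im_flow_field:
  "Im (flow_field J (\<lambda>j. complex_of_real (\<nu> j)) (\<lambda>j. complex_of_real (X j)) w)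
     = - Im w * (\<Sum>j\<in>J. 2 * \<nu> j / (norm (w - complex_of_real (X j)))\<^sup>2)"
proof -
  have "Im (2 * complex_of_real (\<nu> j) / (w - complex_of_real (X j))) 
      = - Im w * (2 * \<nu> j / (norm (w - complex_of_real (X j)))\<^sup>2)" for j
    by (simp add: Im_divide cmod_power2)
  then show ?thesis unfolding flow_field_def Im_sum sum_distrib_left by (intro sum.cong refl) simp
qed

lemma cnj_flow_field:
  "cnj (flow_field J (\<lambda>j. complex_of_real (\<nu> j)) (\<lambda>j. complex_of_real (X j)) w)
     = flow_field J (\<lambda>j. complex_of_real (\<nu> j)) (\<lambda>j. complex_of_real (X j)) (cnj w)"
  unfolding flow_field_def by simp

lemma complex_of_real_Im_bounded_linear: "bounded_linear (\<lambda>w. complex_of_real (Im w))"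
  by (intro bounded_linear_compose[OF bounded_linear_of_real bounded_linear_Im])

lemma solves_upto_Re_le:
  assumes "solves_upto T y f" "t \<in> {0..T}" "\<And>s. s \<in> {0..t} \<Longrightarrow> Re (f s) \<le> 0"
  shows "Re (y t) \<le> Re (y 0)"
proof -
  have i: "f integrable_on {0..t}"
    using assms(1,2) by (auto simp: solves_upto_def absolutely_integrable_on_def)
  have "(\<lambda>s. Re (f s)) integrable_on {0..t}" 
    using integrable_linear[OF i bounded_linear_Re] by (simp add: o_def)
  then have "integral {0..t} (\<lambda>s. - Re (f s)) \<ge> 0"
    using assms(3) by (intro Henstock_Kurzweil_Integration.integral_nonneg integrable_neg) auto
  moreover have "Re (integral {0..t} f) = integral {0..t} (\<lambda>s. Re (f s))"
    using integral_linear[OF i bounded_linear_Re] by (simp add: o_def)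
  ultimately show ?thesis using solves_uptoD(2)[OF assms(1,2)] by simp
qed

section \<open>The flow up to a time before any collision\<close>

locale loewner_flow =
  fixes n m :: nat and \<nu> :: "nat \<Rightarrow> real \<Rightarrow> real" and x0 :: "nat \<Rightarrow> real" and \<xi> :: "nat \<Rightarrow> complex"
    and T :: real and X :: "nat \<Rightarrow> real \<Rightarrow> real" and g :: "real \<Rightarrow> complex \<Rightarrow> complex" and t :: real
  assumes mn: "0 < m" "m \<le> n div 2"
    and conj: "cnj ` (\<xi> ` {1..m}) = \<xi> ` {1..m}"
    and par: "parametrization n \<nu>"
    and flow: "multiple_loewner_flow n m \<nu> x0 \<xi> T X g"
    and tT: "t \<in> {0..T}"
    and distinct: "\<And>s. s \<in> {0..t} \<Longrightarrow> pairwise_distinct n m (\<lambda>j. X j s) (\<lambda>l. g s (\<xi> l))"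
begin

abbreviation u :: "real \<Rightarrow> nat \<Rightarrow> complex" where "u s \<equiv> \<lambda>j. complex_of_real (\<nu> j s)"
abbreviation x :: "real \<Rightarrow> nat \<Rightarrow> complex" where "x s \<equiv> \<lambda>j. complex_of_real (X j s)"
abbreviation p :: "real \<Rightarrow> nat \<Rightarrow> complex" where "p s \<equiv> \<lambda>l. g s (\<xi> l)"
abbreviation V :: "real \<Rightarrow> complex \<Rightarrow> complex" where "V s \<equiv> flow_field {1..n} (u s) (x s)"

text \<open>The strict inequality excludes the swallowing time, at which the right-hand side of the
  equation is singular; the bound by \<open>t\<close> keeps \<open>s\<close> in the collision-free
  range.\<close>

definition live :: "complex \<Rightarrow> real \<Rightarrow> bool" where
  "live z s \<longleftrightarrow> 0 \<le> Im z \<and> s \<in> {0..t} \<and> ereal s < swallowing_time n X g z"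

lemma n_ge_2: "2 \<le> n" using mn by auto

lemma nu_nonneg: "j \<in> {1..n} \<Longrightarrow> 0 \<le> s \<Longrightarrow> 0 \<le> \<nu> j s"
  using par by (auto simp: parametrization_def)

lemma g_0: "0 \<le> Im z \<Longrightarrow> g 0 z = z"
  using flow unfolding multiple_loewner_flow_def by blast

lemma g_reflect: "s \<in> {0..t} \<Longrightarrow> Im z < 0 \<Longrightarrow> g s z = cnj (g s (cnj z))"
  using flow tT unfolding multiple_loewner_flow_def by auto

lemma live_mono: "live z s \<Longrightarrow> r \<in> {0..s} \<Longrightarrow> live z r"
  unfolding live_def using order_le_less_trans[of "ereal r" "ereal s"] by auto

lemma live_not_hit: "live z s \<Longrightarrow> j \<in> {1..n} \<Longrightarrow> g s z \<noteq> x s j"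
  using Inf_lower[of "ereal s" "ereal ` {t. 0 \<le> t \<and> hits n X g z t}"]
  unfolding live_def swallowing_time_def hits_def by fastforce

lemma live_solves: "live z s \<Longrightarrow> solves_upto s (\<lambda>r. g r z) (\<lambda>r. V r (g r z))"
  using flow tT unfolding multiple_loewner_flow_def live_def flow_field_def by auto

lemma live_continuous: "live z s \<Longrightarrow> continuous_on {0..s} (\<lambda>r. g r z)"
  using live_solves solves_upto_continuous by blast

lemma not_live:
  assumes "0 \<le> Im z" "s \<in> {0..t}" "\<not> live z s"
  obtains \<tau> where "\<tau> \<in> {0..s}" "hits n X g z \<tau>" "swallowing_time n X g z = ereal \<tau>"
    "continuous_on {0..\<tau>} (\<lambda>r. g r z)" "\<And>r. r \<in> {0..<\<tau>} \<Longrightarrow> live z r"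
proof -
  have sw: "swallowing_time n X g z \<le> ereal s" using assms by (auto simp: live_def)
  also have "ereal s \<le> ereal T" using assms(2) tT by auto
  finally obtain \<tau> where \<tau>: "\<tau> \<in> {0..T}" "swallowing_time n X g z = ereal \<tau>" "hits n X g z \<tau>"
    using flow assms(1) unfolding multiple_loewner_flow_def by blast
  have "\<tau> \<in> {0..s}" using \<tau> sw by auto
  moreover have "continuous_on {t \<in> {0..T}. ereal t \<le> ereal \<tau>} (\<lambda>t. g t z)"
    using flow assms(1) \<tau>(2) unfolding multiple_loewner_flow_def by metis
  then have "continuous_on {0..\<tau>} (\<lambda>r. g r z)"
    by (rule continuous_on_subset) (use \<tau> in auto)
  moreover have "live z r" if "r \<in> {0..<\<tau>}" for r
    using that assms \<tau>(2) \<open>\<tau> \<in> {0..s}\<close> by (auto simp: live_def)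
  ultimately show ?thesis using that \<tau> by blast
qed

text \<open>A pole that is swallowed sits on a driving point at that time, which would be a
  collision.\<close>

lemma live_pole: "l \<in> {1..m} \<Longrightarrow> 0 \<le> Im (\<xi> l) \<Longrightarrow> s \<in> {0..t} \<Longrightarrow> live (\<xi> l) s"
proof (rule ccontr)
  assume l: "l \<in> {1..m}" and a: "0 \<le> Im (\<xi> l)" "s \<in> {0..t}" "\<not> live (\<xi> l) s"
  obtain \<tau> where "\<tau> \<in> {0..s}" "hits n X g (\<xi> l) \<tau>" using not_live[OF a] by blast
  then show False using pairwise_distinctD(4)[OF distinct[of \<tau>]] l a(2) unfolding hits_def by fastforce
qed

text \<open>The linear equation for the imaginary part cannot be solved yet: integrability of the
  weights is derived from the conjugation symmetry of the poles, which rests on this lemma. Instead,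
  the square of the imaginary part starts at \<open>0\<close> and has nonpositive velocity.\<close>

lemma live_real:
  assumes z: "live z s" "Im z = 0"
  shows "Im (g s z) = 0"
proof -
  define y where "y = (\<lambda>r. complex_of_real (Im (g r z)))"
  have "solves_upto s y (\<lambda>r. complex_of_real (Im (V r (g r z))))"
    unfolding y_def by (rule solves_upto_linear_image[OF live_solves[OF z(1)] complex_of_real_Im_bounded_linear])
  note sq = solves_upto_mult[OF this this]
  have s: "s \<in> {0..s}" using z(1) by (auto simp: live_def)
  have "Re (y s * y s) \<le> Re (y 0 * y 0)"
  proof (rule solves_upto_Re_le[OF sq s])
    fix r assume r: "r \<in> {0..s}"
    let ?S = "\<Sum>j\<in>{1..n}. 2 * \<nu> j r / (norm (g r z - x r j))\<^sup>2"
    have "Re (complex_of_real (Im (V r (g r z))) * y r + y r * complex_of_real (Im (V r (g r z))))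
        = - 2 * ((Im (g r z))\<^sup>2 * ?S)"
      unfolding y_def Im_flow_field by (simp add: power2_eq_square)
    moreover have "0 \<le> ?S" using nu_nonneg r by (intro sum_nonneg) auto
    ultimately show "Re (complex_of_real (Im (V r (g r z))) * y r + y r * complex_of_real (Im (V r (g r z)))) \<le> 0"
      by (simp only:) (simp add: mult_nonneg_nonneg del: power2_eq_square)
  qed
  also have "y 0 = 0" unfolding y_def using z g_0 by (simp add: live_def)
  finally have "(Im (g s z))\<^sup>2 \<le> 0" by (simp add: y_def power2_eq_square)
  then show ?thesis by simp
qed

text \<open>Reflection is part of the flow only for starting points strictly below the axis; a real
  pole is its own conjugate and has to be shown to stay real.\<close>

lemma conj_pole:
  assumes "l \<in> {1..m}"
  obtains l' where "l' \<in> {1..m}" "\<xi> l' = cnj (\<xi> l)" "\<And>s. s \<in> {0..t} \<Longrightarrow> p s l' = cnj (p s l)"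
proof -
  have "cnj (\<xi> l) \<in> \<xi> ` {1..m}" using conj assms by blast
  then obtain l' where l': "l' \<in> {1..m}" "\<xi> l' = cnj (\<xi> l)" by force
  have "p s l' = cnj (p s l)" if s: "s \<in> {0..t}" for s
  proof (cases "Im (\<xi> l)" "0 :: real" rule: linorder_cases)
    case less
    then show ?thesis using g_reflect[OF s less] l' by simp
  next
    case greater
    then show ?thesis using g_reflect[OF s, of "\<xi> l'"] l' by simp
  next
    case equal
    then have "p s l' = p s l" using l' by (metis complex_cnj_cancel_iff complex_cnj complex_eq_iff complex_is_Real_iff Reals_cnj_iff)
    moreover have "Im (p s l) = 0" using live_real[OF live_pole[OF assms _ s]] equal by simp
    ultimately show ?thesis by (metis Reals_cnj_iff complex_is_Real_iff)
  qed
  then show ?thesis using that l' by blast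
qed

lemma conj_closed: "s \<in> {0..t} \<Longrightarrow> cnj ` (p s ` {1..m}) = p s ` {1..m}"
proof -
  assume s: "s \<in> {0..t}"
  have "cnj w \<in> p s ` {1..m}" if w: "w \<in> p s ` {1..m}" for w
  proof -
    obtain l where l: "l \<in> {1..m}" "w = p s l" using w by blast
    obtain l' where "l' \<in> {1..m}" "p s l' = cnj (p s l)" using conj_pole[OF l(1)] s by metis
    then show ?thesis using l by (metis image_eqI)
  qed
  then have "cnj ` (p s ` {1..m}) \<subseteq> p s ` {1..m}" "p s ` {1..m} \<subseteq> cnj ` (p s ` {1..m})"
    by (blast, metis complex_cnj_cnj image_eqI subsetI)
  then show ?thesis by blast
qed

text \<open>The equation is given only in the closed upper half-plane; a pole below the axis
  inherits it from its conjugate partner, since weights and driving points are real.\<close>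

lemma pole_solves:
  assumes l: "l \<in> {1..m}"
  shows "solves_upto t (\<lambda>s. p s l) (\<lambda>s. V s (p s l))"
proof -
  have t: "t \<in> {0..t}" using tT by simp
  show ?thesis
  proof (cases "0 \<le> Im (\<xi> l)")
    case True
    then show ?thesis using live_solves live_pole[OF l True t] by blast
  next
    case False
    obtain l' where l': "l' \<in> {1..m}" "\<xi> l' = cnj (\<xi> l)" "\<And>s. s \<in> {0..t} \<Longrightarrow> p s l' = cnj (p s l)"
      using conj_pole[OF l] by blast
    have "solves_upto t (\<lambda>s. p s l') (\<lambda>s. V s (p s l'))"
      using live_solves live_pole[OF l'(1) _ t] l'(2) False by simp
    from solves_upto_linear_image[OF this bounded_linear_cnj]
    show ?thesis by (rule solves_upto_cong) (simp_all only: cnj_flow_field l'(3) complex_cnj_cnj)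
  qed
qed

lemma driving_solves:
  assumes "j \<in> {1..n}"
  shows "solves_upto t (\<lambda>s. x s j) (\<lambda>s. driving_velocity {1..n} {1..m} (u s) (x s) (p s) j)"
proof -
  have "solves_upto T (\<lambda>s. x s j) (\<lambda>s. driving_velocity {1..n} {1..m} (u s) (x s) (p s) j)"
    using flow assms unfolding multiple_loewner_flow_def driving_velocity_def by blast
  then show ?thesis by (rule solves_upto_mono) (use tT in simp)
qed

lemma X_0: "j \<in> {1..n} \<Longrightarrow> X j 0 = x0 j"
  using flow unfolding multiple_loewner_flow_def by blast

lemma p_0: "l \<in> {1..m} \<Longrightarrow> p 0 l = \<xi> l"
  using g_0[of "\<xi> l"] g_reflect[of 0 "\<xi> l"] g_0[of "cnj (\<xi> l)"] tT by (cases "0 \<le> Im (\<xi> l)") auto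

lemma X_continuous: "j \<in> {1..n} \<Longrightarrow> continuous_on {0..t} (X j)"
  using continuous_on_Re[OF solves_upto_continuous[OF driving_solves]] by simp

lemma x_continuous: "j \<in> {1..n} \<Longrightarrow> continuous_on {0..t} (\<lambda>s. x s j)"
  using solves_upto_continuous[OF driving_solves] .

lemma p_continuous: "l \<in> {1..m} \<Longrightarrow> continuous_on {0..t} (\<lambda>s. p s l)"
  using solves_upto_continuous[OF pole_solves] .

text \<open>Absolute continuity of the paths makes their velocities integrable, and these dominate
  the measurable weights.\<close>

lemma nu_integrable:
  assumes j: "j \<in> {1..n}"
  shows "\<nu> j absolutely_integrable_on {0..t}"
proof -
  obtain C where C: "C \<ge> 0" "\<And>s \<nu>. s \<in> {0..t} \<Longrightarrow> (\<forall>j\<in>{1..n}. 0 \<le> \<nu> j) \<Longrightarrow> (\<Sum>j\<in>{1..n}. \<nu> j) \<le>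
      C * ((\<Sum>k\<in>{1..n}. norm (driving_velocity {1..n} {1..m} (\<lambda>j. of_real (\<nu> j)) (x s) (p s) k))
         + (\<Sum>l\<in>{1..m}. norm (flow_field {1..n} (\<lambda>j. of_real (\<nu> j)) (x s) (p s l))))"
    using weights_le_velocities[OF distinct conj_closed n_ge_2 X_continuous p_continuous] by blast
  let ?b = "\<lambda>s. C * ((\<Sum>k\<in>{1..n}. norm (driving_velocity {1..n} {1..m} (u s) (x s) (p s) k))
         + (\<Sum>l\<in>{1..m}. norm (V s (p s l))))"
  show ?thesis
  proof (rule measurable_bounded_by_integrable_imp_absolutely_integrable)
    show "\<nu> j \<in> borel_measurable (lebesgue_on {0..t})"
      using par j unfolding parametrization_def
      by (auto intro: measurable_restrict_mono[where A = "{0..}"])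
    have "(\<lambda>s. norm (driving_velocity {1..n} {1..m} (u s) (x s) (p s) k)) integrable_on {0..t}" if "k \<in> {1..n}" for k
      using solves_uptoD(1)[OF driving_solves[OF that]] by (simp add: absolutely_integrable_on_def)
    moreover have "(\<lambda>s. norm (V s (p s l))) integrable_on {0..t}" if "l \<in> {1..m}" for l
      using solves_uptoD(1)[OF pole_solves[OF that]] by (simp add: absolutely_integrable_on_def)
    ultimately show "?b integrable_on {0..t}"
      by (intro integrable_on_mult_right Henstock_Kurzweil_Integration.integrable_add Henstock_Kurzweil_Integration.integrable_sum) auto
    fix s assume s: "s \<in> {0..t}"
    have pos: "\<forall>j\<in>{1..n}. 0 \<le> \<nu> j s" using nu_nonneg s by auto
    have "\<nu> j s \<le> (\<Sum>j\<in>{1..n}. \<nu> j s)" using pos j by (intro member_le_sum) auto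
    also have "\<dots> \<le> ?b s" using C(2)[OF s, of "\<lambda>j. \<nu> j s"] pos by blast
    finally show "norm (\<nu> j s) \<le> ?b s" using pos j by simp
  qed simp
qed

lemma u_integrable: "j \<in> {1..n} \<Longrightarrow> (\<lambda>s. u s j) absolutely_integrable_on {0..t}"
  using absolutely_integrable_linear[OF nu_integrable bounded_linear_of_real] by (simp add: o_def)

lemma u_mult_integrable:
  assumes "s \<in> {0..t}" "\<And>j. j \<in> {1..n} \<Longrightarrow> continuous_on {0..s} (c j)"
  shows "(\<lambda>r. \<Sum>j\<in>{1..n}. 2 * u r j * c j r) absolutely_integrable_on {0..s}"
proof (rule absolutely_integrable_sum)
  fix j assume j: "j \<in> {1..n}"
  have "(\<lambda>r. u r j) absolutely_integrable_on {0..s}"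
    by (rule absolutely_integrable_on_subinterval[OF u_integrable[OF j]]) (use assms in auto)
  moreover have "continuous_on {0..s} (\<lambda>r. 2 * c j r)" using assms(2)[OF j] by (intro continuous_intros)
  ultimately show "(\<lambda>r. 2 * u r j * c j r) absolutely_integrable_on {0..s}"
    using absolutely_integrable_continuous_mult[of 0 s "\<lambda>r. 2 * c j r" "\<lambda>r. u r j"] by (simp add: mult_ac)
qed simp

lemma stationary_preserved:
  assumes st: "stationary_relations n m x0 \<xi>" and s: "s \<in> {0..t}"
  shows "stationary_relations n m (\<lambda>j. X j s) (p s)"
  unfolding stationary_relations_def
proof
  fix k assume k: "k \<in> {1..m}"
  note dd = pairwise_distinctD[OF distinct]
  \<comment> \<open>\<open>B\<close> is the negative of the stationary expression, and its velocity
    is \<open>a * B\<close>. The coefficient \<open>a\<close> is integrable because the denominators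
    are continuous and never vanish on \<open>{0..t}\<close>.\<close>
  define B where "B = (\<lambda>s. (\<Sum>j\<in>{1..n}. 1 / (p s k - x s j)) - (\<Sum>l\<in>{1..m} - {k}. 2 * (1 / (p s k - p s l))))"
  define a where "a = (\<lambda>s. \<Sum>j\<in>{1..n}. 2 * u s j / (p s k - x s j)\<^sup>2)"
  have nx: "p s k - x s j \<noteq> 0" if "s \<in> {0..t}" "j \<in> {1..n}" for s j
    using dd(4)[OF that k] by simp
  have np: "p s k - p s l \<noteq> 0" if "s \<in> {0..t}" "l \<in> {1..m} - {k}" for s l
    using inj_onD[OF dd(2)[OF that(1)], of k l] k that(2) by auto
  have "solves_upto t B (\<lambda>s. (\<Sum>j\<in>{1..n}. - (V s (p s k) - driving_velocity {1..n} {1..m} (u s) (x s) (p s) j) / (p s k - x s j)\<^sup>2)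
      - (\<Sum>l\<in>{1..m} - {k}. 2 * (- (V s (p s k) - V s (p s l)) / (p s k - p s l)\<^sup>2)))"
    unfolding B_def
    by (intro solves_upto_diff solves_upto_sum solves_upto_cmult solves_upto_inverse pole_solves driving_solves k nx np) auto
  then have "solves_upto t B (\<lambda>s. a s * B s)"
  proof (rule solves_upto_cong)
    fix s assume s: "s \<in> {0..t}"
    have "p s l \<notin> x s ` {1..n}" if "l \<in> {1..m}" for l using dd(4)[OF s _ that] by blast
    note id = stationary_relation_velocity[OF finite_atLeastAtMost dd(3)[OF s] finite_atLeastAtMost dd(2)[OF s] this k, of "u s"]
    have e1: "(\<Sum>j\<in>J. - A j / D j) = - (\<Sum>j\<in>J. A j / D j)"
      and e2: "(\<Sum>j\<in>J. 2 * (- A j / D j)) = - (2 * (\<Sum>j\<in>J. A j / D j))"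
      and e3: "(\<Sum>j\<in>J. 2 * (1 / D j)) = (\<Sum>j\<in>J. 2 / D j)" for A D :: "nat \<Rightarrow> complex" and J
      by (simp_all add: sum_negf sum_distrib_left)
    show "(\<Sum>j\<in>{1..n}. - (V s (p s k) - driving_velocity {1..n} {1..m} (u s) (x s) (p s) j) / (p s k - x s j)\<^sup>2)
      - (\<Sum>l\<in>{1..m} - {k}. 2 * (- (V s (p s k) - V s (p s l)) / (p s k - p s l)\<^sup>2)) = a s * B s"
      unfolding a_def B_def e1 e2 e3 diff_minus_eq_add by (rule id)
  qed simp
  moreover have "a absolutely_integrable_on {0..t}"
  proof -
    have "(\<lambda>s. \<Sum>j\<in>{1..n}. 2 * u s j * (1 / (p s k - x s j)\<^sup>2)) absolutely_integrable_on {0..t}"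
      by (intro u_mult_integrable continuous_intros p_continuous[OF k] x_continuous ballI)
        (use tT nx in auto)
    then show ?thesis by (simp add: a_def)
  qed
  ultimately have "B s = B 0 * exp (integral {0..s} a)"
    by (rule solves_upto_linear_ode) (rule s)
  moreover have "B 0 = 0"
    using st k unfolding stationary_relations_def B_def by (simp add: p_0 X_0)
  ultimately have "B s = 0" by simp
  then show "- (\<Sum>j\<in>{1..n}. 1 / (p s k - complex_of_real (X j s))) + (\<Sum>l\<in>{1..m} - {k}. 2 / (p s k - p s l)) = 0"
    by (simp add: B_def)
qed

end

section \<open>The flow maps\<close>

context loewner_flow begin

text \<open>In Loewner theory this is the half-plane capacity of the hull at time \<open>t\<close>;
  here it sets the exponents of the Lipschitz constants.\<close>

definition mass :: real where "mass = integral {0..t} (\<lambda>s. \<Sum>j\<in>{1..n}. 2 * \<nu> j s)"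

lemma total_nu_integrable: "s \<in> {0..t} \<Longrightarrow> (\<lambda>s. \<Sum>j\<in>{1..n}. 2 * \<nu> j s) integrable_on {0..s}"
proof -
  assume s: "s \<in> {0..t}"
  have "\<nu> j integrable_on {0..s}" if "j \<in> {1..n}" for j
  proof (rule integrable_on_subinterval)
    show "\<nu> j integrable_on {0..t}" using nu_integrable[OF that] by (simp add: absolutely_integrable_on_def)
  qed (use s in auto)
  then show ?thesis
    by (intro Henstock_Kurzweil_Integration.integrable_sum integrable_on_mult_right) auto
qed

lemma weighted_integral_le_mass:
  assumes s: "s \<in> {0..t}" and c: "\<And>j. j \<in> {1..n} \<Longrightarrow> continuous_on {0..s} (c j)"
    and B: "0 \<le> B" "\<And>j r. j \<in> {1..n} \<Longrightarrow> r \<in> {0..s} \<Longrightarrow> norm (c j r) \<le> B"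
  shows "norm (integral {0..s} (\<lambda>r. \<Sum>j\<in>{1..n}. 2 * u r j * c j r)) \<le> B * mass"
proof -
  have "norm (integral {0..s} (\<lambda>r. \<Sum>j\<in>{1..n}. 2 * u r j * c j r)) 
      \<le> integral {0..s} (\<lambda>r. B * (\<Sum>j\<in>{1..n}. 2 * \<nu> j r))"
  proof (rule Henstock_Kurzweil_Integration.integral_norm_bound_integral)
    show "(\<lambda>r. \<Sum>j\<in>{1..n}. 2 * u r j * c j r) integrable_on {0..s}"
      using u_mult_integrable[OF s c] by (simp add: absolutely_integrable_on_def)
    show "(\<lambda>r. B * (\<Sum>j\<in>{1..n}. 2 * \<nu> j r)) integrable_on {0..s}"
      by (intro integrable_on_mult_right total_nu_integrable s)
    fix r assume r: "r \<in> {0..s}"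
    have "norm (\<Sum>j\<in>{1..n}. 2 * u r j * c j r) \<le> (\<Sum>j\<in>{1..n}. B * (2 * \<nu> j r))"
    proof (rule sum_norm_le)
      fix j assume j: "j \<in> {1..n}"
      have "\<nu> j r \<ge> 0" using nu_nonneg j r by auto
      then show "norm (2 * u r j * c j r) \<le> B * (2 * \<nu> j r)"
        using mult_left_mono[OF B(2)[OF j r], of "2 * \<nu> j r"] by (simp add: norm_mult mult.commute)
    qed
    then show "norm (\<Sum>j\<in>{1..n}. 2 * u r j * c j r) \<le> B * (\<Sum>j\<in>{1..n}. 2 * \<nu> j r)"
      by (simp add: sum_distrib_left)
  qed
  also have "\<dots> = B * integral {0..s} (\<lambda>r. \<Sum>j\<in>{1..n}. 2 * \<nu> j r)" by simp
  also have "integral {0..s} (\<lambda>r. \<Sum>j\<in>{1..n}. 2 * \<nu> j r) \<le> mass"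
  proof -
    have "0 \<le> (\<Sum>j\<in>{1..n}. 2 * \<nu> j r)" if "r \<in> {0..t}" for r
      using nu_nonneg that by (intro sum_nonneg) auto
    then show ?thesis
      unfolding mass_def using s tT total_nu_integrable by (intro integral_subset_le) auto
  qed
  finally show ?thesis using B(1) by (simp add: mult_left_mono)
qed

text \<open>Minus the difference quotient of the flow field between \<open>g r z\<close> and
  \<open>g r z'\<close>, and on the diagonal minus the derivative of the field. Hence
  \<open>exp (- integral {0..t} (kernel z z))\<close> is the derivative of \<open>g t\<close> at
  \<open>z\<close>.\<close>

definition kernel :: "complex \<Rightarrow> complex \<Rightarrow> real \<Rightarrow> complex" where
  "kernel z z' r = (\<Sum>j\<in>{1..n}. 2 * u r j * (1 / ((g r z - x r j) * (g r z' - x r j))))"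

lemma live_diff_nonzero: "live z s \<Longrightarrow> r \<in> {0..s} \<Longrightarrow> j \<in> {1..n} \<Longrightarrow> g r z - x r j \<noteq> 0"
  using live_not_hit[OF live_mono] by simp

lemma live_range: "live z s \<Longrightarrow> s \<in> {0..t}" by (simp add: live_def)

lemma continuous_on_live_factor:
  assumes "live z s" "live z' s" "j \<in> {1..n}"
  shows "continuous_on {0..s} (\<lambda>r. 1 / ((g r z - x r j) * (g r z' - x r j)))"
proof -
  have "continuous_on {0..s} (\<lambda>r. x r j)"
    using x_continuous[OF assms(3)] live_range[OF assms(1)] by (rule_tac continuous_on_subset) auto
  then show ?thesis
    using live_diff_nonzero assms by (intro continuous_intros live_continuous) auto
qed

lemma kernel_integrable:
  assumes "live z s" "live z' s" shows "kernel z z' absolutely_integrable_on {0..s}"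
  unfolding kernel_def
  by (intro u_mult_integrable continuous_on_live_factor assms live_range[OF assms(1)])

lemma flow_difference:
  assumes "live z s" "live z' s"
  shows "g s z - g s z' = (z - z') * exp (- integral {0..s} (kernel z z'))"
proof -
  have "solves_upto s (\<lambda>r. g r z - g r z') (\<lambda>r. - kernel z z' r * (g r z - g r z'))"
  proof (rule solves_upto_cong[OF solves_upto_diff[OF live_solves[OF assms(1)] live_solves[OF assms(2)]]])
    fix r assume r: "r \<in> {0..s}"
    show "V r (g r z) - V r (g r z') = - kernel z z' r * (g r z - g r z')"
      unfolding flow_field_def kernel_def sum_negf[symmetric] sum_subtractf[symmetric] sum_distrib_right
    proof (rule sum.cong[OF refl])
      fix j assume "j \<in> {1..n}"
      then have "g r z - x r j \<noteq> 0" "g r z' - x r j \<noteq> 0" using live_diff_nonzero assms r by blast+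
      moreover have "2 * c / d - 2 * c / d' = - (2 * c * (1 / (d * d'))) * (d - d')"
        if "d \<noteq> 0" "d' \<noteq> 0" for c d d' :: complex using that by (simp add: field_simps)
      ultimately have "2 * u r j / (g r z - x r j) - 2 * u r j / (g r z' - x r j)
          = - (2 * u r j * (1 / ((g r z - x r j) * (g r z' - x r j)))) * ((g r z - x r j) - (g r z' - x r j))"
        by blast
      then show "2 * u r j / (g r z - x r j) - 2 * u r j / (g r z' - x r j)
          = - (2 * u r j * (1 / ((g r z - x r j) * (g r z' - x r j)))) * (g r z - g r z')"
        by simp
    qed
  qed simp
  moreover have "(\<lambda>r. - kernel z z' r) absolutely_integrable_on {0..s}"
    using absolutely_integrable_linear[OF kernel_integrable[OF assms] bounded_linear_minus[OF bounded_linear_ident]]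
    by (simp add: o_def)
  ultimately have "g s z - g s z' = (g 0 z - g 0 z') * exp (integral {0..s} (\<lambda>r. - kernel z z' r))"
    by (rule solves_upto_linear_ode) (use live_range[OF assms(1)] in auto)
  then show ?thesis using g_0 assms by (simp add: live_def)
qed

lemma kernel_integral_le:
  assumes "live z s" "live z' s" "0 < c" "0 < c'"
    and "\<And>r j. r \<in> {0..s} \<Longrightarrow> j \<in> {1..n} \<Longrightarrow> c \<le> norm (g r z - x r j)"
    and "\<And>r j. r \<in> {0..s} \<Longrightarrow> j \<in> {1..n} \<Longrightarrow> c' \<le> norm (g r z' - x r j)"
  shows "norm (integral {0..s} (kernel z z')) \<le> 1 / (c * c') * mass"
  unfolding kernel_def
proof (rule weighted_integral_le_mass[OF live_range[OF assms(1)]])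
  show "norm (1 / ((g r z - x r j) * (g r z' - x r j))) \<le> 1 / (c * c')" if "j \<in> {1..n}" "r \<in> {0..s}" for j r
    using assms(3,4) assms(5,6)[OF that(2,1)] by (auto simp: norm_divide norm_mult intro!: divide_left_mono mult_mono mult_pos_pos)
qed (use assms continuous_on_live_factor in auto)

text \<open>The exponent has modulus at most \<open>mass / (c * c')\<close> when \<open>c\<close>
  and \<open>c'\<close> are lower bounds for the distances to the driving points. The second
  inequality makes the inverse map Lipschitz as well.\<close>

lemma flow_difference_bounds:
  assumes "live z s" "live z' s" "0 < c" "0 < c'"
    and "\<And>r j. r \<in> {0..s} \<Longrightarrow> j \<in> {1..n} \<Longrightarrow> c \<le> norm (g r z - x r j)"
    and "\<And>r j. r \<in> {0..s} \<Longrightarrow> j \<in> {1..n} \<Longrightarrow> c' \<le> norm (g r z' - x r j)"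
  shows "norm (g s z - g s z') \<le> norm (z - z') * exp (1 / (c * c') * mass)"
    and "norm (z - z') \<le> norm (g s z - g s z') * exp (1 / (c * c') * mass)"
proof -
  let ?I = "integral {0..s} (kernel z z')"
  have le: "\<bar>Re ?I\<bar> \<le> 1 / (c * c') * mass"
    using kernel_integral_le[OF assms] abs_Re_le_cmod order_trans by blast
  have eq: "norm (g s z - g s z') = norm (z - z') * exp (- Re ?I)"
    unfolding flow_difference[OF assms(1,2)] by (simp add: norm_mult)
  show "norm (g s z - g s z') \<le> norm (z - z') * exp (1 / (c * c') * mass)"
    unfolding eq using le by (intro mult_left_mono) auto
  have "norm (z - z') = norm (g s z - g s z') * exp (Re ?I)"
    unfolding eq by (simp add: exp_minus)
  also have "\<dots> \<le> norm (g s z - g s z') * exp (1 / (c * c') * mass)"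
    using le by (intro mult_left_mono) auto
  finally show "norm (z - z') \<le> norm (g s z - g s z') * exp (1 / (c * c') * mass)" .
qed

lemma flow_inj: "live z s \<Longrightarrow> live z' s \<Longrightarrow> g s z = g s z' \<Longrightarrow> z = z'"
  using flow_difference[of z s z'] by simp

text \<open>With integrable weights available, the height is the exact exponential
  \<open>Im z * exp (- integral {0..r} k)\<close> with \<open>k\<close> nonnegative.\<close>

lemma Im_flow:
  assumes z: "live z s" "0 < Im z"
  shows "0 < Im (g s z)" "r \<in> {0..s} \<Longrightarrow> Im (g s z) \<le> Im (g r z)"
proof -
  define k where "k = (\<lambda>r. \<Sum>j\<in>{1..n}. 2 * \<nu> j r / (norm (g r z - x r j))\<^sup>2)"
  have s: "s \<in> {0..t}" by (rule live_range[OF z(1)])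
  have xc: "continuous_on {0..s} (\<lambda>r. x r j)" if "j \<in> {1..n}" for j
    using x_continuous[OF that] s by (rule_tac continuous_on_subset) auto
  have "(\<lambda>r. \<Sum>j\<in>{1..n}. 2 * u r j * complex_of_real (1 / (norm (g r z - x r j))\<^sup>2)) absolutely_integrable_on {0..s}"
    using live_diff_nonzero[OF z(1)]
    by (intro u_mult_integrable s continuous_intros live_continuous[OF z(1)] xc) auto
  then have kc: "(\<lambda>r. complex_of_real (k r)) absolutely_integrable_on {0..s}" by (simp add: k_def)
  have k0: "k r \<ge> 0" if "r \<in> {0..s}" for r unfolding k_def using that nu_nonneg by (intro sum_nonneg) auto
  have ki: "k integrable_on {0..s}"
    using absolutely_integrable_linear[OF kc bounded_linear_Re] by (simp add: o_def absolutely_integrable_on_def)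
  have ki': "k integrable_on {0..r}" if "r \<in> {0..s}" for r
    by (rule integrable_on_subinterval[OF ki]) (use that in auto)
  have eq: "Im (g r z) = Im z * exp (- integral {0..r} k)" if r: "r \<in> {0..s}" for r
  proof -
    have "solves_upto s (\<lambda>r. complex_of_real (Im (g r z))) (\<lambda>r. - complex_of_real (k r) * complex_of_real (Im (g r z)))"
      by (rule solves_upto_cong[OF solves_upto_linear_image[OF live_solves[OF z(1)] complex_of_real_Im_bounded_linear]])
         (simp_all add: Im_flow_field k_def)
    moreover have "(\<lambda>r. - complex_of_real (k r)) absolutely_integrable_on {0..s}"
      using absolutely_integrable_linear[OF kc bounded_linear_minus[OF bounded_linear_ident]] by (simp add: o_def)
    ultimately have "complex_of_real (Im (g r z)) = complex_of_real (Im (g 0 z)) * exp (integral {0..r} (\<lambda>r. - complex_of_real (k r)))"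
      by (rule solves_upto_linear_ode) (rule r)
    also have "integral {0..r} (\<lambda>r. - complex_of_real (k r)) = complex_of_real (- integral {0..r} k)"
      using integral_linear[OF ki'[OF r] bounded_linear_of_real[where 'a = complex]] by (simp add: o_def)
    finally have "complex_of_real (Im (g r z)) = complex_of_real (Im (g 0 z) * exp (- integral {0..r} k))"
      by (simp flip: exp_of_real)
    then show ?thesis using g_0 z by (simp only: of_real_eq_iff live_def)
  qed
  have s': "s \<in> {0..s}" using s by auto
  show "0 < Im (g s z)" using eq[OF s'] z(2) by simp
  assume r: "r \<in> {0..s}"
  have "integral {0..r} k \<le> integral {0..s} k"
    using r k0 ki ki' by (intro integral_subset_le) auto
  then show "Im (g s z) \<le> Im (g r z)" unfolding eq[OF r] eq[OF s'] using z(2) by simp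
qed

lemma Im_le_dist_driving: "Im w \<le> norm (w - x s j)"
  using abs_Im_le_cmod[of "w - x s j"] by simp

text \<open>A point that starts close to an unswallowed point cannot be swallowed: by the intermediate value
  theorem its imaginary part would first have to pass half the height at which the Lipschitz bound
  still applies.\<close>

lemma live_stable:
  assumes z: "live z t" "0 < Im z" "c \<le> Im (g t z)" and c: "0 < c"
    and close: "norm (z - z') * exp (1 / (c * (c / 2)) * mass) < c / 4"
  shows "live z' t" "c / 2 \<le> Im (g t z')" "0 < Im z'"
    "norm (g t z - g t z') \<le> norm (z - z') * exp (1 / (c * (c / 2)) * mass)"
proof -
  let ?E = "exp (1 / (c * (c / 2)) * mass)"
  have t: "t \<in> {0..t}" using live_range[OF z(1)] .
  have mass0: "0 \<le> mass" unfolding mass_def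
    using nu_nonneg total_nu_integrable[OF t] by (intro Henstock_Kurzweil_Integration.integral_nonneg sum_nonneg) auto
  have "norm (z - z') * 1 \<le> norm (z - z') * ?E" using mass0 c by (intro mult_left_mono) auto
  then have "norm (z - z') < c / 4" using close by simp
  then have "\<bar>Im z - Im z'\<bar> < c / 4" using abs_Im_le_cmod[of "z - z'"] by simp
  moreover have "c \<le> Im (g r z)" if "r \<in> {0..t}" for r using Im_flow(2)[OF z(1,2) that] z(3) by simp
  note zc = this
  then have "c \<le> Im z" using g_0 z t by (metis atLeastAtMost_iff live_def order_refl)
  ultimately have z': "c / 2 < Im z'" using c by linarith
  then show "0 < Im z'" using c by simp
  \<comment> \<open>A conditional estimate: heights do not increase, so if \<open>z'\<close> is at
    height \<open>c / 2\<close> or more at time \<open>s\<close>, it was so at all earlier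
    times.\<close>
  have bound: "norm (g s z - g s z') \<le> norm (z - z') * ?E" if s: "live z' s" "c / 2 \<le> Im (g s z')" for s
  proof (rule flow_difference_bounds(1)[OF live_mono[OF z(1)] s(1)])
    show "s \<in> {0..t}" using live_range[OF s(1)] .
    show "c \<le> norm (g r z - x r j)" if "r \<in> {0..s}" for r j
      using zc[of r] Im_le_dist_driving[of "g r z" j r] that live_range[OF s(1)] by auto
    show "c / 2 \<le> norm (g r z' - x r j)" if "r \<in> {0..s}" for r j
      using Im_flow(2)[OF s(1) _ that] s(2) z' c Im_le_dist_driving[of "g r z'" j r] by auto
  qed (use c in auto)
  have main: "live z' t \<and> c / 2 \<le> Im (g t z')"
  proof (rule ccontr)
    assume contra: "\<not> (live z' t \<and> c / 2 \<le> Im (g t z'))"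
    \<comment> \<open>Either \<open>b = t\<close>, or \<open>b\<close> is the swallowing time of
      \<open>z'\<close>, where the height is \<open>0\<close>.\<close>
    have "\<exists>b\<in>{0..t}. continuous_on {0..b} (\<lambda>r. g r z') \<and> Im (g b z') < c / 2 \<and> (\<forall>r\<in>{0..<b}. live z' r)"
    proof (cases "live z' t")
      case True
      then have "Im (g t z') < c / 2" using contra by auto
      then show ?thesis using True t live_continuous[OF True] live_mono[OF True] by (intro bexI[of _ t]) auto
    next
      case False
      have "0 \<le> Im z'" using z' c by simp
      from not_live[OF this t False] obtain \<tau> where \<tau>: "\<tau> \<in> {0..t}" "hits n X g z' \<tau>"
        "continuous_on {0..\<tau>} (\<lambda>r. g r z')" "\<And>r. r \<in> {0..<\<tau>} \<Longrightarrow> live z' r" by metis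
      then have "Im (g \<tau> z') = 0" by (auto simp: hits_def)
      then show ?thesis using \<tau> c by (intro bexI[of _ \<tau>]) auto
    qed
    then obtain b where b: "b \<in> {0..t}" "continuous_on {0..b} (\<lambda>r. g r z')" "Im (g b z') < c / 2"
      "\<And>r. r \<in> {0..<b} \<Longrightarrow> live z' r" by blast
    have "Im (g 0 z') = Im z'" using g_0 z' c by simp
    \<comment> \<open>At height exactly \<open>c / 2\<close> the estimate still applies, and puts
      \<open>g s z'\<close> within \<open>c / 4\<close> of a point of height at least
      \<open>c\<close>.\<close>
    then obtain s where s: "0 \<le> s" "s \<le> b" "Im (g s z') = c / 2"
      using IVT2'[of "\<lambda>r. Im (g r z')" b "c / 2" 0] b z' continuous_on_Im[OF b(2)] by auto
    then have "s \<noteq> b" using b(3) by auto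
    then have ls: "live z' s" using b(4) s by auto
    have "norm (g s z - g s z') < c / 4" using bound[OF ls] s(3) close by simp
    then have "\<bar>Im (g s z) - Im (g s z')\<bar> < c / 4" using abs_Im_le_cmod[of "g s z - g s z'"] by simp
    moreover have "c \<le> Im (g s z)" using zc s b by auto
    ultimately show False using s(3) c by simp
  qed
  then show "live z' t" "c / 2 \<le> Im (g t z')" by auto
  then show "norm (g t z - g t z') \<le> norm (z - z') * ?E" by (rule bound)
qed

text \<open>To the right of all driving points the field has nonnegative real part, so points there
  only move further right.\<close>

lemma Re_flow_far:
  assumes M: "\<And>j s. j \<in> {1..n} \<Longrightarrow> s \<in> {0..t} \<Longrightarrow> X j s \<le> M"
    and z: "0 \<le> Im z" "M + 1 < Re z"
  shows "live z t" "s \<in> {0..t} \<Longrightarrow> Re z \<le> Re (g s z)"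
proof -
  have inc: "Re z \<le> Re (g r z)" if lr: "live z r" and far: "\<And>s. s \<in> {0..r} \<Longrightarrow> M \<le> Re (g s z)" for r
  proof -
    have r: "r \<in> {0..r}" using live_range[OF lr] by auto
    have "Re (-1 * g r z) \<le> Re (-1 * g 0 z)"
    proof (rule solves_upto_Re_le[OF solves_upto_cmult[OF live_solves[OF lr]] r])
      fix s assume s: "s \<in> {0..r}"
      have "0 \<le> Re (V s (g s z))" unfolding flow_field_def Re_sum
      proof (rule sum_nonneg)
        fix j assume j: "j \<in> {1..n}"
        have "X j s \<le> Re (g s z)" using far[OF s] M[OF j, of s] s live_range[OF lr] by auto
        moreover have "0 \<le> \<nu> j s" using nu_nonneg j s by auto
        ultimately show "0 \<le> Re (2 * u s j / (g s z - x s j))" by (simp add: Re_divide)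
      qed
      then show "Re (-1 * V s (g s z)) \<le> 0" by simp
    qed
    then show ?thesis using g_0 z by simp
  qed
  have claim: "Re z \<le> Re (g b z)" 
    if b: "b \<in> {0..t}" "continuous_on {0..b} (\<lambda>r. g r z)" "\<And>r. r \<in> {0..<b} \<Longrightarrow> live z r" for b
  proof -
    \<comment> \<open>Times at which the point has come too far left. The threshold lies between
      \<open>M\<close>, above which the real part cannot decrease, and the start beyond
      \<open>M + 1\<close>; a first such time would contradict the monotonicity before it.\<close>
    define S where "S = {r \<in> {0..b}. Re (g r z) \<le> M + 1 / 2}"
    have lim: "Re z \<le> Re (g e z)" if e: "e \<in> {0..b}" and ee: "\<And>r. r \<in> {0..<e} \<Longrightarrow> Re z \<le> Re (g r z)" for e
    proof (cases "e = 0")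
      case True
      then show ?thesis using g_0 z by simp
    next
      case False
      then have cl: "closure {0..<e} = {0..e}" using e by simp
      show ?thesis
        by (rule continuous_ge_on_closure[where S = "{0..<e}" and f = "\<lambda>r. Re (g r z)"])
           (use cl e ee in \<open>auto intro!: continuous_on_Re continuous_on_subset[OF b(2)]\<close>)
    qed
    have "S = {}"
    proof (rule ccontr)
      assume "S \<noteq> {}"
      moreover have "S = {0..b} \<inter> (\<lambda>r. Re (g r z)) -` {..M + 1 / 2}" by (auto simp: S_def)
      then have "compact S"
        using continuous_closed_preimage[OF continuous_on_Re[OF b(2)]] compact_Int_closed[of "{0..b}"]
        by (metis closed_atLeastAtMost closed_atMost bounded_closed_interval bounded_subset compact_eq_bounded_closed inf_le1)
      ultimately obtain s1 where s1: "s1 \<in> S" "\<And>r. r \<in> S \<Longrightarrow> s1 \<le> r"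
        using compact_attains_inf[of S] by blast
      have "Re z \<le> Re (g s1 z)"
      proof (rule lim)
        show "s1 \<in> {0..b}" using s1 by (auto simp: S_def)
        fix r assume r: "r \<in> {0..<s1}"
        have rb: "r \<in> {0..<b}" using r \<open>s1 \<in> {0..b}\<close> by auto
        have "M \<le> Re (g s z)" if "s \<in> {0..r}" for s
        proof (rule ccontr)
          assume "\<not> ?thesis"
          then have "s \<in> S" using that rb by (auto simp: S_def)
          then show False using s1(2) that r by force
        qed
        then show "Re z \<le> Re (g r z)" by (rule inc[OF b(3)[OF rb]])
      qed
      then show False using s1(1) z(2) by (auto simp: S_def)
    qed
    show ?thesis
    proof (rule lim)
      fix r assume r: "r \<in> {0..<b}"
      have "M \<le> Re (g s z)" if "s \<in> {0..r}" for s
      proof (rule ccontr)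
        assume "\<not> ?thesis"
        then have "s \<in> S" using that r by (auto simp: S_def)
        then show False using \<open>S = {}\<close> by simp
      qed
      then show "Re z \<le> Re (g r z)" by (rule inc[OF b(3)[OF r]])
    qed (use b in auto)
  qed
  have t: "t \<in> {0..t}" using tT by simp
  show live: "live z t"
  proof (rule ccontr)
    assume "\<not> live z t"
    from not_live[OF z(1) t this] obtain \<tau> where \<tau>: "\<tau> \<in> {0..t}" "hits n X g z \<tau>"
      "continuous_on {0..\<tau>} (\<lambda>r. g r z)" "\<And>r. r \<in> {0..<\<tau>} \<Longrightarrow> live z r" by metis
    have "Re z \<le> Re (g \<tau> z)" by (rule claim[OF \<tau>(1,3,4)])
    moreover obtain j where "j \<in> {1..n}" "g \<tau> z = x \<tau> j" using \<tau>(2) by (auto simp: hits_def)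
    ultimately show False using M[of j \<tau>] \<tau>(1) z(2) by simp
  qed
  show "Re z \<le> Re (g s z)" if "s \<in> {0..t}"
    using that by (intro claim continuous_on_subset[OF live_continuous[OF live]] live_mono[OF live]) auto
qed

section \<open>Domain and range of the flow map\<close>

lemma configuration_bounded:
  obtains M where "\<And>j s. j \<in> {1..n} \<Longrightarrow> s \<in> {0..t} \<Longrightarrow> X j s \<le> M"
    "\<And>l s. l \<in> {1..m} \<Longrightarrow> s \<in> {0..t} \<Longrightarrow> Re (p s l) \<le> M"
proof -
  have "bounded (\<Union>j\<in>{1..n}. (\<lambda>s. x s j) ` {0..t})" 
    by (intro bounded_UN ballI finite_atLeastAtMost compact_imp_bounded compact_continuous_image x_continuous compact_Icc)
  then obtain A where A: "\<And>j s. j \<in> {1..n} \<Longrightarrow> s \<in> {0..t} \<Longrightarrow> norm (x s j) \<le> A" unfolding bounded_iff by fastforce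
  have "bounded (\<Union>l\<in>{1..m}. (\<lambda>s. p s l) ` {0..t})" 
    by (intro bounded_UN ballI finite_atLeastAtMost compact_imp_bounded compact_continuous_image p_continuous compact_Icc)
  then obtain B where B: "\<And>l s. l \<in> {1..m} \<Longrightarrow> s \<in> {0..t} \<Longrightarrow> norm (p s l) \<le> B" unfolding bounded_iff by fastforce
  show ?thesis
  proof (rule that[of "max A B"])
    show "X j s \<le> max A B" if "j \<in> {1..n}" "s \<in> {0..t}" for j s
      using A[OF that] by simp
    show "Re (p s l) \<le> max A B" if "l \<in> {1..m}" "s \<in> {0..t}" for l s
      using B[OF that] complex_Re_le_cmod[of "p s l"] by simp
  qed
qed

definition U :: "complex set" where "U = {z. 0 < Im z \<and> live z t}"

lemma U_eq: "upper_half_plane - loewner_hull n X g t = U"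
  using tT by (auto simp: U_def upper_half_plane_def loewner_hull_def live_def)

lemma U_nonempty: "U \<noteq> {}"
proof -
  obtain M where M: "\<And>j s. j \<in> {1..n} \<Longrightarrow> s \<in> {0..t} \<Longrightarrow> X j s \<le> M" using configuration_bounded by metis
  have "Complex (M + 2) 1 \<in> U" unfolding U_def using Re_flow_far(1)[OF M, of "Complex (M + 2) 1"] by simp
  then show ?thesis by blast
qed

lemma U_neighbourhood:
  assumes "z \<in> U"
  obtains e C where "e > 0" "ball z e \<subseteq> U" "\<And>z'. z' \<in> ball z e \<Longrightarrow> norm (g t z - g t z') \<le> norm (z - z') * C"
proof -
  have z: "live z t" "0 < Im z" using assms by (auto simp: U_def)
  define c where "c = Im (g t z)"
  have c: "c > 0" unfolding c_def using Im_flow(1)[OF z] .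
  define C where "C = exp (1 / (c * (c / 2)) * mass)"
  have C: "C > 0" by (simp add: C_def)
  have close: "norm (z - z') * C < c / 4" if "z' \<in> ball z (c / 4 / C)" for z'
    using that C by (simp add: dist_norm field_simps)
  show ?thesis
  proof (rule that)
    show "c / 4 / C > 0" using c C by simp
    show "ball z (c / 4 / C) \<subseteq> U"
      using live_stable[OF z _ c close[unfolded C_def]] unfolding U_def c_def C_def by auto
    show "norm (g t z - g t z') \<le> norm (z - z') * C" if "z' \<in> ball z (c / 4 / C)" for z'
      using live_stable(4)[OF z _ c close[OF that, unfolded C_def]] unfolding c_def C_def by auto
  qed
qed

lemma open_U: "open U"
  unfolding open_contains_ball using U_neighbourhood by metis

lemma continuous_on_flow_U: "continuous_on U (g t)"
  unfolding continuous_on_eq_continuous_at[OF open_U]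
proof
  fix z assume "z \<in> U"
  then obtain e C where e: "e > 0" "ball z e \<subseteq> U"
      "\<And>z'. z' \<in> ball z e \<Longrightarrow> norm (g t z - g t z') \<le> norm (z - z') * C"
    using U_neighbourhood by metis
  have "((\<lambda>z'. norm (z - z') * C) \<longlongrightarrow> norm (z - z) * C) (at z)" by (intro tendsto_intros)
  then have "((\<lambda>z'. norm (z - z') * C) \<longlongrightarrow> 0) (at z)" by simp
  moreover have "\<forall>\<^sub>F z' in at z. norm (g t z' - g t z) \<le> norm (z - z') * C"
    using e unfolding eventually_at by (intro exI[of _ e]) (auto simp: dist_commute norm_minus_commute)
  ultimately have "((\<lambda>z'. g t z' - g t z) \<longlongrightarrow> 0) (at z)" by (rule Lim_null_comparison[rotated])
  then show "isCont (g t) z" unfolding isCont_def by (subst (asm) LIM_zero_iff)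
qed

lemma inj_on_U: "inj_on (g t) U"
  using flow_inj by (auto simp: inj_on_def U_def)

text \<open>The image is open by invariance of domain, nonempty, and relatively closed in the
  connected half-plane. For closedness, the preimages of a sequence tending to \<open>w\<close>
  eventually keep height at least \<open>c\<close> up to time \<open>t\<close>, so the inverse
  Lipschitz bound makes them Cauchy; their limit is unswallowed by its closeness to a late
  term.\<close>

lemma flow_image_U: "g t ` U = upper_half_plane"
proof -
  have sub: "g t ` U \<subseteq> upper_half_plane" using Im_flow(1) by (auto simp: U_def upper_half_plane_def)
  have conn: "connected upper_half_plane"
    unfolding upper_half_plane_def by (intro convex_connected convex_halfspace_Im_gt)
  have "openin (top_of_set upper_half_plane) (g t ` U)"
    by (intro open_openin_trans[OF _ invariance_of_domain[OF continuous_on_flow_U open_U inj_on_U] sub])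
       (simp add: upper_half_plane_def open_halfspace_Im_gt)
  moreover have "closedin (top_of_set upper_half_plane) (g t ` U)"
  proof -
    have "w \<in> g t ` U" if w: "w \<in> upper_half_plane" "w \<in> closure (g t ` U)" for w
    proof -
      define c where "c = Im w / 2"
      have c: "0 < c" "c < Im w" using w by (auto simp: c_def upper_half_plane_def)
      define C where "C = exp (1 / (c * (c / 2)) * mass)"
      have C: "C > 0" by (simp add: C_def)
      obtain W where W: "\<And>i. W i \<in> g t ` U" "W \<longlonglongrightarrow> w" using w(2) unfolding closure_sequential by blast
      define Z where "Z = (\<lambda>i. inv_into U (g t) (W i))"
      have Z: "\<And>i. Z i \<in> U" "\<And>i. W i = g t (Z i)"
        unfolding Z_def using W(1) by (simp_all add: inv_into_into f_inv_into_f)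
      have ev: "\<forall>\<^sub>F i in sequentially. c \<le> Im (W i)"
        using order_tendstoD(1)[OF tendsto_Im[OF W(2)] c(2)] by eventually_elim simp
      then obtain N where N: "\<And>i. i \<ge> N \<Longrightarrow> c \<le> Im (W i)" by (auto simp: eventually_sequentially)
      have Zl: "live (Z i) t" "0 < Im (Z i)" for i using Z by (auto simp: U_def)
      have far: "c \<le> norm (g r (Z i) - x r j)" if "i \<ge> N" "r \<in> {0..t}" for i r j
        using N[OF that(1)] Im_flow(2)[OF Zl[of i] that(2)] Z(2)[of i] Im_le_dist_driving[of "g r (Z i)" j r] by simp
      have lip: "norm (Z i - Z k) \<le> norm (W i - W k) * exp (1 / (c * c) * mass)" if "i \<ge> N" "k \<ge> N" for i k
        unfolding Z(2) using c far that by (intro flow_difference_bounds(2) Zl) auto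
      have "Cauchy W" using W(2) LIMSEQ_imp_Cauchy by blast
      have "Cauchy Z"
      proof (rule CauchyI)
        fix e :: real assume "e > 0"
        then have "e / exp (1 / (c * c) * mass) > 0" by simp
        from CauchyD[OF \<open>Cauchy W\<close> this] obtain N' where N': "\<And>i k. i \<ge> N' \<Longrightarrow> k \<ge> N' \<Longrightarrow>
          norm (W i - W k) < e / exp (1 / (c * c) * mass)" by blast
        have "norm (Z i - Z k) < e" if "i \<ge> max N N'" "k \<ge> max N N'" for i k
          using lip[of i k] N'[of i k] that by (simp add: field_simps)
        then show "\<exists>M. \<forall>m\<ge>M. \<forall>n\<ge>M. norm (Z m - Z n) < e" by blast
      qed
      then obtain z where z: "Z \<longlonglongrightarrow> z" using Cauchy_convergent_iff convergent_def by blast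
      have "((\<lambda>i. norm (Z i - z) * C) \<longlonglongrightarrow> norm (z - z) * C)" by (intro tendsto_intros z)
      then have "\<forall>\<^sub>F i in sequentially. norm (Z i - z) * C < c / 4"
        using c by (intro order_tendstoD(2)[where y = "0"]) auto
      then have "\<forall>\<^sub>F i in sequentially. norm (Z i - z) * C < c / 4 \<and> c \<le> Im (W i)" using ev by (rule eventually_conj)
      then obtain i where i: "norm (Z i - z) * C < c / 4" "c \<le> Im (W i)"
        using eventually_happens'[OF sequentially_bot] by blast
      have "z \<in> U" unfolding U_def
        using live_stable[OF Zl _ c(1), of i z] i Z(2)[of i] by (simp add: C_def)
      then have "isCont (g t) z"
        using continuous_on_flow_U open_U continuous_on_eq_continuous_at by blast
      then have "(\<lambda>i. g t (Z i)) \<longlonglongrightarrow> g t z" using z by (rule isCont_tendsto_compose)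
      then have "w = g t z" using W(2) Z(2) LIMSEQ_unique by (metis (no_types, lifting) ext)
      then show ?thesis using \<open>z \<in> U\<close> by blast
    qed
    then have "upper_half_plane \<inter> closure (g t ` U) \<subseteq> g t ` U" by (intro subsetI) (metis IntD1 IntD2)
    then have "g t ` U = upper_half_plane \<inter> closure (g t ` U)"
      by (intro equalityI Int_greatest sub closure_subset)
    then show ?thesis using closedin_closed_Int[OF closed_closure] by metis
  qed
  ultimately show ?thesis using conn U_nonempty unfolding connected_clopen by blast
qed

lemma bij_betw_flow: "bij_betw (g t) U upper_half_plane"
  using inj_on_U flow_image_U by (simp add: bij_betw_def)

end

section \<open>The derivative of the inverse flow and the integral of motion\<close>

lemma solves_upto_nonzero:
  assumes y: "solves_upto T y f" and nz: "\<And>s. s \<in> {0..T} \<Longrightarrow> y s \<noteq> 0"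
  shows "(\<lambda>s. f s / y s) absolutely_integrable_on {0..T}"
    and "t \<in> {0..T} \<Longrightarrow> y t = y 0 * exp (integral {0..t} (\<lambda>s. f s / y s))"
proof -
  have "continuous_on {0..T} (\<lambda>s. 1 / y s)"
    using nz by (intro continuous_intros solves_upto_continuous[OF y]) auto
  from absolutely_integrable_continuous_mult[OF this solves_uptoD(1)[OF y]]
  show i: "(\<lambda>s. f s / y s) absolutely_integrable_on {0..T}" by simp
  have "solves_upto T y (\<lambda>s. f s / y s * y s)"
    by (rule solves_upto_cong[OF y]) (use nz in auto)
  then show "t \<in> {0..T} \<Longrightarrow> y t = y 0 * exp (integral {0..t} (\<lambda>s. f s / y s))"
    using i by (rule solves_upto_linear_ode)
qed

lemma not_in_image_if_diff_nonzero:
  fixes w :: "'a::group_add"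
  shows "(\<And>j. j \<in> J \<Longrightarrow> w - f j \<noteq> 0) \<Longrightarrow> w \<notin> f ` J"
  by auto

context loewner_flow begin

abbreviation inv_flow :: "complex \<Rightarrow> complex" where "inv_flow \<equiv> inv_into U (g t)"

lemma inv_flow_in_U: "w \<in> upper_half_plane \<Longrightarrow> inv_flow w \<in> U"
  using flow_image_U by (metis inv_into_into)

lemma flow_inv_flow: "w \<in> upper_half_plane \<Longrightarrow> g t (inv_flow w) = w"
  using flow_image_U by (metis f_inv_into_f)

lemma inv_flow_flow: "z \<in> U \<Longrightarrow> inv_flow (g t z) = z"
  using inj_on_U by (rule inv_into_f_f)

lemma t_in: "t \<in> {0..t}" using tT by simp

lemma far_from_driving:
  assumes "live z t" "0 < Im z" "c \<le> Im (g t z)" "r \<in> {0..t}"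
  shows "c \<le> norm (g r z - x r j)"
  using Im_flow(2)[OF assms(1,2,4)] assms(3) Im_le_dist_driving[of "g r z" j r] by linarith

text \<open>From \<open>1 / (a * b) - 1 / (b * b) = (b - a) / (a * b * b)\<close>: the denominator
  gives \<open>c * c * c\<close>, the Lipschitz bound for \<open>g\<close> the exponential, and the
  integration against the weights the last \<open>mass\<close>.\<close>

lemma kernel_integral_diff_le:
  assumes z: "live z t" "0 < Im z" "c \<le> Im (g t z)" and z': "live z' t" "0 < Im z'" "c \<le> Im (g t z')" and c: "0 < c"
  shows "norm (integral {0..t} (kernel z' z) - integral {0..t} (kernel z z))
     \<le> norm (z - z') * (exp (1 / (c * c) * mass) / (c * c * c) * mass)"
proof -
  define d where "d = (\<lambda>j r. 1 / ((g r z' - x r j) * (g r z - x r j)) - 1 / ((g r z - x r j) * (g r z - x r j)))"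
  have cont: "continuous_on {0..t} (d j)" if "j \<in> {1..n}" for j
    unfolding d_def using continuous_on_live_factor z(1) z'(1) that by (intro continuous_on_diff) auto
  have diff: "integral {0..t} (kernel z' z) - integral {0..t} (kernel z z) = integral {0..t} (\<lambda>r. kernel z' z r - kernel z z r)"
    using kernel_integrable[OF z'(1) z(1)] kernel_integrable[OF z(1) z(1)]
    by (intro Henstock_Kurzweil_Integration.integral_diff[symmetric]) (auto simp: absolutely_integrable_on_def)
  have eq: "(\<lambda>r. kernel z' z r - kernel z z r) = (\<lambda>r. \<Sum>j\<in>{1..n}. 2 * u r j * d j r)"
    unfolding kernel_def d_def by (simp add: sum_subtractf[symmetric] right_diff_distrib)
  have "norm (integral {0..t} (\<lambda>r. \<Sum>j\<in>{1..n}. 2 * u r j * d j r)) \<le> norm (z - z') * exp (1 / (c * c) * mass) / (c * c * c) * mass"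
  proof (rule weighted_integral_le_mass[OF t_in cont])
    fix j r assume j: "j \<in> {1..n}" and r: "r \<in> {0..t}"
    let ?a = "g r z' - x r j" and ?b = "g r z - x r j"
    have a: "c \<le> norm ?a" and b: "c \<le> norm ?b" using far_from_driving z z' r by auto
    then have nz: "?a \<noteq> 0" "?b \<noteq> 0" using c by auto
    have "1 / (a * b) - 1 / (b * b) = (b - a) / (a * b * b)" if "a \<noteq> 0" "b \<noteq> 0" for a b :: complex
      using that by (simp add: divide_simps)
    from this[OF nz] have "d j r = (g r z - g r z') / (?a * ?b * ?b)" unfolding d_def by simp
    then have "norm (d j r) = norm (g r z - g r z') / (norm ?a * norm ?b * norm ?b)" by (simp add: norm_divide norm_mult)
    also have "\<dots> \<le> norm (g r z - g r z') / (c * c * c)"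
      using a b c nz by (intro divide_left_mono mult_mono mult_nonneg_nonneg mult_pos_pos) auto
    also have "norm (g r z - g r z') \<le> norm (z - z') * exp (1 / (c * c) * mass)"
    proof (rule flow_difference_bounds(1)[OF live_mono[OF z(1) r] live_mono[OF z'(1) r] c c])
      show "c \<le> norm (g s z - x s j)" if "s \<in> {0..r}" for s j
        using far_from_driving[OF z, of s] that r by auto
      show "c \<le> norm (g s z' - x s j)" if "s \<in> {0..r}" for s j
        using far_from_driving[OF z', of s] that r by auto
    qed
    finally show "norm (d j r) \<le> norm (z - z') * exp (1 / (c * c) * mass) / (c * c * c)"
      using c by (simp add: divide_right_mono)
  qed (use c in auto)
  then show ?thesis unfolding diff eq by simp
qed

text \<open>By \<open>flow_difference\<close> the difference quotient of the inverse already is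
  \<open>exp\<close> of a kernel integral, so only continuity of that integral in the base point
  remains. The inverse is differentiated, rather than \<open>g t\<close>, because it is what
  \<open>R\<close> is composed with.\<close>

lemma inv_flow_has_field_derivative:
  assumes w: "w \<in> upper_half_plane"
  shows "(inv_flow has_field_derivative exp (integral {0..t} (kernel (inv_flow w) (inv_flow w)))) (at w)"
proof -
  define z where "z = inv_flow w"
  \<comment> \<open>Half the height of \<open>w\<close>, so that the disc of radius \<open>c\<close>
    about \<open>w\<close> lies at height at least \<open>c\<close>.\<close>
  define c where "c = Im w / 2"
  have c: "0 < c" "c < Im w" using w by (auto simp: c_def upper_half_plane_def)
  have z: "live z t" "0 < Im z" "g t z = w"
    using inv_flow_in_U[OF w] flow_inv_flow[OF w] by (auto simp: z_def U_def)
  define E where "E = exp (1 / (c * c) * mass)"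
  define B where "B = E * (E / (c * c * c) * mass)"
  have near: "live (inv_flow w') t \<and> 0 < Im (inv_flow w') \<and> g t (inv_flow w') = w' \<and>
      norm (integral {0..t} (kernel (inv_flow w') z) - integral {0..t} (kernel z z)) \<le> norm (w' - w) * B"
    if w': "w' \<in> ball w c" for w'
  proof -
    have "\<bar>Im w - Im w'\<bar> < c" using w' abs_Im_le_cmod[of "w - w'"] by (simp add: dist_norm)
    then have cw': "c \<le> Im w'" using c_def by linarith
    then have wh: "w' \<in> upper_half_plane" using c by (simp add: upper_half_plane_def)
    have z': "live (inv_flow w') t" "0 < Im (inv_flow w')" "g t (inv_flow w') = w'"
      using inv_flow_in_U[OF wh] flow_inv_flow[OF wh] by (auto simp: U_def)
    have "norm (z - inv_flow w') \<le> norm (g t z - g t (inv_flow w')) * E"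
      unfolding E_def using c cw' z z' far_from_driving
      by (intro flow_difference_bounds(2)) auto
    then have le: "norm (z - inv_flow w') \<le> norm (w' - w) * E" using z z' by (simp add: norm_minus_commute)
    have "mass \<ge> 0" unfolding mass_def
      using nu_nonneg total_nu_integrable[OF t_in] by (intro Henstock_Kurzweil_Integration.integral_nonneg sum_nonneg) auto
    then have "0 \<le> E / (c * c * c) * mass" using c by (simp add: E_def)
    have "norm (integral {0..t} (kernel (inv_flow w') z) - integral {0..t} (kernel z z)) 
        \<le> norm (z - inv_flow w') * (E / (c * c * c) * mass)"
      unfolding E_def using c cw' z z' by (intro kernel_integral_diff_le) auto
    also have "\<dots> \<le> norm (w' - w) * E * (E / (c * c * c) * mass)"
      using le \<open>0 \<le> E / (c * c * c) * mass\<close> by (rule mult_right_mono)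
    finally show ?thesis using z' by (simp add: B_def mult.assoc)
  qed
  have ev: "\<forall>\<^sub>F w' in at w. w' \<in> ball w c \<and> w' \<noteq> w"
    using c(1) unfolding eventually_at by (intro exI[of _ c]) (auto simp: dist_commute)
  have "((\<lambda>w'. norm (w' - w) * B) \<longlongrightarrow> norm (w - w) * B) (at w)" by (intro tendsto_intros)
  then have "((\<lambda>w'. norm (w' - w) * B) \<longlongrightarrow> 0) (at w)" by simp
  then have "((\<lambda>w'. integral {0..t} (kernel (inv_flow w') z) - integral {0..t} (kernel z z)) \<longlongrightarrow> 0) (at w)"
    by (rule Lim_null_comparison[rotated]) (use ev near in \<open>auto elim!: eventually_mono\<close>)
  then have "((\<lambda>w'. integral {0..t} (kernel (inv_flow w') z)) \<longlongrightarrow> integral {0..t} (kernel z z)) (at w)"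
    by (rule LIM_zero_cancel)
  then have lim: "((\<lambda>w'. exp (integral {0..t} (kernel (inv_flow w') z))) \<longlongrightarrow> exp (integral {0..t} (kernel z z))) (at w)"
    by (rule tendsto_exp)
  have "\<forall>\<^sub>F w' in at w. exp (integral {0..t} (kernel (inv_flow w') z)) = (inv_flow w' - z) / (w' - w)"
    using ev
  proof (rule eventually_mono)
    fix w' assume w': "w' \<in> ball w c \<and> w' \<noteq> w"
    then have z': "live (inv_flow w') t" "g t (inv_flow w') = w'" using near by auto
    have "w' - w = (inv_flow w' - z) * exp (- integral {0..t} (kernel (inv_flow w') z))"
      using flow_difference[OF z'(1) z(1)] z'(2) z(3) by simp
    moreover have "w' - w \<noteq> 0" using w' by simp
    ultimately show "exp (integral {0..t} (kernel (inv_flow w') z)) = (inv_flow w' - z) / (w' - w)"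
      by (simp add: exp_minus field_simps)
  qed
  with lim show ?thesis unfolding has_field_derivative_iff z_def[symmetric]
    by (rule Lim_transform_eventually)
qed

text \<open>For a pole in the closed upper half-plane this is injectivity of the flow; a pole below
  the axis stays below it by reflection.\<close>

lemma pole_not_met:
  assumes z: "live z s" "0 < Im z" "z \<notin> \<xi> ` {1..m}" and l: "l \<in> {1..m}"
  shows "g s z \<noteq> p s l"
proof (cases "0 \<le> Im (\<xi> l)")
  case True
  show ?thesis
  proof
    assume "g s z = p s l"
    then have "z = \<xi> l" by (rule flow_inj[OF z(1) live_pole[OF l True live_range[OF z(1)]]])
    then show False using z(3) l by blast
  qed
next
  case False
  obtain l' where l': "l' \<in> {1..m}" "\<xi> l' = cnj (\<xi> l)" "\<And>s. s \<in> {0..t} \<Longrightarrow> p s l' = cnj (p s l)"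
    using conj_pole[OF l] by blast
  have "0 < Im (p s l')"
    using False l'(2) by (intro Im_flow(1) live_pole l'(1) live_range[OF z(1)]) auto
  then have "Im (p s l) < 0" using l'(3)[OF live_range[OF z(1)]] by simp
  then show ?thesis using Im_flow(1)[OF z(1,2)] by auto
qed

definition F :: "real \<Rightarrow> complex \<Rightarrow> complex" where
  "F s w = poly (crit_poly n (\<lambda>j. X j s)) w / (poly (root_poly (p s) {1..m}) w)\<^sup>2"

text \<open>The exponential is the reciprocal of the derivative of \<open>g t\<close> at
  \<open>z\<close>, so this is the conservation law stated without differentiating in
  \<open>z\<close>. Each factor of \<open>F\<close> becomes an exponential, and the exponents are
  compared pointwise in time under the integral.\<close>

lemma F_integral_of_motion:
  assumes z: "live z t" "0 < Im z" "z \<notin> \<xi> ` {1..m}"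
  shows "F t (g t z) = F 0 z * exp (integral {0..t} (kernel z z))"
proof -
  define a where "a = (\<lambda>j s. (V s (g s z) - driving_velocity {1..n} {1..m} (u s) (x s) (p s) j) / (g s z - x s j))"
  define b where "b = (\<lambda>l s. (V s (g s z) - V s (p s l)) / (g s z - p s l))"
  have nx: "g s z - x s j \<noteq> 0" if "s \<in> {0..t}" "j \<in> {1..n}" for s j
    using live_diff_nonzero[OF z(1)] that by blast
  have np: "g s z - p s l \<noteq> 0" if "s \<in> {0..t}" "l \<in> {1..m}" for s l
    using pole_not_met[OF live_mono[OF z(1) that(1)] z(2,3) that(2)] by simp
  have g0: "g 0 z = z" using g_0 z by (simp add: live_def)
  have sx: "solves_upto t (\<lambda>s. g s z - x s j) (\<lambda>s. V s (g s z) - driving_velocity {1..n} {1..m} (u s) (x s) (p s) j)"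
    if "j \<in> {1..n}" for j using that by (intro solves_upto_diff live_solves z driving_solves)
  have sp: "solves_upto t (\<lambda>s. g s z - p s l) (\<lambda>s. V s (g s z) - V s (p s l))"
    if "l \<in> {1..m}" for l using that by (intro solves_upto_diff live_solves z pole_solves)
  have ai: "a j integrable_on {0..t}" "g t z - x t j = (z - x 0 j) * exp (integral {0..t} (a j))" if j: "j \<in> {1..n}" for j
    using solves_upto_nonzero(1)[OF sx[OF j] nx[OF _ j]] solves_upto_nonzero(2)[OF sx[OF j] nx[OF _ j] t_in] g0
    unfolding a_def by (auto simp: absolutely_integrable_on_def)
  have bi: "b l integrable_on {0..t}" "g t z - p t l = (z - p 0 l) * exp (integral {0..t} (b l))" if l: "l \<in> {1..m}" for l
    using solves_upto_nonzero(1)[OF sp[OF l] np[OF _ l]] solves_upto_nonzero(2)[OF sp[OF l] np[OF _ l] t_in] g0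
    unfolding b_def by (auto simp: absolutely_integrable_on_def)
  have A: "(\<Prod>j\<in>{1..n}. g t z - x t j) = (\<Prod>j\<in>{1..n}. z - x 0 j) * exp (\<Sum>j\<in>{1..n}. integral {0..t} (a j))"
    by (simp add: ai(2) prod.distrib exp_sum)
  have B: "(\<Prod>l\<in>{1..m}. g t z - p t l) = (\<Prod>l\<in>{1..m}. z - p 0 l) * exp (\<Sum>l\<in>{1..m}. integral {0..t} (b l))"
    by (simp add: bi(2) prod.distrib exp_sum)
  have asum: "(\<lambda>s. \<Sum>j\<in>{1..n}. a j s) integrable_on {0..t}" and bsum: "(\<lambda>s. 2 * (\<Sum>l\<in>{1..m}. b l s)) integrable_on {0..t}"
    by (intro integrable_on_mult_right Henstock_Kurzweil_Integration.integrable_sum ai(1) bi(1) finite_atLeastAtMost; assumption)+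
  have exp_quot: "exp a / (exp b)\<^sup>2 = exp (a - 2 * b)" for a b :: complex by (simp add: exp_diff exp_double)
  have "(\<Sum>j\<in>{1..n}. integral {0..t} (a j)) - 2 * (\<Sum>l\<in>{1..m}. integral {0..t} (b l))
      = integral {0..t} (\<lambda>s. \<Sum>j\<in>{1..n}. a j s) - integral {0..t} (\<lambda>s. 2 * (\<Sum>l\<in>{1..m}. b l s))"
  proof -
    have "integral {0..t} (\<lambda>s. \<Sum>j\<in>{1..n}. a j s) = (\<Sum>j\<in>{1..n}. integral {0..t} (a j))"
      by (rule Henstock_Kurzweil_Integration.integral_sum[OF finite_atLeastAtMost ai(1)])
    moreover have "integral {0..t} (\<lambda>s. \<Sum>l\<in>{1..m}. b l s) = (\<Sum>l\<in>{1..m}. integral {0..t} (b l))"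
      by (rule Henstock_Kurzweil_Integration.integral_sum[OF finite_atLeastAtMost bi(1)])
    ultimately show ?thesis by simp
  qed
  also have "\<dots> = integral {0..t} (\<lambda>s. (\<Sum>j\<in>{1..n}. a j s) - 2 * (\<Sum>l\<in>{1..m}. b l s))"
    by (rule Henstock_Kurzweil_Integration.integral_diff[OF asum bsum, symmetric])
  also have "\<dots> = integral {0..t} (kernel z z)"
  proof (rule integral_cong)
    fix s assume s: "s \<in> {0..t}"
    note dd = pairwise_distinctD[OF distinct[OF s]]
    have "g s z \<notin> x s ` {1..n}" by (rule not_in_image_if_diff_nonzero) (rule nx[OF s])
    moreover have "g s z \<notin> p s ` {1..m}" by (rule not_in_image_if_diff_nonzero) (rule np[OF s])
    moreover have "p s l \<notin> x s ` {1..n}" if "l \<in> {1..m}" for l using dd(4)[OF _ that] by blast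
    ultimately have "(\<Sum>j\<in>{1..n}. a j s) - 2 * (\<Sum>l\<in>{1..m}. b l s) = (\<Sum>j\<in>{1..n}. 2 * u s j / (g s z - x s j)\<^sup>2)"
      unfolding a_def b_def by (intro integral_of_motion_identity dd(3) finite_atLeastAtMost)
    then show "(\<Sum>j\<in>{1..n}. a j s) - 2 * (\<Sum>l\<in>{1..m}. b l s) = kernel z z s"
      by (simp add: kernel_def power2_eq_square)
  qed
  finally have "exp (\<Sum>j\<in>{1..n}. integral {0..t} (a j)) / (exp (\<Sum>l\<in>{1..m}. integral {0..t} (b l)))\<^sup>2 = exp (integral {0..t} (kernel z z))"
    using exp_quot by simp
  moreover have "F t (g t z) = F 0 z * (exp (\<Sum>j\<in>{1..n}. integral {0..t} (a j)) / (exp (\<Sum>l\<in>{1..m}. integral {0..t} (b l)))\<^sup>2)"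
    unfolding F_def poly_root_poly A B by (simp add: power_mult_distrib)
  ultimately show ?thesis by simp
qed

end

section \<open>The conserved rational function\<close>

context loewner_flow begin

text \<open>Lets the construction at time \<open>t\<close> be repeated at every earlier time, in
  particular just before a point is swallowed.\<close>

lemma loewner_flow_at: "s \<in> {0..t} \<Longrightarrow> loewner_flow n m \<nu> x0 \<xi> T X g s"
  using mn conj par flow tT distinct by unfold_locales auto

lemma initial_configuration:
  "root_poly (p 0) {1..m} = root_poly \<xi> {1..m}" "crit_poly n (\<lambda>j. X j 0) = crit_poly n x0"
  unfolding root_poly_def by (auto intro!: prod.cong simp: p_0 X_0)

definition wronskian_at :: "real \<Rightarrow> complex poly \<Rightarrow> bool" where
  "wronskian_at s P \<longleftrightarrow> map_poly cnj P = P \<and>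
     pderiv P * root_poly (p s) {1..m} - P * pderiv (root_poly (p s) {1..m}) = crit_poly n (\<lambda>j. X j s)"

definition quot :: "real \<Rightarrow> complex poly \<Rightarrow> complex \<Rightarrow> complex" where
  "quot s P w = poly P w / poly (root_poly (p s) {1..m}) w"

lemma quot_CR:
  assumes "s \<in> {0..t}" "wronskian_at s P"
  shows "quot s P \<in> CR m n (\<lambda>j. X j s)" "finite_poles (quot s P) = p s ` {1..m}"
    "w \<notin> p s ` {1..m} \<Longrightarrow> (quot s P has_field_derivative F s w) (at w)"
    "cnj (quot s P w) = quot s P (cnj w)"
proof -
  have W: "map_poly cnj P = P" "pderiv P * root_poly (p s) {1..m} - P * pderiv (root_poly (p s) {1..m}) = crit_poly n (\<lambda>j. X j s)"
    using assms(2) by (simp_all add: wronskian_at_def)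
  note C = CR_of_wronskian[OF distinct[OF assms(1)] mn conj_closed[OF assms(1)] W]
  have q: "quot s P = (\<lambda>z. poly P z / poly (root_poly (p s) {1..m}) z)" by (rule ext) (simp only: quot_def)
  show CR: "quot s P \<in> CR m n (\<lambda>j. X j s)" unfolding q by (rule C(1))
  show "finite_poles (quot s P) = p s ` {1..m}" unfolding q by (rule C(2))
  show "w \<notin> p s ` {1..m} \<Longrightarrow> (quot s P has_field_derivative F s w) (at w)" unfolding q F_def by (rule C(3))
  have "\<forall>z. cnj (quot s P (cnj z)) = quot s P z" using CR unfolding CR_def by blast
  from this[rule_format, of "cnj w"] show "cnj (quot s P w) = quot s P (cnj w)" by simp
qed

lemma pole_upper_half_plane:
  assumes l: "l \<in> {1..m}" and "p t l \<in> upper_half_plane"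
  shows "\<xi> l \<in> U"
proof -
  have pos: "0 < Im (p t l)" using assms by (simp add: upper_half_plane_def)
  show ?thesis
  proof (cases "Im (\<xi> l)" "0 :: real" rule: linorder_cases)
    case greater
    then show ?thesis using live_pole[OF l _ t_in] by (simp add: U_def)
  next
    case equal
    then show ?thesis using live_real[OF live_pole[OF l _ t_in]] pos by simp
  next
    case less
    obtain l' where l': "l' \<in> {1..m}" "\<xi> l' = cnj (\<xi> l)" "\<And>s. s \<in> {0..t} \<Longrightarrow> p s l' = cnj (p s l)"
      using conj_pole[OF l] by blast
    have "0 < Im (p t l')" using less l'(2) by (intro Im_flow(1) live_pole l'(1) t_in) auto
    then show ?thesis using l'(3)[OF t_in] pos by simp
  qed
qed

lemma pole_inv_flow_iff:
  assumes w: "w \<in> upper_half_plane"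
  shows "inv_flow w \<in> \<xi> ` {1..m} \<longleftrightarrow> w \<in> p t ` {1..m}"
proof
  assume "inv_flow w \<in> \<xi> ` {1..m}"
  then obtain l where "l \<in> {1..m}" "inv_flow w = \<xi> l" by blast
  then show "w \<in> p t ` {1..m}" using flow_inv_flow[OF w] by (metis imageI)
next
  assume "w \<in> p t ` {1..m}"
  then obtain l where l: "l \<in> {1..m}" "w = p t l" by blast
  then have "inv_flow w = \<xi> l" using inv_flow_flow[OF pole_upper_half_plane[OF l(1)]] w by simp
  then show "inv_flow w \<in> \<xi> ` {1..m}" using l by blast
qed

text \<open>Conservation is known only in the open half-plane, so the real points are approached
  from above. The abscissa \<open>M + 2\<close> is beyond the threshold \<open>M + 1\<close> of
  \<open>Re_flow_far\<close>, keeps distance at least 1 from the driving points (whence the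
  constants \<open>1 * 1\<close>), and lies to the right of all poles.\<close>

lemma real_axis_limit:
  obtains z0 w0 :: complex and Z :: "nat \<Rightarrow> complex" where "Im z0 = 0" "Im w0 = 0" "\<And>i. Z i \<in> U"
    "Z \<longlonglongrightarrow> z0" "(\<lambda>i. g t (Z i)) \<longlonglongrightarrow> w0" "z0 \<notin> \<xi> ` {1..m}" "w0 \<notin> p t ` {1..m}" "\<And>i. Z i \<notin> \<xi> ` {1..m}"
proof -
  obtain M where M: "\<And>j s. j \<in> {1..n} \<Longrightarrow> s \<in> {0..t} \<Longrightarrow> X j s \<le> M"
    "\<And>l s. l \<in> {1..m} \<Longrightarrow> s \<in> {0..t} \<Longrightarrow> Re (p s l) \<le> M" using configuration_bounded by metis
  define z0 where "z0 = complex_of_real (M + 2)"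
  define Z where "Z = (\<lambda>i. Complex (M + 2) (1 / real (Suc i)))"
  have far: "live z t \<and> (\<forall>s\<in>{0..t}. M + 2 \<le> Re (g s z))" if "0 \<le> Im z" "Re z = M + 2" for z
    using Re_flow_far[OF M(1), of z] that by auto
  have z0: "live z0 t" "\<forall>s\<in>{0..t}. M + 2 \<le> Re (g s z0)" using far[of z0] by (simp_all add: z0_def)
  have Z: "live (Z i) t" "\<forall>s\<in>{0..t}. M + 2 \<le> Re (g s (Z i))" for i using far[of "Z i"] by (simp_all add: Z_def)
  have "(\<lambda>i. complex_of_real (M + 2) + \<i> * complex_of_real (1 / real (Suc i))) \<longlonglongrightarrow> complex_of_real (M + 2) + \<i> * complex_of_real 0"
    by (intro tendsto_intros LIMSEQ_Suc[OF lim_1_over_n])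
  then have lim: "Z \<longlonglongrightarrow> z0" unfolding Z_def z0_def by (simp add: Complex_eq)
  have dist1: "1 \<le> norm (g r z - x r j)" if "r \<in> {0..t}" "j \<in> {1..n}" "M + 2 \<le> Re (g r z)" for r j z
    using that M(1)[OF that(2,1)] complex_Re_le_cmod[of "g r z - x r j"] by simp
  have "norm (g t (Z i) - g t z0) \<le> norm (Z i - z0) * exp (1 / (1 * 1) * mass)" for i
    using Z z0 dist1 by (intro flow_difference_bounds(1)) auto
  then have le: "\<forall>\<^sub>F i in sequentially. norm (g t (Z i) - g t z0) \<le> norm (Z i - z0) * exp (1 / (1 * 1) * mass)"
    by (rule always_eventually[OF allI])
  have "(\<lambda>i. norm (Z i - z0) * exp (1 / (1 * 1) * mass)) \<longlonglongrightarrow> norm (z0 - z0) * exp (1 / (1 * 1) * mass)"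
    by (intro tendsto_intros lim)
  then have "(\<lambda>i. norm (Z i - z0) * exp (1 / (1 * 1) * mass)) \<longlonglongrightarrow> 0" by simp
  with le have "(\<lambda>i. g t (Z i) - g t z0) \<longlonglongrightarrow> 0" by (rule Lim_null_comparison)
  then have lim2: "(\<lambda>i. g t (Z i)) \<longlonglongrightarrow> g t z0" by (rule LIM_zero_cancel)
  have nxi: "z \<notin> \<xi> ` {1..m}" if "Re z = M + 2" for z
  proof
    assume "z \<in> \<xi> ` {1..m}"
    then obtain l where "l \<in> {1..m}" "z = \<xi> l" by blast
    then show False using M(2)[of l 0] p_0[of l] tT that by simp
  qed
  show ?thesis
  proof (rule that[of z0 "g t z0" Z])
    show "Im z0 = 0" by (simp add: z0_def)
    then show "Im (g t z0) = 0" by (rule live_real[OF z0(1)])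
    show "Z i \<in> U" for i using Z(1)[of i] by (simp add: U_def Z_def)
    show "g t z0 \<notin> p t ` {1..m}"
    proof
      assume "g t z0 \<in> p t ` {1..m}"
      then obtain l where "l \<in> {1..m}" "g t z0 = p t l" by blast
      then show False using M(2)[of l t] z0(2) t_in by force
    qed
    show "z0 \<notin> \<xi> ` {1..m}" "Z i \<notin> \<xi> ` {1..m}" for i by (rule nxi, simp add: z0_def Z_def)+
  qed (rule lim lim2)+
qed

lemma conserved_quotient_exists:
  assumes st: "stationary_relations n m x0 \<xi>" and P0: "wronskian_at 0 P0"
  obtains P where "wronskian_at t P"
    "\<And>w. w \<in> upper_half_plane \<Longrightarrow> w \<notin> p t ` {1..m} \<Longrightarrow> quot t P w = quot 0 P0 (inv_flow w)"
proof -
  have zero: "0 \<in> {0..t}" using tT by simp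
  note R0 = quot_CR[OF zero P0]
  obtain P1 where P1: "wronskian_at t P1"
    using real_stationary_wronskian_exists[OF distinct[OF t_in] stationary_preserved[OF st t_in] conj_closed[OF t_in]]
    unfolding wronskian_at_def by (elim exE)
  note R1 = quot_CR[OF t_in P1]
  have p0: "p 0 ` {1..m} = \<xi> ` {1..m}" by (intro image_cong refl p_0)
  define S where "S = upper_half_plane - p t ` {1..m}"
  have conn: "connected S" unfolding S_def upper_half_plane_def
    by (intro connected_open_delete_finite convex_connected convex_halfspace_Im_gt open_halfspace_Im_gt) auto
  have op: "open S" unfolding S_def upper_half_plane_def
    by (intro open_Diff open_halfspace_Im_gt finite_imp_closed) auto
  define D where "D = (\<lambda>w. quot t P1 w - quot 0 P0 (inv_flow w))"
  have Dd: "(D has_field_derivative 0) (at w)" if w: "w \<in> S" for w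
  proof -
    have wh: "w \<in> upper_half_plane" and wp: "w \<notin> p t ` {1..m}" using w by (auto simp: S_def)
    define z where "z = inv_flow w"
    have zp: "z \<notin> \<xi> ` {1..m}" using pole_inv_flow_iff[OF wh] wp by (simp add: z_def)
    have zU: "live z t" "0 < Im z" "g t z = w" using inv_flow_in_U[OF wh] flow_inv_flow[OF wh] by (auto simp: z_def U_def)
    have "((\<lambda>w. quot 0 P0 (inv_flow w)) has_field_derivative F 0 (inv_flow w) * exp (integral {0..t} (kernel z z))) (at w)"
      using DERIV_chain2[OF R0(3) inv_flow_has_field_derivative[OF wh]] zp p0 by (simp add: z_def)
    then have "(D has_field_derivative F t w - F 0 z * exp (integral {0..t} (kernel z z))) (at w)"
      unfolding D_def z_def[symmetric] by (intro derivative_intros R1(3) wp)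
    then show ?thesis using F_integral_of_motion[OF zU(1,2) zp] zU(3) by simp
  qed
  then obtain c where c: "\<And>w. w \<in> S \<Longrightarrow> D w = c"
    using DERIV_zero_connected_constant[OF conn op finite.emptyI, of D] 
      continuous_on_eq_continuous_at[OF op, of D] DERIV_isCont by blast
  obtain z0 w0 Z where Z: "Im z0 = 0" "Im w0 = 0" "\<And>i. Z i \<in> U" "Z \<longlonglongrightarrow> z0" "(\<lambda>i. g t (Z i)) \<longlonglongrightarrow> w0"
    "z0 \<notin> \<xi> ` {1..m}" "w0 \<notin> p t ` {1..m}" "\<And>i. Z i \<notin> \<xi> ` {1..m}" using real_axis_limit by metis
  have "quot t P1 (g t (Z i)) - quot 0 P0 (Z i) = c" for i
  proof -
    have h: "g t (Z i) \<in> upper_half_plane" using flow_image_U Z(3) by blast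
    moreover have "g t (Z i) \<notin> p t ` {1..m}" using pole_inv_flow_iff[OF h] inv_flow_flow[OF Z(3)] Z(8) by simp
    ultimately show ?thesis using c[of "g t (Z i)"] inv_flow_flow[OF Z(3)] by (simp add: D_def S_def)
  qed
  moreover have "(\<lambda>i. quot t P1 (g t (Z i)) - quot 0 P0 (Z i)) \<longlonglongrightarrow> quot t P1 w0 - quot 0 P0 z0"
  proof (rule tendsto_diff)
    show "(\<lambda>i. quot t P1 (g t (Z i))) \<longlonglongrightarrow> quot t P1 w0"
      by (rule isCont_tendsto_compose[OF DERIV_isCont[OF R1(3)[OF Z(7)]] Z(5)])
    have "z0 \<notin> p 0 ` {1..m}" using Z(6) p0 by simp
    then show "(\<lambda>i. quot 0 P0 (Z i)) \<longlonglongrightarrow> quot 0 P0 z0"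
      by (intro isCont_tendsto_compose[OF DERIV_isCont[OF R0(3)] Z(4)])
  qed
  ultimately have c_eq: "c = quot t P1 w0 - quot 0 P0 z0" by (simp add: LIMSEQ_const_iff)
  have "cnj w0 = w0" "cnj z0 = z0" using Z(1,2) by (simp_all add: complex_eq_iff)
  then have c_real: "cnj c = c" unfolding c_eq complex_cnj_diff R1(4) R0(4) by simp
  have Q: "map_poly cnj (root_poly (p t) {1..m}) = root_poly (p t) {1..m}"
    using pairwise_distinctD(2)[OF distinct[OF t_in]] conj_closed[OF t_in] by (intro map_poly_cnj_root_poly) auto
  \<comment> \<open>Subtracting \<open>c\<close> times the denominator shifts the quotient by
    \<open>c\<close> and leaves the Wronskian unchanged; reality of \<open>c\<close> preserves the
    symmetry.\<close>
  define P where "P = P1 - smult c (root_poly (p t) {1..m})"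
  show ?thesis
  proof (rule that[of P])
    have "map_poly cnj (smult c (root_poly (p t) {1..m})) = smult c (map_poly cnj (root_poly (p t) {1..m}))"
      by (rule poly_ext) (simp add: c_real)
    then have "map_poly cnj P = P" using P1 unfolding P_def map_poly_cnj_diff wronskian_at_def Q by simp
    moreover have "pderiv P * root_poly (p t) {1..m} - P * pderiv (root_poly (p t) {1..m}) =
        pderiv P1 * root_poly (p t) {1..m} - P1 * pderiv (root_poly (p t) {1..m})"
      unfolding P_def by (simp add: pderiv_diff pderiv_smult algebra_simps)
    ultimately show "wronskian_at t P" using P1 by (simp add: wronskian_at_def)
    fix w assume w: "w \<in> upper_half_plane" "w \<notin> p t ` {1..m}"
    have "poly (root_poly (p t) {1..m}) w \<noteq> 0" using w(2) by auto
    then have "quot t P w = quot t P1 w - c" by (simp add: quot_def P_def diff_divide_distrib del: poly_root_poly)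
    then show "quot t P w = quot 0 P0 (inv_flow w)" using c[of w] w by (simp add: S_def D_def algebra_simps)
  qed
qed

section \<open>The hull and the real locus\<close>

lemma swallowed_value_real:
  assumes st: "stationary_relations n m x0 \<xi>" and P0: "wronskian_at 0 P0"
    and z: "0 < Im z" "z \<notin> \<xi> ` {1..m}" "\<not> live z t"
  shows "Im (quot 0 P0 z) = 0"
proof -
  have "0 \<le> Im z" using z by simp
  from not_live[OF this t_in z(3)] obtain \<tau> where \<tau>: "\<tau> \<in> {0..t}" "hits n X g z \<tau>"
    "continuous_on {0..\<tau>} (\<lambda>r. g r z)" "\<And>r. r \<in> {0..<\<tau>} \<Longrightarrow> live z r" by metis
  obtain j where j: "j \<in> {1..n}" "g \<tau> z = x \<tau> j" using \<tau>(2) by (auto simp: hits_def)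
  define a where "a = x \<tau> j"
  have "\<tau> \<noteq> 0" using j g_0[of z] z by auto
  then have \<tau>0: "0 < \<tau>" using \<tau>(1) by simp
  define \<F> where "\<F> = at \<tau> within {0..<\<tau>}"
  have nontriv: "\<F> \<noteq> bot" unfolding \<F>_def trivial_limit_within using \<tau>0 by (simp add: islimpt_in_closure)
  have sub: "{0..<\<tau>} \<subseteq> {0..\<tau>}" "{0..<\<tau>} \<subseteq> {0..t}" using \<tau>(1) by auto
  have in_range: "\<forall>\<^sub>F s in \<F>. s \<in> {0..<\<tau>}" unfolding \<F>_def by (simp add: eventually_at_filter)
  have lim_g: "((\<lambda>s. g s z) \<longlongrightarrow> a) \<F>"
  proof -
    have "((\<lambda>s. g s z) \<longlongrightarrow> g \<tau> z) (at \<tau> within {0..\<tau>})"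
      using \<tau>(3) \<tau>0 unfolding continuous_on_def by simp
    from tendsto_within_subset[OF this sub(1)] show ?thesis unfolding \<F>_def a_def j(2) .
  qed
  have lim_p: "((\<lambda>s. p s l) \<longlongrightarrow> p \<tau> l) \<F>" if "l \<in> {1..m}" for l
  proof -
    have "((\<lambda>s. p s l) \<longlongrightarrow> p \<tau> l) (at \<tau> within {0..t})"
      using p_continuous[OF that] \<tau>(1) unfolding continuous_on_def by blast
    from tendsto_within_subset[OF this sub(2)] show ?thesis unfolding \<F>_def .
  qed
  obtain d where d: "0 < d" "\<forall>w\<in>p \<tau> ` {1..m}. w \<noteq> a \<longrightarrow> d \<le> dist a w"
    using finite_set_avoid[of "p \<tau> ` {1..m}" a] by auto
  \<comment> \<open>One third is spent on the distance from \<open>a\<close> to \<open>v\<close>,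
    one on the motion of the pole between \<open>s\<close> and \<open>\<tau>\<close>; the last third
    remains between \<open>v\<close> and the pole.\<close>
  define \<delta> where "\<delta> = d / 3"
  have \<delta>: "0 < \<delta>" using d by (simp add: \<delta>_def)
  have far: "3 * \<delta> \<le> dist a (p \<tau> l)" if l: "l \<in> {1..m}" for l
    using d(2) l pairwise_distinctD(4)[OF distinct[OF \<tau>(1)] j(1) l] by (simp add: \<delta>_def a_def)
  obtain M where M: "\<And>j s. j \<in> {1..n} \<Longrightarrow> s \<in> {0..t} \<Longrightarrow> norm (x s j) \<le> M"
  proof -
    have "bounded (\<Union>j\<in>{1..n}. (\<lambda>s. x s j) ` {0..t})"
      by (intro bounded_UN ballI finite_atLeastAtMost compact_imp_bounded compact_continuous_image x_continuous compact_Icc)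
    then show ?thesis using that unfolding bounded_iff by fastforce
  qed
  have "0 \<le> M" using M[OF j(1) \<tau>(1)] norm_ge_zero order_trans by blast
  \<comment> \<open>Bounds \<open>F s\<close> near \<open>a\<close>, uniformly for \<open>s\<close>
    close to \<open>\<tau>\<close>: each zero factor is at most
    \<open>norm a + \<delta> + M\<close>, each pole factor at least \<open>\<delta>\<close>.\<close>
  define B where "B = (norm a + \<delta> + M) ^ n / (\<delta> ^ m)\<^sup>2"
  have bound: "\<bar>Im (quot 0 P0 z)\<bar> \<le> B * Im (g s z)"
    if s: "s \<in> {0..<\<tau>}" and ga: "dist (g s z) a < \<delta>" and pa: "\<And>l. l \<in> {1..m} \<Longrightarrow> dist (p s l) (p \<tau> l) < \<delta>" for s
  proof -
    have st': "s \<in> {0..t}" using s sub by blast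
    \<comment> \<open>At \<open>s < \<tau>\<close> the point is unswallowed, so the conserved
      quotient of that time is available, with a polynomial \<open>P\<close> that depends on
      \<open>s\<close>.\<close>
    interpret L: loewner_flow n m \<nu> x0 \<xi> T X g s by (rule loewner_flow_at[OF st'])
    have lz: "live z s" by (rule \<tau>(4)[OF s])
    have zU: "z \<in> L.U" using lz z(1) by (simp add: L.U_def L.live_def live_def)
    have gs: "g s z \<in> upper_half_plane" using Im_flow(1)[OF lz z(1)] by (simp add: upper_half_plane_def)
    have gp: "g s z \<notin> p s ` {1..m}" using pole_not_met[OF lz z(1,2)] by blast
    obtain P where P: "wronskian_at s P"
      "\<And>w. w \<in> upper_half_plane \<Longrightarrow> w \<notin> p s ` {1..m} \<Longrightarrow> quot s P w = quot 0 P0 (inv_into L.U (g s) w)"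
      using L.conserved_quotient_exists[OF st P0] by metis
    note R = quot_CR[OF st' P(1)]
    have val: "quot s P (g s z) = quot 0 P0 z" using P(2)[OF gs gp] L.inv_flow_flow[OF zU] by simp
    have sep: "\<delta> \<le> norm (v - p s l)" if "v \<in> ball a \<delta>" "l \<in> {1..m}" for v l
    proof -
      have "dist a (p \<tau> l) \<le> dist a v + dist v (p s l) + dist (p s l) (p \<tau> l)"
        using dist_triangle[of a "p \<tau> l" v] dist_triangle[of v "p \<tau> l" "p s l"] by linarith
      then show ?thesis using far[OF that(2)] pa[OF that(2)] that(1) by (simp add: dist_norm)
    qed
    have FB: "norm (F s v) \<le> B" if v: "v \<in> ball a \<delta>" for v
    proof -
      have "norm (v - x s k) \<le> norm a + \<delta> + M" if "k \<in> {1..n}" for k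
      proof -
        have "norm (v - x s k) \<le> norm v + norm (x s k)" by (rule norm_triangle_ineq4)
        moreover have "norm v \<le> norm a + dist a v" using norm_triangle_sub[of v a] by (simp add: dist_norm norm_minus_commute)
        ultimately show ?thesis using M[OF that st'] v by simp
      qed
      then have "(\<Prod>k\<in>{1..n}. norm (v - x s k)) \<le> (\<Prod>k\<in>{1..n}. norm a + \<delta> + M)"
        by (intro prod_mono) auto
      moreover have "(\<Prod>l\<in>{1..m}. \<delta>) \<le> (\<Prod>l\<in>{1..m}. norm (v - p s l))"
        using sep[OF v] \<delta> by (intro prod_mono) auto
      ultimately show ?thesis
        unfolding F_def B_def poly_root_poly norm_divide norm_power prod_norm[symmetric]
        using \<delta> \<open>0 \<le> M\<close> by (intro frac_le power_mono) (auto simp: prod_nonneg)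
    qed
    \<comment> \<open>The foot of \<open>g s z\<close> on the real axis; it lies in the ball because
      the centre \<open>a\<close> is real.\<close>
    define r where "r = complex_of_real (Re (g s z))"
    have "norm (r - a) \<le> norm (g s z - a)"
      using abs_Re_le_cmod[of "g s z - a"] by (simp add: r_def a_def flip: of_real_diff)
    then have rb: "r \<in> ball a \<delta>" "g s z \<in> ball a \<delta>" using ga by (simp_all add: dist_norm norm_minus_commute)
    have "norm (quot s P (g s z) - quot s P r) \<le> B * norm (g s z - r)"
    proof (rule field_differentiable_bound[OF convex_ball _ FB rb(2,1)])
      fix v assume v: "v \<in> ball a \<delta>"
      have "v \<notin> p s ` {1..m}" using sep[OF v] \<delta> by force
      then show "(quot s P has_field_derivative F s v) (at v within ball a \<delta>)"
        by (rule has_field_derivative_at_within[OF R(3)])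
    qed
    moreover have "cnj (quot s P r) = quot s P r" unfolding R(4) by (simp add: r_def)
    then have "Im (quot s P r) = 0" by (simp add: complex_eq_iff)
    then have "\<bar>Im (quot s P (g s z))\<bar> \<le> norm (quot s P (g s z) - quot s P r)"
      using abs_Im_le_cmod[of "quot s P (g s z) - quot s P r"] by simp
    moreover have "norm (g s z - r) = Im (g s z)"
      using gs by (simp add: r_def cmod_def upper_half_plane_def)
    ultimately show ?thesis unfolding val by simp
  qed
  have "\<forall>\<^sub>F s in \<F>. \<forall>l\<in>{1..m}. dist (p s l) (p \<tau> l) < \<delta>"
    by (intro eventually_ball_finite ballI tendstoD[OF lim_p] \<delta>) auto
  then have "\<forall>\<^sub>F s in \<F>. \<bar>Im (quot 0 P0 z)\<bar> \<le> B * Im (g s z)"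
    using in_range tendstoD[OF lim_g \<delta>] by eventually_elim (rule bound, auto)
  moreover have "((\<lambda>s. B * Im (g s z)) \<longlongrightarrow> B * Im a) \<F>" by (intro tendsto_intros lim_g)
  \<comment> \<open>The left-hand side does not depend on \<open>s\<close>, so the bound passes to
    the limit, where \<open>Im a = 0\<close>.\<close>
  ultimately have "\<bar>Im (quot 0 P0 z)\<bar> \<le> B * Im a"
    by (intro tendsto_lowerbound[OF _ _ nontriv])
  then show ?thesis by (simp add: a_def)
qed

lemma flow_conclusion:
  assumes st: "stationary_relations n m x0 \<xi>" and P0: "wronskian_at 0 P0"
  shows "Some ` loewner_hull n X g t \<subseteq> real_locus (quot 0 P0)"
    and "bij_betw (g t) (upper_half_plane - loewner_hull n X g t) upper_half_plane"
    and "\<exists>S \<in> CR m n (\<lambda>j. X j t). \<forall>w \<in> upper_half_plane. sphere_map S (Some w) =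
      sphere_map (quot 0 P0) (Some (inv_into (upper_half_plane - loewner_hull n X g t) (g t) w))"
proof -
  have zero: "0 \<in> {0..t}" using tT by simp
  note R0 = quot_CR[OF zero P0]
  have p0: "p 0 ` {1..m} = \<xi> ` {1..m}" by (intro image_cong refl p_0)
  have pole0: "is_pole (quot 0 P0) z \<longleftrightarrow> z \<in> \<xi> ` {1..m}" for z
    using R0(2) unfolding p0 finite_poles_def by blast
  show "bij_betw (g t) (upper_half_plane - loewner_hull n X g t) upper_half_plane"
    unfolding U_eq by (rule bij_betw_flow)
  show "Some ` loewner_hull n X g t \<subseteq> real_locus (quot 0 P0)"
  proof (rule image_subsetI)
    fix z assume z: "z \<in> loewner_hull n X g t"
    then have zi: "0 \<le> Im z" and nl: "\<not> live z t" by (auto simp: loewner_hull_def live_def)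
    \<comment> \<open>Hull points on the real axis are settled by the symmetry of the quotient;
      poles map to infinity, which the real locus contains.\<close>
    have "quot 0 P0 z \<in> \<real>" if "z \<notin> \<xi> ` {1..m}"
    proof (cases "Im z = 0")
      case True
      then have "cnj z = z" by (simp add: complex_eq_iff)
      then have "cnj (quot 0 P0 z) = quot 0 P0 z" using R0(4)[of z] by simp
      then show ?thesis by (simp add: Reals_cnj_iff)
    next
      case False
      then show ?thesis using swallowed_value_real[OF st P0 _ that nl] zi by (simp add: complex_is_Real_iff)
    qed
    then show "Some z \<in> real_locus (quot 0 P0)"
      unfolding real_locus_def sphere_map_def by (simp add: pole0)
  qed
  obtain P where P: "wronskian_at t P"
    "\<And>w. w \<in> upper_half_plane \<Longrightarrow> w \<notin> p t ` {1..m} \<Longrightarrow> quot t P w = quot 0 P0 (inv_flow w)"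
    using conserved_quotient_exists[OF st P0] by metis
  note R = quot_CR[OF t_in P(1)]
  have pole: "is_pole (quot t P) w \<longleftrightarrow> w \<in> p t ` {1..m}" for w
    using R(2) unfolding finite_poles_def by blast
  have "sphere_map (quot t P) (Some w) = sphere_map (quot 0 P0) (Some (inv_flow w))" if w: "w \<in> upper_half_plane" for w
    unfolding sphere_map_def using P(2)[OF w] pole_inv_flow_iff[OF w] by (simp add: pole pole0)
  then show "\<exists>S \<in> CR m n (\<lambda>j. X j t). \<forall>w \<in> upper_half_plane. sphere_map S (Some w) =
      sphere_map (quot 0 P0) (Some (inv_into (upper_half_plane - loewner_hull n X g t) (g t) w))"
    unfolding U_eq using R(1) by blast
qed

end

theorem theorem1p5:
  fixes n m :: nat and x :: "nat \<Rightarrow> real" and \<xi> :: "nat \<Rightarrow> complex"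
  assumes "0 < n" and "0 < m" and "m \<le> n div 2"
    and "pairwise_distinct n m x \<xi>"
    and "cnj ` (\<xi> ` {1..m}) = \<xi> ` {1..m}"
    and "stationary_relations n m x \<xi>"
  shows "\<exists>R \<in> CR m n x.
    finite_poles R = \<xi> ` {1..m} \<and>
    (\<forall>\<nu> T X g. parametrization n \<nu> \<longrightarrow> multiple_loewner_flow n m \<nu> x \<xi> T X g \<longrightarrow>
      (\<forall>t\<in>{0..T}.
        (\<forall>s\<in>{0..t}. pairwise_distinct n m (\<lambda>j. X j s) (\<lambda>l. g s (\<xi> l))) \<longrightarrow>
          Some ` loewner_hull n X g t \<subseteq> real_locus R \<and>
          bij_betw (g t) (upper_half_plane - loewner_hull n X g t) upper_half_plane \<and>
          (\<exists>S \<in> CR m n (\<lambda>j. X j t). \<forall>w \<in> upper_half_plane.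
             sphere_map S (Some w) =
             sphere_map R (Some (inv_into (upper_half_plane - loewner_hull n X g t) (g t) w)))))"
proof -
  \<comment> \<open>Chosen before any parametrization or flow, so one \<open>R\<close> serves them
    all.\<close>
  obtain P where P: "map_poly cnj P = P \<and>
    pderiv P * root_poly \<xi> {1..m} - P * pderiv (root_poly \<xi> {1..m}) = crit_poly n x"
    using real_stationary_wronskian_exists[OF assms(4,6,5)] by (rule exE)
  define R where "R = (\<lambda>z. poly P z / poly (root_poly \<xi> {1..m}) z)"
  note C = CR_of_wronskian[OF assms(4,2,3,5) conjunct1[OF P] conjunct2[OF P], folded R_def]
  have flow: "Some ` loewner_hull n X g t \<subseteq> real_locus R \<and>
          bij_betw (g t) (upper_half_plane - loewner_hull n X g t) upper_half_plane \<and>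
          (\<exists>S \<in> CR m n (\<lambda>j. X j t). \<forall>w \<in> upper_half_plane.
             sphere_map S (Some w) =
             sphere_map R (Some (inv_into (upper_half_plane - loewner_hull n X g t) (g t) w)))"
    if "parametrization n \<nu>" "multiple_loewner_flow n m \<nu> x \<xi> T X g" "t \<in> {0..T}"
      "\<forall>s\<in>{0..t}. pairwise_distinct n m (\<lambda>j. X j s) (\<lambda>l. g s (\<xi> l))" for \<nu> T X g t
  proof -
    interpret loewner_flow n m \<nu> x \<xi> T X g t
      using assms that by unfold_locales auto
    have "wronskian_at 0 P" unfolding wronskian_at_def initial_configuration by (rule P)
    moreover have "quot 0 P = R" unfolding quot_def R_def initial_configuration ..
    ultimately show ?thesis using flow_conclusion[OF assms(6)] by metis
  qed
  show ?thesis
    by (intro bexI[OF _ C(1)] conjI[OF C(2)] allI impI ballI) (rule flow)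
qed

end
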